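(* There exist absolute constants $C_0,C_1>0$ and $c>1$ such that the following holds in the setting of the context. Let $B>1$, let $\theta^\star\in\mathbb R^{d_\theta}$ satisfy $\max_{\alpha\in\mathcal E_s}|\eta_\alpha(\theta^\star)|\le\log B$, let the responses be distributed according to $\mathbb P_{\theta^\star}^{(N)}$, and let $\mathbf W\succ\mathbf 0$. If $N\ge C_0B^3\mu_Qd_\theta^{3/2}\log^3d$, then: (i) with $\mathbb P_{\theta^\star}^{(N)}$-probability at least $1-d^{-c}$, the maximum likelihood estimator $\hat\theta\in\arg\min_{\theta\in\mathbb R^{d_\theta}}\ell(\theta)$ exists and is unique; (ii) the estimation error satisfies $$\mathbb P_{\theta^\star}^{(N)}\Big\{\|\hat\theta-\theta^\star\|_{Q,\infty}\le C_1\Big(\sqrt{\frac{\sigma^2B\mu_Qd_\theta\log d}{N}}+\frac{\sigma B\mu_Qd_\theta^{3/2}}{N}\Big)\Big\}\ge1-d^{-c},$$ $$\mathbb P_{\theta^\star}^{(N)}\Big\{\|\hat\theta-\theta^\star\|_{\nabla^2\ell(\theta^\star)}\le C_1\sqrt{\frac{Bd_\theta\log d}{N}}\Big\}\ge1-d^{-c},$$ where each event is understood to include the existence of $\hat\theta$.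
   Context: Model (Bradley–Terry–Luce with linear-in-parameter utility). Fix an integer $d\ge2$, feature vectors $\phi(\mathbf x_1),\dots,\phi(\mathbf x_d)\in\mathbb R^p$, the matrix $\mathfrak A\in\mathbb R^{d\times p}$ with rows $\phi(\mathbf x_i)^\top$, a scale $\sigma>0$, and a consistent linear system $\mathbf A\mathbf w=\mathbf b$ with $\mathbf A\in\mathbb R^{l\times p}$, $\mathbf b\in\mathbb R^l$. Let $r_A=\mathrm{rank}(\mathbf A)$, $d_\theta=p-r_A\ge1$, let $\mathbf V\in\mathbb R^{p\times d_\theta}$ have orthonormal columns spanning $\mathrm{Null}(\mathbf A)$, and $\mathbf w_o=\mathbf A^\dagger\mathbf b$. Feasible parameters are $\mathbf w=\mathbf w_o+\mathbf V\theta$, $\theta\in\mathbb R^{d_\theta}$. Design: a nonempty set of queries $\mathcal E_s\subseteq\{(i,j):1\le i<j\le d\}$ and integers $n_\alpha\ge1$ ($\alpha\in\mathcal E_s$); $N=\sum_{\alpha\in\mathcal E_s}n_\alpha$. For $\alpha=(i,j)$: $\mathbf a_\alpha=\mathfrak A^\top(\mathbf e_i-\mathbf e_j)$, $\mathbf q_\alpha=\mathbf V^\top\mathbf a_\alpha$, $\eta_\alpha(\theta)=(\mathbf w_o^\top\mathbf a_\alpha+\mathbf q_\alpha^\top\theta)/\sigma$. Responses: $Y^{(N)}=(Y_\alpha^{(t)})_{\alpha\in\mathcal E_s,t\in[n_\alpha]}\in\{0,1\}^N$. Under $\mathbb P_\theta^{(N)}$ the coordinates are independent and $Y_\alpha^{(t)}$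 is Bernoulli with success probability $1/(1+e^{-\eta_\alpha(\theta)})$. Negative log-likelihood: with $\Psi(\eta)=\log(1+e^\eta)$ and $Y_\alpha=\sum_{t=1}^{n_\alpha}Y_\alpha^{(t)}$, $\ \ell(\theta)=\frac1N\sum_{\alpha\in\mathcal E_s}\big[-Y_\alpha\eta_\alpha(\theta)+n_\alpha\Psi(\eta_\alpha(\theta))\big]$; its Hessian $\nabla^2\ell(\theta)=\frac1{N\sigma^2}\sum_{\alpha}n_\alpha\Psi''(\eta_\alpha(\theta))\mathbf q_\alpha\mathbf q_\alpha^\top$ is deterministic. Design matrix: $\mathbf W=\frac1N\sum_{\alpha\in\mathcal E_s}n_\alpha\mathbf q_\alpha\mathbf q_\alpha^\top$. Coherence level: $\mu_Q=\max_{\alpha\in\mathcal E_s}\frac1{d_\theta}\mathbf q_\alpha^\top\mathbf W^{-1}\mathbf q_\alpha$. Norms: $\|\mathbf v\|_{Q,\infty}=\max_{\alpha\in\mathcal E_s}|\mathbf q_\alpha^\top\mathbf v|$, $\|\mathbf v\|_{\mathbf H}=\sqrt{\mathbf v^\top\mathbf H\mathbf v}$. "Absolute constant" means a number independent of all quantities in the problem ($d,p,N,B,\sigma$, the design, $\theta^\star$). *)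

theory Defs
  imports
    "HOL-Probability.Product_PMF"
    "Jordan_Normal_Form.DL_Rank"
    "Jordan_Normal_Form.Matrix_Kernel"
    "Jordan_Normal_Form.Gauss_Jordan_Elimination"
begin

hide_type (open) Finite_Cartesian_Product.vec
unbundle no vec_syntax and no inner_syntax

text \<open>Vectors and matrices are those of \<open>Jordan_Normal_Form\<close>: the dimensions are terms, so that the
  absolute constants of the theorem can be quantified outside of all dimensions.  Coordinates, and
  therefore also the compared items, are numbered from 0.\<close>

definition pos_def_mat :: "nat \<Rightarrow> real mat \<Rightarrow> bool" where
  "pos_def_mat n M \<longleftrightarrow> M \<in> carrier_mat n n \<and> transpose_mat M = M \<and>
     (\<forall>v \<in> carrier_vec n. v \<noteq> 0\<^sub>v n \<longrightarrow> v \<bullet> (M *\<^sub>v v) > 0)"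

definition is_moore_penrose :: "real mat \<Rightarrow> real mat \<Rightarrow> bool" where
  "is_moore_penrose A X \<longleftrightarrow> X \<in> carrier_mat (dim_col A) (dim_row A) \<and>
     A * X * A = A \<and> X * A * X = X \<and>
     transpose_mat (A * X) = A * X \<and> transpose_mat (X * A) = X * A"

definition pinv_mat :: "real mat \<Rightarrow> real mat" where
  "pinv_mat A = (THE X. is_moore_penrose A X)"

text \<open>The entry \<open>(i, j)\<close> is the iterated partial derivative along the coordinates \<open>j\<close> and then \<open>i\<close>.\<close>

definition hessian :: "nat \<Rightarrow> (real vec \<Rightarrow> real) \<Rightarrow> real vec \<Rightarrow> real mat" where
  "hessian n f x = mat n n (\<lambda>(i, j).
     deriv (\<lambda>s. deriv (\<lambda>t. f (x + s \<cdot>\<^sub>v unit_vec n i + t \<cdot>\<^sub>v unit_vec n j)) 0) 0)"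

definition mat_norm :: "real mat \<Rightarrow> real vec \<Rightarrow> real" where
  "mat_norm H v = sqrt (v \<bullet> (H *\<^sub>v v))"

record btl =
  num_items :: nat                       (* d *)
  num_feat :: nat                        (* p *)
  feat :: "nat \<Rightarrow> real vec"              (* feature vector of item i < d *)
  scale :: real                          (* sigma *)
  con_mat :: "real mat"                  (* A *)
  con_rhs :: "real vec"                  (* b *)
  null_basis :: "real mat"               (* V *)
  queries :: "(nat \<times> nat) set"          (* E_s *)
  reps :: "nat \<times> nat \<Rightarrow> nat"             (* n_alpha *)

definition dim_theta :: "btl \<Rightarrow> nat" where
  "dim_theta S = num_feat S - vec_space.rank (dim_row (con_mat S)) (con_mat S)"

definition btl_setting :: "btl \<Rightarrow> bool" where
  "btl_setting S \<longleftrightarrow>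
     num_items S \<ge> 2 \<and>
     (\<forall>i < num_items S. feat S i \<in> carrier_vec (num_feat S)) \<and>
     scale S > 0 \<and>
     dim_col (con_mat S) = num_feat S \<and>
     con_rhs S \<in> carrier_vec (dim_row (con_mat S)) \<and>
     (\<exists>w \<in> carrier_vec (num_feat S). con_mat S *\<^sub>v w = con_rhs S) \<and>
     dim_theta S \<ge> 1 \<and>
     null_basis S \<in> carrier_mat (num_feat S) (dim_theta S) \<and>
     transpose_mat (null_basis S) * null_basis S = 1\<^sub>m (dim_theta S) \<and>
     vec_space.col_space (num_feat S) (null_basis S) = mat_kernel (con_mat S) \<and>
     queries S \<noteq> {} \<and>
     queries S \<subseteq> {(i, j). i < j \<and> j < num_items S} \<and>
     (\<forall>\<alpha> \<in> queries S. reps S \<alpha> \<ge> 1)"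

definition sample_size :: "btl \<Rightarrow> nat" where
  "sample_size S = (\<Sum>\<alpha>\<in>queries S. reps S \<alpha>)"

definition feat_mat :: "btl \<Rightarrow> real mat" where
  "feat_mat S = mat_of_rows (num_feat S) (map (feat S) [0..<num_items S])"

definition w_base :: "btl \<Rightarrow> real vec" where
  "w_base S = pinv_mat (con_mat S) *\<^sub>v con_rhs S"

definition query_vec :: "btl \<Rightarrow> nat \<times> nat \<Rightarrow> real vec" where
  "query_vec S = (\<lambda>(i, j). transpose_mat (feat_mat S) *\<^sub>v
     (unit_vec (num_items S) i - unit_vec (num_items S) j))"

definition red_query_vec :: "btl \<Rightarrow> nat \<times> nat \<Rightarrow> real vec" where
  "red_query_vec S \<alpha> = transpose_mat (null_basis S) *\<^sub>v query_vec S \<alpha>"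

definition logit :: "btl \<Rightarrow> real vec \<Rightarrow> nat \<times> nat \<Rightarrow> real" where
  "logit S \<theta> \<alpha> = (w_base S \<bullet> query_vec S \<alpha> + red_query_vec S \<alpha> \<bullet> \<theta>) / scale S"

text \<open>A response \<open>y\<close> assigns a truth value (1 is \<open>True\<close>) to each index \<open>(\<alpha>, t)\<close>, with the
  repetitions \<open>t\<close> numbered from 0; outside of the index set it is \<open>False\<close> almost surely.\<close>

type_synonym response = "(nat \<times> nat) \<times> nat \<Rightarrow> bool"

definition response_pmf :: "btl \<Rightarrow> real vec \<Rightarrow> response pmf" where
  "response_pmf S \<theta> = Pi_pmf (SIGMA \<alpha>:queries S. {..<reps S \<alpha>}) False
     (\<lambda>(\<alpha>, t). bernoulli_pmf (1 / (1 + exp (- logit S \<theta> \<alpha>))))"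

definition neg_log_lik :: "btl \<Rightarrow> response \<Rightarrow> real vec \<Rightarrow> real" where
  "neg_log_lik S y \<theta> = 1 / real (sample_size S) * (\<Sum>\<alpha>\<in>queries S.
     - (\<Sum>t<reps S \<alpha>. of_bool (y (\<alpha>, t))) * logit S \<theta> \<alpha>
     + real (reps S \<alpha>) * ln (1 + exp (logit S \<theta> \<alpha>)))"

definition is_mle :: "btl \<Rightarrow> response \<Rightarrow> real vec \<Rightarrow> bool" where
  "is_mle S y = is_arg_min (neg_log_lik S y) (\<lambda>\<theta>. \<theta> \<in> carrier_vec (dim_theta S))"

definition design_mat :: "btl \<Rightarrow> real mat" where
  "design_mat S = mat (dim_theta S) (dim_theta S) (\<lambda>(i, j).
     1 / real (sample_size S) * (\<Sum>\<alpha>\<in>queries S.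
       real (reps S \<alpha>) * (red_query_vec S \<alpha> $ i * red_query_vec S \<alpha> $ j)))"

definition coherence :: "btl \<Rightarrow> real" where
  "coherence S = (MAX \<alpha>\<in>queries S. 1 / real (dim_theta S) *
     (red_query_vec S \<alpha> \<bullet> (the (mat_inverse (design_mat S)) *\<^sub>v red_query_vec S \<alpha>)))"

definition query_norm :: "btl \<Rightarrow> real vec \<Rightarrow> real" where
  "query_norm S v = (MAX \<alpha>\<in>queries S. \<bar>red_query_vec S \<alpha> \<bullet> v\<bar>)"

text \<open>The Hessian of the negative log-likelihood does not depend on the responses, and
  \<open>exp \<eta> / (1 + exp \<eta>)\<^sup>2\<close> is the second derivative of \<open>ln (1 + exp \<eta>)\<close>.\<close>

lemma hessian_neg_log_lik:
  assumes S: "btl_setting S" and \<theta>: "\<theta> \<in> carrier_vec (dim_theta S)"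
  shows "hessian (dim_theta S) (neg_log_lik S y) \<theta> = mat (dim_theta S) (dim_theta S) (\<lambda>(i, j).
    1 / (real (sample_size S) * (scale S)\<^sup>2) * (\<Sum>\<alpha>\<in>queries S. real (reps S \<alpha>) *
      (exp (logit S \<theta> \<alpha>) / (1 + exp (logit S \<theta> \<alpha>))\<^sup>2) *
      (red_query_vec S \<alpha> $ i * red_query_vec S \<alpha> $ j)))"
proof (rule eq_matI; simp add: hessian_def; safe?)
  fix i j assume ij: "i < dim_theta S" "j < dim_theta S"
  define q where "q = red_query_vec S"
  define \<sigma> where "\<sigma> = scale S"
  have \<sigma>: "\<sigma> > 0" using S by (simp add: btl_setting_def \<sigma>_def)
  have q: "q \<alpha> \<in> carrier_vec (dim_theta S)" for \<alpha>
    using S by (intro carrier_vecI) (auto simp: btl_setting_def q_def red_query_vec_def)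
  have l: "logit S (\<theta> + s \<cdot>\<^sub>v unit_vec (dim_theta S) i + t \<cdot>\<^sub>v unit_vec (dim_theta S) j) \<alpha>
      = logit S \<theta> \<alpha> + (s * q \<alpha> $ i + t * q \<alpha> $ j) / \<sigma>" for s t \<alpha>
    using \<theta> q[of \<alpha>] ij
    by (simp add: logit_def q_def[symmetric] \<sigma>_def[symmetric]
        scalar_prod_add_distrib[of _ "dim_theta S"] add_divide_distrib)
  define Y where "Y \<alpha> = (\<Sum>t<reps S \<alpha>. of_bool (y (\<alpha>, t)) :: real)" for \<alpha>
  define N where "N = real (sample_size S)"
  have pos: "1 + exp x \<noteq> 0" for x :: real by (smt (verit) exp_gt_zero)
  have dt: "((\<lambda>t. - Yv * (e + (s * a + t * b) / \<sigma>) + n * ln (1 + exp (e + (s * a + t * b) / \<sigma>)))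
      has_real_derivative (- Yv + n * (1 - 1 / (1 + exp (e + s * a / \<sigma>)))) * (b / \<sigma>)) (at 0)"
    for Yv e s a b n :: real
  proof -
    have "((\<lambda>t. e + (s * a + t * b) / \<sigma>) has_real_derivative b / \<sigma>) (at 0)"
      using \<sigma> by (auto intro!: derivative_eq_intros)
    note D = this
    have "((\<lambda>t. - Yv * (e + (s * a + t * b) / \<sigma>) + n * ln (1 + exp (e + (s * a + t * b) / \<sigma>)))
      has_real_derivative - Yv * (b / \<sigma>) + n * (1 / (1 + exp (e + (s * a + 0 * b) / \<sigma>))
        * (0 + exp (e + (s * a + 0 * b) / \<sigma>) * (b / \<sigma>)))) (at 0)"
      by (rule DERIV_add DERIV_cmult DERIV_chain2[OF DERIV_ln_divide] DERIV_const
          DERIV_chain2[OF DERIV_exp] D | (simp add: add_pos_pos; fail))+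
    moreover have eq: "1 - 1 / (1 + exp x) = exp x / (1 + exp x)" for x :: real
      using pos[of x] by (simp add: diff_divide_eq_iff)
    ultimately show ?thesis
      unfolding eq by (elim DERIV_cong) (simp add: left_diff_distrib diff_divide_distrib)
  qed
  have ds: "((\<lambda>s. (- Yv + n * (1 - 1 / (1 + exp (e + s * a / \<sigma>)))) * (b / \<sigma>))
      has_real_derivative n * (exp e / (1 + exp e)\<^sup>2) * (a * b) / \<sigma>\<^sup>2) (at 0)"
    for Yv e a b n :: real
    using \<sigma> by (auto intro!: derivative_eq_intros simp: pos power2_eq_square)
  have d1: "deriv (\<lambda>t. neg_log_lik S y (\<theta> + s \<cdot>\<^sub>v unit_vec (dim_theta S) i + t \<cdot>\<^sub>v unit_vec (dim_theta S) j)) 0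
     = 1 / N * (\<Sum>\<alpha>\<in>queries S. (- Y \<alpha> + real (reps S \<alpha>) * (1 - 1 / (1 + exp (logit S \<theta> \<alpha> + s * q \<alpha> $ i / \<sigma>)))) * (q \<alpha> $ j / \<sigma>))" for s
    unfolding neg_log_lik_def l Y_def[symmetric] N_def[symmetric]
    by (intro DERIV_imp_deriv DERIV_cmult DERIV_sum dt)
  have "deriv (\<lambda>s. deriv (\<lambda>t. neg_log_lik S y (\<theta> + s \<cdot>\<^sub>v unit_vec (dim_theta S) i + t \<cdot>\<^sub>v unit_vec (dim_theta S) j)) 0) 0
    = 1 / N * (\<Sum>\<alpha>\<in>queries S. real (reps S \<alpha>) * (exp (logit S \<theta> \<alpha>) / (1 + exp (logit S \<theta> \<alpha>))\<^sup>2) *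
      (q \<alpha> $ i * q \<alpha> $ j) / \<sigma>\<^sup>2)"
    unfolding d1 by (intro DERIV_imp_deriv DERIV_cmult DERIV_sum ds)
  then show "deriv (\<lambda>s. deriv (\<lambda>t. neg_log_lik S y (\<theta> + s \<cdot>\<^sub>v unit_vec (dim_theta S) i + t \<cdot>\<^sub>v unit_vec (dim_theta S) j)) 0) 0
    = (\<Sum>\<alpha>\<in>queries S. real (reps S \<alpha>) * exp (logit S \<theta> \<alpha>) * (red_query_vec S \<alpha> $ i * red_query_vec S \<alpha> $ j) / (1 + exp (logit S \<theta> \<alpha>))\<^sup>2) / (real (sample_size S) * (scale S)\<^sup>2)"
    unfolding q_def[symmetric] \<sigma>_def[symmetric] N_def[symmetric]
    by (simp add: sum_divide_distrib mult_ac)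
qed

end

theory Submission
  imports Defs
begin

text \<open>With \<open>x\<^sub>a = q\<^sub>a / \<sigma>\<close>, \<open>v\<^sub>a = n\<^sub>a \<Psi>''(\<eta>\<^sub>a)\<close> and \<open>H = \<Sum>\<^sub>a v\<^sub>a x\<^sub>a x\<^sub>a\<^sup>T\<close>, everything is expressed through the kernel
  \<open>g a b = x\<^sub>a \<bullet> H\<^sup>-\<^sup>1 x\<^sub>b\<close>, a projection in the weighted space \<open>\<ell>\<^sup>2(v)\<close> with trace \<open>k = d\<^sub>\<theta>\<close> and diagonal at most
  \<open>lv = 4 B \<mu> k / N\<close>.  A Newton step from the truth moves the linear predictors by \<open>z = g s\<close>, where \<open>s\<close>
  are the centred counts; by Bernstein's inequality \<open>z\<^sub>a\<^sup>2 \<le> 9 \<tau> g a a\<close> for all \<open>a\<close>, where \<open>\<tau>\<close> is of order \<open>ln d\<close>.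
  Since the third derivative of \<open>\<Psi>\<close> is dominated by the second, the error of a Newton step is governed
  by the quadratic forms \<open>\<Sum>\<^sub>c v\<^sub>c \<bar>g b c\<bar> z\<^sub>c\<^sup>2\<close>.  Their means are at most \<open>lv \<surd>k\<close>, and a martingale bound for
  their fluctuations avoids the factor \<open>\<tau>\<close> that the entrywise bound on \<open>z\<close> would put in front of it.
  On these events the Newton map sends a small convex compact set into itself.  A minimiser of the loss
  over that set is then stationary, because the Newton step is a descent direction that stays inside,
  and convexity makes it the unique global minimiser.\<close>

section \<open>The logistic function\<close>

text \<open>The sup norm asks for each predictor separately, while convexity of the loss controls
  only the energy; the Newton map is therefore estimated in both norms together. Only invariance of
  a set is derived, not a contraction, so compactness and descent take the place of a fixed point
  theorem. The two summands of the sup bound differ in origin: the square root is the size of the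
  linear fluctuation \<open>z\<close>, the other is the mean \<open>lv * sqrt k\<close> of the
  quadratic forms. Up to a multiple of that mean, their fluctuations are of order
  \<open>\<tau>\<^sup>2 * lv\<close>, because the weighted Hilbert-Schmidt norm of the matrix of
  such a form is at most \<open>lv\<close>, without a factor \<open>sqrt k\<close>. They are
  absorbed into \<open>sqrt (\<tau> * lv)\<close> as soon as \<open>\<tau> ^ 3 * lv \<le> 1\<close>,
  which is the origin of the cubed logarithm; the power 3/2 of the dimension is the \<open>k\<close>
  inside \<open>lv\<close> times the \<open>sqrt k\<close> of the mean. The choice
  \<open>\<tau> = 9 * ln d\<close> outweighs a union bound over at most \<open>d\<^sup>2\<close>
  queries whose individual failure probabilities are of order
  \<open>d\<^sup>2 * exp (- \<tau>)\<close>.\<close>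

definition sigm :: "real \<Rightarrow> real" where
  "sigm x = 1 / (1 + exp (- x))"

definition dsigm :: "real \<Rightarrow> real" where
  "dsigm x = exp x / (1 + exp x)\<^sup>2"

lemma one_plus_exp_pos: "1 + exp x > (0::real)"
  by (simp add: add_pos_pos)

lemma sigm_altdef: "sigm x = exp x / (1 + exp x)"
  using one_plus_exp_pos[of x] one_plus_exp_pos[of "-x"]
  by (simp add: sigm_def field_simps exp_minus)

lemma sigm_bounds: "0 < sigm x" "sigm x < 1"
  by (simp_all add: sigm_altdef one_plus_exp_pos)

lemma dsigm_pos: "dsigm x > 0"
  using one_plus_exp_pos[of x] by (simp add: dsigm_def)

lemma dsigm_eq: "dsigm x = sigm x * (1 - sigm x)"
  using one_plus_exp_pos[of x] by (simp add: dsigm_def sigm_altdef field_simps power2_eq_square)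

lemma DERIV_softplus: "((\<lambda>x. ln (1 + exp x)) has_real_derivative sigm x) (at x)"
  by (auto intro!: derivative_eq_intros simp: one_plus_exp_pos sigm_altdef)

lemma sigm_strict_mono: "a < b \<Longrightarrow> sigm a < sigm b"
  unfolding sigm_def by (intro divide_strict_left_mono) (auto simp: one_plus_exp_pos)

lemma softplus_gt_tangent:
  assumes "a \<noteq> b"
  shows "ln (1 + exp b) > ln (1 + exp a) + sigm a * (b - a)"
proof (cases "a < b")
  case True
  obtain z where "a < z" "z < b" "ln (1 + exp b) - ln (1 + exp a) = (b - a) * sigm z"
    using MVT2[OF True, of "\<lambda>x. ln (1 + exp x)" sigm] DERIV_softplus by auto
  moreover have "sigm a * (b - a) < sigm z * (b - a)"
    using True sigm_strict_mono[OF \<open>a < z\<close>] by simp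
  ultimately show ?thesis by (simp only: mult.commute[of "b - a"])
next
  case False
  hence True: "b < a" using assms by simp
  obtain z where "b < z" "z < a" "ln (1 + exp a) - ln (1 + exp b) = (a - b) * sigm z"
    using MVT2[OF True, of "\<lambda>x. ln (1 + exp x)" sigm] DERIV_softplus by auto
  moreover have "sigm z * (a - b) < sigm a * (a - b)"
    using True sigm_strict_mono[OF \<open>z < a\<close>] by simp
  ultimately show ?thesis by (simp add: algebra_simps)
qed

lemma exp_le_quadratic:
  fixes y :: real
  assumes "\<bar>y\<bar> \<le> 1"
  shows "exp y \<le> 1 + y + y\<^sup>2"
proof (cases "y \<ge> 0")
  case True
  thus ?thesis using assms exp_bound[of y] by simp
next
  case False
  \<comment> \<open>For negative \<open>y\<close> the exponential is at most
    \<open>1 / (1 - y)\<close>; that this product is at least 1 turns the bound into the polynomial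
    one.\<close>
  have "(1 + y + y\<^sup>2) * (1 - y) = 1 - y * y\<^sup>2"
    by (simp add: algebra_simps power2_eq_square)
  also have "\<dots> \<ge> 1" using False by (simp add: mult_le_0_iff)
  finally have 1: "(1 + y + y\<^sup>2) * (1 - y) \<ge> 1" .
  have "exp y = 1 / exp (- y)" by (simp add: exp_minus field_simps)
  also have "\<dots> \<le> 1 / (1 - y)"
    using False exp_ge_add_one_self[of "- y"] by (intro divide_left_mono) auto
  also have "\<dots> \<le> 1 + y + y\<^sup>2"
    using 1 False by (simp add: divide_le_eq)
  finally show ?thesis .
qed

text \<open>Divided by \<open>dsigm x\<close>, the increment of \<open>sigm\<close> lies between
  \<open>1 - exp (- z)\<close> and \<open>exp z - 1\<close>, whatever \<open>x\<close> is. The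
  Taylor error is thus relative to the second derivative of the loss, and no factor \<open>B\<close>
  enters through it.\<close>

lemma sigm_second_order:
  assumes "\<bar>z\<bar> \<le> 1"
  shows "\<bar>sigm (x + z) - sigm x - dsigm x * z\<bar> \<le> dsigm x * z\<^sup>2"
proof -
  define a where "a = exp x"
  define b where "b = exp z"
  define f where "f = (b - 1) * (1 + a) / (1 + a * b)"
  have a: "a > 0" and b: "b > 0" by (auto simp: a_def b_def)
  have pos: "1 + a > 0" "1 + a * b > 0" using a b by (auto intro: add_pos_pos)
  have f: "sigm (x + z) - sigm x = dsigm x * f"
    using pos unfolding sigm_altdef dsigm_def f_def exp_add a_def[symmetric] b_def[symmetric]
    by (simp add: divide_simps) (simp add: algebra_simps power2_eq_square)
  \<comment> \<open>After clearing denominators, this bound and the lower one reduce to a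
    nonnegative multiple of \<open>(b - 1)\<^sup>2\<close>.\<close>
  have up: "f \<le> b - 1"
  proof -
    have "(b - 1) * (1 + a) \<le> (b - 1) * (1 + a * b)"
    proof -
      have "(b - 1) * (1 + a * b) - (b - 1) * (1 + a) = a * (b - 1)\<^sup>2"
        by (simp add: algebra_simps power2_eq_square)
      moreover have "a * (b - 1)\<^sup>2 \<ge> 0" using a by simp
      ultimately show ?thesis by linarith
    qed
    thus ?thesis using pos by (simp add: f_def divide_le_eq)
  qed
  have lo: "1 - exp (- z) \<le> f"
  proof -
    have "(b - 1) / b \<le> f"
    proof -
      have "b * ((b - 1) * (1 + a)) - (b - 1) * (1 + a * b) = (b - 1)\<^sup>2"
        by (simp add: algebra_simps power2_eq_square)
      hence "(b - 1) * (1 + a * b) \<le> b * ((b - 1) * (1 + a))"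
        by (smt (verit) zero_le_power2)
      thus ?thesis using pos b by (simp add: f_def divide_simps mult_ac)
    qed
    moreover have "(b - 1) / b = 1 - exp (- z)"
      using b by (simp add: b_def exp_minus field_simps)
    ultimately show ?thesis by simp
  qed
  have e: "f \<le> z + z\<^sup>2" "f \<ge> z - z\<^sup>2"
    using up lo exp_le_quadratic[of z] exp_le_quadratic[of "- z"] assms by (auto simp: b_def)
  have "sigm (x + z) - sigm x - dsigm x * z = dsigm x * (f - z)"
    using f by (simp add: algebra_simps)
  moreover have "\<bar>f - z\<bar> \<le> z\<^sup>2" using e by linarith
  ultimately show ?thesis
    using dsigm_pos[of x] by (simp add: abs_mult)
qed

lemma Cauchy_Schwarz_sum_weighted:
  fixes v a b :: "'a \<Rightarrow> real"
  assumes "\<And>i. i \<in> Q \<Longrightarrow> v i \<ge> 0"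
  shows "(\<Sum>i\<in>Q. v i * a i * b i)\<^sup>2 \<le> (\<Sum>i\<in>Q. v i * (a i)\<^sup>2) * (\<Sum>i\<in>Q. v i * (b i)\<^sup>2)"
proof -
  have 1: "(\<Sum>i\<in>Q. v i * a i * b i) = (\<Sum>i\<in>Q. (sqrt (v i) * a i) * (sqrt (v i) * b i))"
    using assms by (intro sum.cong) (auto simp: algebra_simps)
  have 2: "(\<Sum>i\<in>Q. v i * (c i)\<^sup>2) = (\<Sum>i\<in>Q. (sqrt (v i) * c i)\<^sup>2)" for c
    using assms by (intro sum.cong) (auto simp: power_mult_distrib)
  show ?thesis unfolding 1 2 by (rule Cauchy_Schwarz_ineq_sum)
qed

section \<open>Projection kernels\<close>

text \<open>The matrix with entries \<open>sqrt (v a) * g a b * sqrt (v b)\<close> is the hat matrix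
  of a weighted regression, an orthogonal projection. The analysis works with positive weights,
  symmetry and idempotence; matrices return only when the model is instantiated.\<close>

locale projection_kernel =
  fixes Q :: "'a set" and v :: "'a \<Rightarrow> real" and g :: "'a \<Rightarrow> 'a \<Rightarrow> real"
  assumes finite_Q: "finite Q"
    and v_pos: "a \<in> Q \<Longrightarrow> v a > 0"
    and g_sym: "a \<in> Q \<Longrightarrow> b \<in> Q \<Longrightarrow> g a b = g b a"
    and g_idem: "a \<in> Q \<Longrightarrow> b \<in> Q \<Longrightarrow> (\<Sum>c\<in>Q. v c * g a c * g c b) = g a b"
begin

lemma v_nonneg: "a \<in> Q \<Longrightarrow> v a \<ge> 0"
  using v_pos[of a] by simp

lemma g_diag_eq: "a \<in> Q \<Longrightarrow> (\<Sum>c\<in>Q. v c * (g a c)\<^sup>2) = g a a"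
  using g_idem[of a a] g_sym by (simp add: power2_eq_square mult.assoc)

lemma g_diag_eq':
  assumes a: "a \<in> Q"
  shows "(\<Sum>c\<in>Q. v c * (g c a)\<^sup>2) = g a a"
proof -
  have "(\<Sum>c\<in>Q. v c * (g c a)\<^sup>2) = (\<Sum>c\<in>Q. v c * (g a c)\<^sup>2)"
    using g_sym[OF a] by (intro sum.cong refl) simp
  thus ?thesis by (simp only: g_diag_eq[OF a])
qed

lemma g_diag_nonneg: "a \<in> Q \<Longrightarrow> g a a \<ge> 0"
  using g_diag_eq[of a] sum_nonneg[of Q "\<lambda>c. v c * (g a c)\<^sup>2"] v_nonneg by simp

lemma g_square_le:
  assumes "a \<in> Q" "b \<in> Q"
  shows "(g a b)\<^sup>2 \<le> g a a * g b b"
  using Cauchy_Schwarz_sum_weighted[of Q v "g a" "\<lambda>c. g c b"] v_nonneg assms g_idem[of a b]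
    g_diag_eq[of a] g_diag_eq[of b] g_sym by simp

lemma abs_g_le:
  assumes "a \<in> Q" "b \<in> Q"
  shows "\<bar>g a b\<bar> \<le> sqrt (g a a) * sqrt (g b b)"
  using real_sqrt_le_mono[OF g_square_le[OF assms]] by (simp add: real_sqrt_mult)

text \<open>Leverages are at most 1: the summand \<open>c = a\<close> of \<open>g_diag_eq\<close> is
  \<open>v a * (g a a)\<^sup>2\<close>, and one factor \<open>g a a\<close> cancels.\<close>

lemma v_g_diag_le_1:
  assumes "a \<in> Q"
  shows "v a * g a a \<le> 1"
proof (cases "g a a = 0")
  case False
  hence pos: "g a a > 0" using g_diag_nonneg[OF assms] by simp
  have "v a * (g a a)\<^sup>2 \<le> (\<Sum>c\<in>Q. v c * (g a c)\<^sup>2)"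
    using assms v_nonneg finite_Q by (intro member_le_sum) auto
  hence "v a * g a a * g a a \<le> 1 * g a a"
    using g_diag_eq[OF assms] by (simp add: power2_eq_square mult.assoc)
  thus ?thesis using pos by (rule mult_right_le_imp_le)
qed auto

definition proj :: "('a \<Rightarrow> real) \<Rightarrow> 'a \<Rightarrow> real" where
  "proj c b = (\<Sum>a\<in>Q. v a * g b a * c a)"

text \<open>In the weighted inner product a self-adjoint idempotent satisfies
  \<open><Pc, Pc> = <c, Pc>\<close>. After exchanging sums, the inner sum over \<open>b\<close> is
  evaluated by \<open>g_idem\<close>.\<close>

lemma proj_quadratic:
  "(\<Sum>b\<in>Q. v b * (proj c b)\<^sup>2) = (\<Sum>a\<in>Q. v a * c a * proj c a)"
proof -
  have "(\<Sum>b\<in>Q. v b * (proj c b)\<^sup>2)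
      = (\<Sum>b\<in>Q. \<Sum>a\<in>Q. \<Sum>a'\<in>Q. (v a * c a) * (v a' * c a') * (v b * g a b * g b a'))"
  proof (rule sum.cong[OF refl])
    fix b assume b: "b \<in> Q"
    have "v b * (proj c b)\<^sup>2 = v b * (\<Sum>a\<in>Q. \<Sum>a'\<in>Q. (v a * g b a * c a) * (v a' * g b a' * c a'))"
      unfolding proj_def power2_eq_square sum_product ..
    also have "\<dots> = (\<Sum>a\<in>Q. \<Sum>a'\<in>Q. v b * ((v a * g b a * c a) * (v a' * g b a' * c a')))"
      by (simp only: sum_distrib_left)
    also have "\<dots> = (\<Sum>a\<in>Q. \<Sum>a'\<in>Q. (v a * c a) * (v a' * c a') * (v b * g a b * g b a'))"
      using b by (intro sum.cong refl) (simp add: g_sym[of b])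
    finally show "v b * (proj c b)\<^sup>2
      = (\<Sum>a\<in>Q. \<Sum>a'\<in>Q. (v a * c a) * (v a' * c a') * (v b * g a b * g b a'))" .
  qed
  also have "\<dots> = (\<Sum>a\<in>Q. \<Sum>b\<in>Q. \<Sum>a'\<in>Q. (v a * c a) * (v a' * c a') * (v b * g a b * g b a'))"
    by (rule sum.swap)
  also have "\<dots> = (\<Sum>a\<in>Q. \<Sum>a'\<in>Q. \<Sum>b\<in>Q. (v a * c a) * (v a' * c a') * (v b * g a b * g b a'))"
    by (rule sum.cong[OF refl], rule sum.swap)
  also have "\<dots> = (\<Sum>a\<in>Q. \<Sum>a'\<in>Q. (v a * c a) * (v a' * c a') * (\<Sum>b\<in>Q. v b * g a b * g b a'))"
    by (simp only: sum_distrib_left)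
  also have "\<dots> = (\<Sum>a\<in>Q. v a * c a * proj c a)"
  proof -
    have "(\<Sum>a\<in>Q. \<Sum>a'\<in>Q. (v a * c a) * (v a' * c a') * (\<Sum>b\<in>Q. v b * g a b * g b a'))
      = (\<Sum>a\<in>Q. \<Sum>a'\<in>Q. (v a * c a) * (v a' * c a') * g a a')"
      by (intro sum.cong refl arg_cong2[of _ _ _ _ "(*)"] g_idem)
    thus ?thesis unfolding proj_def by (simp add: sum_distrib_left mult_ac)
  qed
  finally show ?thesis .
qed

text \<open>With \<open>p\<close> the left-hand side, Cauchy-Schwarz applied to
  \<open>proj_quadratic\<close> bounds \<open>p\<^sup>2\<close> by \<open>p\<close> times the
  right-hand side, and \<open>p\<close> cancels unless it is 0.\<close>

lemma proj_contraction: "(\<Sum>b\<in>Q. v b * (proj c b)\<^sup>2) \<le> (\<Sum>a\<in>Q. v a * (c a)\<^sup>2)"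
proof -
  define p where "p = (\<Sum>b\<in>Q. v b * (proj c b)\<^sup>2)"
  have "p\<^sup>2 \<le> (\<Sum>a\<in>Q. v a * (c a)\<^sup>2) * p"
    using Cauchy_Schwarz_sum_weighted[of Q v c "proj c"] v_nonneg proj_quadratic[of c]
    by (simp add: p_def)
  hence le: "p * p \<le> (\<Sum>a\<in>Q. v a * (c a)\<^sup>2) * p" by (simp add: power2_eq_square)
  have "p \<ge> 0" unfolding p_def using v_nonneg by (intro sum_nonneg) auto
  have nn: "(\<Sum>a\<in>Q. v a * (c a)\<^sup>2) \<ge> 0" using v_nonneg by (intro sum_nonneg) auto
  have "p \<le> (\<Sum>a\<in>Q. v a * (c a)\<^sup>2)"
  proof (cases "p = 0")
    case False
    hence "p > 0" using \<open>p \<ge> 0\<close> by simp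
    thus ?thesis using le by (rule mult_right_le_imp_le[rotated])
  qed (use nn in simp)
  thus ?thesis unfolding p_def .
qed

lemma proj_idem: "b \<in> Q \<Longrightarrow> proj (proj c) b = proj c b"
proof -
  assume b: "b \<in> Q"
  have "proj (proj c) b = (\<Sum>a\<in>Q. \<Sum>a'\<in>Q. v a' * c a' * (v a * g b a * g a a'))"
    unfolding proj_def sum_distrib_left by (intro sum.cong refl) auto
  also have "\<dots> = (\<Sum>a'\<in>Q. v a' * c a' * (\<Sum>a\<in>Q. v a * g b a * g a a'))"
    unfolding sum_distrib_left by (rule sum.swap)
  also have "\<dots> = proj c b"
    unfolding proj_def using b by (intro sum.cong refl) (auto simp: g_idem)
  finally show ?thesis .
qed

text \<open>In the model these are exactly the displacements of the linear predictors that some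
  parameter realises, so minimising over this set replaces minimising over parameters.\<close>

definition range_proj :: "('a \<Rightarrow> real) set" where
  "range_proj = {z. (\<forall>a. a \<notin> Q \<longrightarrow> z a = 0) \<and> (\<forall>a\<in>Q. z a = proj z a)}"

lemma range_projI:
  assumes "\<And>a. a \<notin> Q \<Longrightarrow> z a = 0" "\<And>a. a \<in> Q \<Longrightarrow> proj z a = z a"
  shows "z \<in> range_proj"
  using assms by (simp add: range_proj_def)

lemma range_projD:
  assumes "z \<in> range_proj"
  shows "a \<notin> Q \<Longrightarrow> z a = 0" "a \<in> Q \<Longrightarrow> proj z a = z a"
  using assms by (simp_all add: range_proj_def)

text \<open>Functions on \<open>Q\<close> are extended by 0, so that compactness is available in the product topology.\<close>

lemma compact_range_proj_box:
  "compact {z \<in> range_proj. (\<forall>a\<in>Q. \<bar>z a - z1 a\<bar> \<le> \<rho>) \<and> (\<Sum>a\<in>Q. v a * (z a - z1 a)\<^sup>2) \<le> R}"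
proof -
  let ?box = "PiE UNIV (\<lambda>a. if a \<in> Q then {z1 a - \<rho>..z1 a + \<rho>} else {0})"
  have box: "compact ?box"
  proof -
    have "compactin (product_topology (\<lambda>_. euclidean) UNIV) ?box"
      unfolding compactin_PiE by simp
    thus ?thesis unfolding euclidean_product_topology compactin_euclidean_iff .
  qed
  have closed: "closed {z. (\<forall>a\<in>Q. z a = proj z a) \<and> (\<Sum>a\<in>Q. v a * (z a - z1 a)\<^sup>2) \<le> R}"
  proof -
    have coord: "continuous_on UNIV (\<lambda>z :: 'a \<Rightarrow> real. z a)" for a
      by (rule continuous_on_product_coordinates)
    show ?thesis
      unfolding proj_def Collect_conj_eq Collect_ball_eq
      by (intro closed_Int closed_INT ballI closed_Collect_eq closed_Collect_le continuous_on_sum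
          continuous_on_mult continuous_on_power continuous_on_diff continuous_on_const coord)
  qed
  have "{z \<in> range_proj. (\<forall>a\<in>Q. \<bar>z a - z1 a\<bar> \<le> \<rho>) \<and> (\<Sum>a\<in>Q. v a * (z a - z1 a)\<^sup>2) \<le> R}
    = ?box \<inter> {z. (\<forall>a\<in>Q. z a = proj z a) \<and> (\<Sum>a\<in>Q. v a * (z a - z1 a)\<^sup>2) \<le> R}"
  proof -
    have box_iff: "z \<in> ?box \<longleftrightarrow> (\<forall>a. a \<notin> Q \<longrightarrow> z a = 0) \<and> (\<forall>a\<in>Q. \<bar>z a - z1 a\<bar> \<le> \<rho>)" for z
    proof -
      have "z a \<in> (if a \<in> Q then {z1 a - \<rho>..z1 a + \<rho>} else {0})
          \<longleftrightarrow> (a \<notin> Q \<longrightarrow> z a = 0) \<and> (a \<in> Q \<longrightarrow> \<bar>z a - z1 a\<bar> \<le> \<rho>)" for a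
        by (cases "a \<in> Q") (simp_all, linarith)
      thus ?thesis unfolding PiE_UNIV_domain Pi_iff by (simp only: ball_UNIV) meson
    qed
    show ?thesis by (rule Set.set_eqI) (simp only: range_proj_def mem_Collect_eq Int_iff box_iff conj_ac)
  qed
  thus ?thesis using compact_Int_closed[OF box closed] by simp
qed

end

section \<open>Newton steps for the logistic loss\<close>

text \<open>Deterministic part: \<open>x\<close> holds the predictors at the truth, \<open>z\<close>
  below is a displacement of them, and \<open>y\<close> is an arbitrary vector of counts.\<close>

locale logistic_kernel = projection_kernel Q v g
  for Q :: "'a set" and v :: "'a \<Rightarrow> real" and g :: "'a \<Rightarrow> 'a \<Rightarrow> real" +
  fixes x n y :: "'a \<Rightarrow> real"
  assumes n_pos: "a \<in> Q \<Longrightarrow> n a > 0"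
    and v_eq: "a \<in> Q \<Longrightarrow> v a = n a * dsigm (x a)"
begin

definition loss :: "('a \<Rightarrow> real) \<Rightarrow> real" where
  "loss z = (\<Sum>a\<in>Q. - y a * (x a + z a) + n a * ln (1 + exp (x a + z a)))"

definition grad :: "('a \<Rightarrow> real) \<Rightarrow> 'a \<Rightarrow> real" where
  "grad z a = n a * sigm (x a + z a) - y a"

text \<open>The Hessian behind \<open>g\<close> is frozen at the truth, so this is a simplified
  (chord) Newton step, expressed as a change of the predictors. At \<open>z = 0\<close> it coincides
  with \<open>lin_est\<close>.\<close>

definition newton_step :: "('a \<Rightarrow> real) \<Rightarrow> 'a \<Rightarrow> real" where
  "newton_step z b = (if b \<in> Q then - (\<Sum>a\<in>Q. g b a * grad z a) else 0)"

definition lin_est :: "'a \<Rightarrow> real" where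
  "lin_est b = (if b \<in> Q then \<Sum>a\<in>Q. g b a * (y a - n a * sigm (x a)) else 0)"

definition remainder :: "('a \<Rightarrow> real) \<Rightarrow> 'a \<Rightarrow> real" where
  "remainder z a = n a * (sigm (x a + z a) - sigm (x a) - dsigm (x a) * z a)"

lemma sum_g_eq_proj: "b \<in> Q \<Longrightarrow> (\<Sum>a\<in>Q. g b a * c a) = proj (\<lambda>a. c a / v a) b"
  unfolding proj_def using v_pos by (intro sum.cong refl) force

lemma sum_g_in_range: "(\<lambda>b. if b \<in> Q then \<Sum>a\<in>Q. g b a * c a else 0) \<in> range_proj"
proof -
  have "proj (\<lambda>b. if b \<in> Q then \<Sum>a\<in>Q. g b a * c a else 0) = proj (proj (\<lambda>a. c a / v a))"
    unfolding proj_def[of "\<lambda>b. if b \<in> Q then _ b else 0"] proj_def[of "proj _"]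
    by (intro ext sum.cong refl) (simp add: sum_g_eq_proj)
  thus ?thesis by (intro range_projI) (simp_all add: sum_g_eq_proj proj_idem)
qed

lemma lin_est_in_range: "lin_est \<in> range_proj"
  using sum_g_in_range[of "\<lambda>a. y a - n a * sigm (x a)"] unfolding lin_est_def[abs_def] .

lemma proj_add: "proj (\<lambda>a. z a + t * z' a) b = proj z b + t * proj z' b"
  unfolding proj_def sum_distrib_left sum.distrib[symmetric]
  by (intro sum.cong refl) (simp add: distrib_left)

lemma range_proj_add:
  assumes "z \<in> range_proj" "z' \<in> range_proj"
  shows "(\<lambda>a. z a + t * z' a) \<in> range_proj"
  by (rule range_projI) (simp_all add: proj_add range_projD[OF assms(1)] range_projD[OF assms(2)])

lemma newton_step_in_range: "newton_step z \<in> range_proj"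
  using sum_g_in_range[of "\<lambda>a. - grad z a"] unfolding newton_step_def[abs_def]
  by (simp add: sum_negf cong: if_cong)

text \<open>The linear part of the gradient contributes \<open>proj z b\<close>, which on the range
  is \<open>z b\<close> and cancels. Only the projected Taylor remainder separates the new point
  from \<open>lin_est\<close>, so controlling the Newton map means controlling
  \<open>remainder\<close>.\<close>

lemma newton_point_eq:
  assumes "z \<in> range_proj" "b \<in> Q"
  shows "z b + newton_step z b = lin_est b - (\<Sum>a\<in>Q. g b a * remainder z a)"
proof -
  have "z b = (\<Sum>a\<in>Q. g b a * (v a * z a))"
    using range_projD(2)[OF assms] unfolding proj_def by (simp add: mult_ac)
  thus ?thesis
    using assms(2) by (simp add: newton_step_def lin_est_def grad_def remainder_def v_eq
      sum_subtractf[symmetric] sum.distrib[symmetric] algebra_simps)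
qed

lemma DERIV_loss_line:
  "((\<lambda>t. loss (\<lambda>a. z a + t * h a)) has_real_derivative (\<Sum>a\<in>Q. grad z a * h a)) (at 0)"
proof -
  have "((\<lambda>t. ln (1 + exp (x a + (z a + t * h a)))) has_real_derivative sigm (x a + z a) * h a) (at 0)" for a
  proof -
    have "((\<lambda>t. x a + (z a + t * h a)) has_real_derivative h a) (at 0)"
      by (auto intro!: derivative_eq_intros)
    from DERIV_chain2[OF DERIV_softplus this] show ?thesis by simp
  qed
  thus ?thesis unfolding loss_def grad_def
    by (auto intro!: derivative_eq_intros sum.cong simp: algebra_simps one_plus_exp_pos sigm_altdef)
qed

text \<open>With \<open>c = grad z / v\<close>, the derivative of the loss along the step is minus
  the weighted square sum of \<open>proj c\<close>, which minimality forces to vanish. Minimality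
  along this one segment is available even at boundary points of a convex set that the Newton map
  preserves.\<close>

lemma stationary_if_newton_minimal:
  assumes min: "\<And>t. 0 \<le> t \<Longrightarrow> t \<le> 1 \<Longrightarrow> loss z \<le> loss (\<lambda>a. z a + t * newton_step z a)"
    and b: "b \<in> Q"
  shows "(\<Sum>a\<in>Q. g b a * grad z a) = 0"
proof -
  define c where "c = (\<lambda>a. grad z a / v a)"
  have step: "newton_step z a = - proj c a" if "a \<in> Q" for a
    using that by (simp add: newton_step_def c_def sum_g_eq_proj)
  have "(\<Sum>a\<in>Q. grad z a * newton_step z a) = - (\<Sum>a\<in>Q. v a * c a * proj c a)"
    unfolding sum_negf[symmetric] c_def
    by (intro sum.cong refl) (use v_pos in \<open>force simp: step c_def\<close>)
  also have "\<dots> = - (\<Sum>a\<in>Q. v a * (proj c a)\<^sup>2)" by (simp add: proj_quadratic)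
  finally have D: "((\<lambda>t. loss (\<lambda>a. z a + t * newton_step z a)) has_real_derivative
      - (\<Sum>a\<in>Q. v a * (proj c a)\<^sup>2)) (at 0)"
    using DERIV_loss_line[of z "newton_step z"] by simp
  have "\<not> - (\<Sum>a\<in>Q. v a * (proj c a)\<^sup>2) < 0"
  proof
    assume "- (\<Sum>a\<in>Q. v a * (proj c a)\<^sup>2) < 0"
    from DERIV_neg_dec_right[OF D this] obtain d where d: "d > 0"
      "\<And>t. t > 0 \<Longrightarrow> t < d \<Longrightarrow> loss (\<lambda>a. z a + t * newton_step z a) < loss z" by auto
    define t where "t = min (d / 2) 1"
    have "0 < t" "t < d" "t \<le> 1" using d(1) by (auto simp: t_def min_def)
    thus False using d(2)[of t] min[of t] by simp
  qed
  hence "(\<Sum>a\<in>Q. v a * (proj c a)\<^sup>2) = 0"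
    using sum_nonneg[of Q "\<lambda>a. v a * (proj c a)\<^sup>2"] v_nonneg by simp
  hence "v b * (proj c b)\<^sup>2 = 0"
    using b finite_Q v_nonneg by (subst (asm) sum_nonneg_eq_0_iff) auto
  hence "proj c b = 0" using v_pos[OF b] by simp
  thus ?thesis using b by (simp add: sum_g_eq_proj c_def)
qed

text \<open>Stationarity concerns the projected gradient. The difference \<open>h\<close> of two
  points of the range equals its own projection, so pairing the gradient with \<open>h\<close> only
  sees the projected gradient and gives 0; strict convexity of each summand does the rest.\<close>

lemma loss_strict_min_if_stationary:
  assumes stat: "\<And>b. b \<in> Q \<Longrightarrow> (\<Sum>a\<in>Q. g b a * grad z a) = 0"
    and z: "z \<in> range_proj" and z': "z' \<in> range_proj" and ne: "z' \<noteq> z"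
  shows "loss z < loss z'"
proof -
  define h where "h a = z' a - z a" for a
  have h: "h a = proj h a" if "a \<in> Q" for a
  proof -
    have "proj h a = proj z' a - proj z a"
      by (simp add: proj_def h_def right_diff_distrib sum_subtractf)
    thus ?thesis using range_projD(2)[OF z that] range_projD(2)[OF z' that] by (simp add: h_def)
  qed
  have "(\<Sum>a\<in>Q. grad z a * h a) = (\<Sum>a\<in>Q. \<Sum>b\<in>Q. grad z a * (v b * g a b * h b))"
    by (intro sum.cong refl, subst h) (auto simp: proj_def sum_distrib_left)
  also have "\<dots> = (\<Sum>b\<in>Q. \<Sum>a\<in>Q. grad z a * (v b * g a b * h b))" by (rule sum.swap)
  also have "\<dots> = (\<Sum>b\<in>Q. v b * h b * (\<Sum>a\<in>Q. g b a * grad z a))"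
    unfolding sum_distrib_left by (intro sum.cong refl) (simp add: g_sym)
  also have "\<dots> = 0" by (simp add: stat)
  finally have 0: "(\<Sum>a\<in>Q. grad z a * h a) = 0" .
  define S where "S z a = - y a * (x a + z a) + n a * ln (1 + exp (x a + z a))" for z a
  have lt: "S z a + grad z a * h a < S z' a" if "a \<in> Q" "z a \<noteq> z' a" for a
  proof -
    have "n a * (ln (1 + exp (x a + z a)) + sigm (x a + z a) * (x a + z' a - (x a + z a)))
      < n a * ln (1 + exp (x a + z' a))"
      using that n_pos by (intro mult_strict_left_mono softplus_gt_tangent) auto
    thus ?thesis by (simp add: S_def grad_def h_def algebra_simps)
  qed
  have le: "S z a + grad z a * h a \<le> S z' a" if "a \<in> Q" for a
    using lt[OF that] by (cases "z a = z' a") (auto simp: S_def h_def)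
  obtain a where a: "z a \<noteq> z' a" using ne by (auto simp: fun_eq_iff eq_commute)
  have "z a = 0 \<and> z' a = 0" if "a \<notin> Q" using range_projD(1)[OF z that] range_projD(1)[OF z' that] by simp
  hence aQ: "a \<in> Q" using a by (cases "a \<in> Q") auto
  have "(\<Sum>a\<in>Q. S z a + grad z a * h a) < (\<Sum>a\<in>Q. S z' a)"
    using a aQ lt le finite_Q by (intro sum_strict_mono_ex1) auto
  thus ?thesis using 0 by (simp add: loss_def S_def[abs_def] sum.distrib)
qed

lemma abs_remainder_le:
  assumes "a \<in> Q" "\<bar>z a\<bar> \<le> 1"
  shows "\<bar>remainder z a\<bar> \<le> v a * (z a)\<^sup>2"
proof -
  have "\<bar>remainder z a\<bar> = n a * \<bar>sigm (x a + z a) - sigm (x a) - dsigm (x a) * z a\<bar>"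
    using n_pos[OF assms(1)] by (simp add: remainder_def abs_mult)
  also have "\<dots> \<le> n a * (dsigm (x a) * (z a)\<^sup>2)"
    using n_pos[OF assms(1)] assms(2) by (intro mult_left_mono sigm_second_order) auto
  finally show ?thesis using assms(1) by (simp add: v_eq mult_ac)
qed

text \<open>Energy estimate: summing against \<open>g\<close> projects
  \<open>remainder z a / v a\<close>, which is at most \<open>(z a)\<^sup>2\<close> in absolute
  value, and projections do not increase the weighted square sum.\<close>

lemma remainder_sq_sum_le:
  assumes z1: "\<And>a. a \<in> Q \<Longrightarrow> \<bar>z a\<bar> \<le> 1"
  shows "(\<Sum>b\<in>Q. v b * (\<Sum>a\<in>Q. g b a * remainder z a)\<^sup>2) \<le> (\<Sum>a\<in>Q. v a * z a ^ 4)"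
proof -
  have "(\<Sum>b\<in>Q. v b * (\<Sum>a\<in>Q. g b a * remainder z a)\<^sup>2)
      = (\<Sum>b\<in>Q. v b * (proj (\<lambda>a. remainder z a / v a) b)\<^sup>2)"
    by (intro sum.cong refl) (simp add: sum_g_eq_proj)
  also have "\<dots> \<le> (\<Sum>a\<in>Q. v a * (remainder z a / v a)\<^sup>2)" by (rule proj_contraction)
  also have "\<dots> \<le> (\<Sum>a\<in>Q. v a * z a ^ 4)"
  proof (intro sum_mono mult_left_mono v_nonneg)
    fix a assume a: "a \<in> Q"
    have "\<bar>remainder z a / v a\<bar> \<le> (z a)\<^sup>2"
      using abs_remainder_le[of a z, OF a z1[OF a]] v_pos[OF a] by (simp add: divide_le_eq mult.commute)
    hence "\<bar>remainder z a / v a\<bar>\<^sup>2 \<le> ((z a)\<^sup>2)\<^sup>2" by (intro power_mono) auto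
    thus "(remainder z a / v a)\<^sup>2 \<le> z a ^ 4" by (simp only: power2_abs) simp
  qed
  finally show ?thesis .
qed

text \<open>Sup estimate, used with \<open>w = lin_est\<close>. The part in \<open>w\<close> is kept
  as a quadratic form for the probabilistic bound. In \<open>u\<^sup>2\<close> one factor is bounded
  by \<open>\<rho>\<close> and the other by Cauchy-Schwarz against row \<open>b\<close> of the
  kernel, so the result is linear in \<open>\<rho>\<close> with a factor that the energy bound makes
  small.\<close>

lemma remainder_sup_le:
  assumes z1: "\<And>a. a \<in> Q \<Longrightarrow> \<bar>z a\<bar> \<le> 1" and b: "b \<in> Q"
    and u: "\<And>a. a \<in> Q \<Longrightarrow> \<bar>u a\<bar> \<le> \<rho>" and zu: "\<And>a. a \<in> Q \<Longrightarrow> z a = w a + u a"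
  shows "\<bar>\<Sum>a\<in>Q. g b a * remainder z a\<bar>
    \<le> 2 * (\<Sum>a\<in>Q. v a * \<bar>g b a\<bar> * (w a)\<^sup>2) + 2 * \<rho> * (sqrt (g b b) * sqrt (\<Sum>a\<in>Q. v a * (u a)\<^sup>2))"
proof -
  have "\<rho> \<ge> 0" using u[OF b] by linarith
  have "\<bar>\<Sum>a\<in>Q. g b a * remainder z a\<bar> \<le> (\<Sum>a\<in>Q. \<bar>g b a * remainder z a\<bar>)" by (rule sum_abs)
  also have "\<dots> \<le> (\<Sum>a\<in>Q. 2 * (v a * \<bar>g b a\<bar> * (w a)\<^sup>2) + 2 * \<rho> * (v a * \<bar>g b a\<bar> * \<bar>u a\<bar>))"
  proof (rule sum_mono)
    fix a assume a: "a \<in> Q"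
    have "(z a)\<^sup>2 \<le> 2 * (w a)\<^sup>2 + 2 * (u a)\<^sup>2"
      using sum_squares_bound[of "w a" "u a"] zu[OF a] by (simp add: power2_sum)
    moreover have "(u a)\<^sup>2 \<le> \<rho> * \<bar>u a\<bar>"
      using mult_right_mono[OF u[OF a], of "\<bar>u a\<bar>"] by (simp add: power2_eq_square)
    ultimately have "(z a)\<^sup>2 \<le> 2 * (w a)\<^sup>2 + 2 * (\<rho> * \<bar>u a\<bar>)" by linarith
    hence "\<bar>g b a\<bar> * (v a * (z a)\<^sup>2) \<le> \<bar>g b a\<bar> * (v a * (2 * (w a)\<^sup>2 + 2 * (\<rho> * \<bar>u a\<bar>)))"
      using v_nonneg[OF a] by (intro mult_left_mono) auto
    moreover have "\<bar>g b a * remainder z a\<bar> \<le> \<bar>g b a\<bar> * (v a * (z a)\<^sup>2)"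
      unfolding abs_mult using abs_remainder_le[of a z, OF a z1[OF a]] by (intro mult_left_mono) auto
    ultimately show "\<bar>g b a * remainder z a\<bar>
      \<le> 2 * (v a * \<bar>g b a\<bar> * (w a)\<^sup>2) + 2 * \<rho> * (v a * \<bar>g b a\<bar> * \<bar>u a\<bar>)"
      by (simp add: algebra_simps)
  qed
  also have "\<dots> = 2 * (\<Sum>a\<in>Q. v a * \<bar>g b a\<bar> * (w a)\<^sup>2) + 2 * \<rho> * (\<Sum>a\<in>Q. v a * \<bar>g b a\<bar> * \<bar>u a\<bar>)"
    by (simp add: sum.distrib sum_distrib_left)
  also have "(\<Sum>a\<in>Q. v a * \<bar>g b a\<bar> * \<bar>u a\<bar>) \<le> sqrt (g b b) * sqrt (\<Sum>a\<in>Q. v a * (u a)\<^sup>2)"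
    using Cauchy_Schwarz_sum_weighted[of Q v "\<lambda>a. \<bar>g b a\<bar>" "\<lambda>a. \<bar>u a\<bar>"] v_nonneg
    by (simp add: g_diag_eq[OF b] real_sqrt_mult[symmetric] real_le_rsqrt)
  finally show ?thesis using \<open>\<rho> \<ge> 0\<close> by (simp add: mult_left_mono)
qed

lemma square_convex_le:
  fixes a b t :: real
  assumes "0 \<le> t" "t \<le> 1"
  shows "((1 - t) * a + t * b)\<^sup>2 \<le> (1 - t) * a\<^sup>2 + t * b\<^sup>2"
proof -
  have "(1 - t) * a\<^sup>2 + t * b\<^sup>2 - ((1 - t) * a + t * b)\<^sup>2 = t * (1 - t) * (a - b)\<^sup>2"
    by (simp add: algebra_simps power2_eq_square)
  moreover have "\<dots> \<ge> 0" using assms by simp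
  ultimately show ?thesis by linarith
qed

text \<open>The constraint on \<open>\<bar>z a - lin_est a\<bar>\<close> keeps the Taylor expansion valid, the energy constraint closes
  the estimate of its error: the set \<open>G\<close> of both is invariant under the Newton map.\<close>

theorem minimiser_exists_near_lin_est:
  assumes diag: "\<And>a. a \<in> Q \<Longrightarrow> g a a \<le> lv" and trace: "(\<Sum>a\<in>Q. v a * g a a) \<le> k"
    and nonneg: "lv \<ge> 0" "k \<ge> 0" "\<tau> \<ge> 0" "T \<ge> 0"
    and lin: "\<And>a. a \<in> Q \<Longrightarrow> (lin_est a)\<^sup>2 \<le> 9 * \<tau> * g a a"
    and quad: "\<And>b. b \<in> Q \<Longrightarrow> (\<Sum>a\<in>Q. v a * \<bar>g b a\<bar> * (lin_est a)\<^sup>2) \<le> T"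
    and small: "T \<le> 1 / 16" "\<tau> * lv \<le> 1 / 10000" "\<tau> * lv * sqrt k \<le> 1 / 144"
  shows "\<exists>z\<in>range_proj. (\<forall>z'\<in>range_proj. z' \<noteq> z \<longrightarrow> loss z < loss z') \<and>
    (\<forall>a\<in>Q. \<bar>z a\<bar> \<le> 3 * sqrt (\<tau> * lv) + 4 * T) \<and> (\<Sum>a\<in>Q. v a * (z a)\<^sup>2) \<le> 19 * \<tau> * k"
proof -
  \<comment> \<open>Both radii are solutions of the closing equations below:
    \<open>648 * \<tau>\<^sup>2 * lv * k + R / 2 = R\<close> for the energy, and
    \<open>2 * T + \<rho> / 2 = \<rho>\<close> for the sup norm.\<close>
  define R where "R = 1296 * \<tau>\<^sup>2 * lv * k"
  define \<rho> where "\<rho> = 4 * T"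
  define G where "G = {z \<in> range_proj. (\<forall>a\<in>Q. \<bar>z a - lin_est a\<bar> \<le> \<rho>) \<and>
      (\<Sum>a\<in>Q. v a * (z a - lin_est a)\<^sup>2) \<le> R}"
  have R: "R \<ge> 0" and \<rho>: "\<rho> \<ge> 0" "\<rho> \<le> 1 / 4" using nonneg small by (auto simp: R_def \<rho>_def)
  have lin': "\<bar>lin_est a\<bar> \<le> 3 * sqrt (\<tau> * lv)" if "a \<in> Q" for a
  proof -
    have "(lin_est a)\<^sup>2 \<le> 9 * (\<tau> * lv)"
      using lin[OF that] mult_left_mono[OF diag[OF that] nonneg(3)] by linarith
    hence "sqrt ((lin_est a)\<^sup>2) \<le> sqrt (9 * (\<tau> * lv))" by (rule real_sqrt_le_mono)
    thus ?thesis by (simp add: real_sqrt_mult)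
  qed
  have sqrt_small: "sqrt (\<tau> * lv) \<le> 1 / 100"
    using small(2) by (intro real_le_lsqrt) (auto simp: power2_eq_square)
  have G_le: "\<bar>z a\<bar> \<le> 3 * sqrt (\<tau> * lv) + \<rho>" if "z \<in> G" "a \<in> Q" for z a
    using that lin'[of a] unfolding G_def by fastforce
  have G_le1: "\<bar>z a\<bar> \<le> 1" if "z \<in> G" "a \<in> Q" for z a
    using G_le[OF that] sqrt_small \<rho> by linarith
  have step_in_G: "(\<lambda>a. z a + 1 * newton_step z a) \<in> G" if z: "z \<in> G" for z
  proof -
    have zr: "z \<in> range_proj" and zb: "\<And>a. a \<in> Q \<Longrightarrow> \<bar>z a - lin_est a\<bar> \<le> \<rho>"
      and zR: "(\<Sum>a\<in>Q. v a * (z a - lin_est a)\<^sup>2) \<le> R" using z by (auto simp: G_def)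
    have diff: "z b + newton_step z b - lin_est b = - (\<Sum>a\<in>Q. g b a * remainder z a)"
      if "b \<in> Q" for b using newton_point_eq[OF zr that] by simp
    have sup: "\<bar>\<Sum>a\<in>Q. g b a * remainder z a\<bar> \<le> \<rho>" if b: "b \<in> Q" for b
    proof -
      \<comment> \<open>Leverage times energy is \<open>36 * \<tau> * lv * sqrt k\<close>, which the
        assumed bound 1/144 turns into 1/4.\<close>
      have "sqrt (g b b) * sqrt (\<Sum>a\<in>Q. v a * (z a - lin_est a)\<^sup>2) \<le> sqrt lv * sqrt R"
        using diag[OF b] zR nonneg v_nonneg by (intro mult_mono) (auto intro!: sum_nonneg)
      also have "\<dots> = 36 * (\<tau> * lv * sqrt k)"
      proof -
        have "lv * R = (36 * (\<tau> * lv))\<^sup>2 * k" by (simp add: R_def power2_eq_square)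
        thus ?thesis using nonneg by (simp add: real_sqrt_mult[symmetric])
            (simp add: real_sqrt_mult)
      qed
      also have "\<dots> \<le> 1 / 4" using small(3) by simp
      finally have "2 * \<rho> * (sqrt (g b b) * sqrt (\<Sum>a\<in>Q. v a * (z a - lin_est a)\<^sup>2)) \<le> 2 * \<rho> * (1 / 4)"
        using \<rho> by (intro mult_left_mono) auto
      moreover have "\<bar>\<Sum>a\<in>Q. g b a * remainder z a\<bar> \<le> 2 * (\<Sum>a\<in>Q. v a * \<bar>g b a\<bar> * (lin_est a)\<^sup>2)
        + 2 * \<rho> * (sqrt (g b b) * sqrt (\<Sum>a\<in>Q. v a * (z a - lin_est a)\<^sup>2))"
        by (rule remainder_sup_le[where u = "\<lambda>a. z a - lin_est a"]) (use G_le1[OF z] zb b in auto)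
      ultimately show ?thesis using quad[OF b] by (simp add: \<rho>_def)
    qed
    have "(\<Sum>b\<in>Q. v b * (\<Sum>a\<in>Q. g b a * remainder z a)\<^sup>2) \<le> (\<Sum>a\<in>Q. v a * z a ^ 4)"
      using G_le1[OF z] by (rule remainder_sq_sum_le)
    \<comment> \<open>The fourth power is at most \<open>8 * w ^ 4 + 8 * u ^ 4\<close>. In
      \<open>w ^ 4\<close> one leverage is bounded by \<open>lv\<close> and the other is kept for
      the trace; \<open>u\<^sup>2 \<le> 1 / 16\<close> leaves half of the energy of
      \<open>u\<close>, so that the estimate closes.\<close>
    also have "\<dots> \<le> (\<Sum>a\<in>Q. 648 * \<tau>\<^sup>2 * lv * (v a * g a a) + 1 / 2 * (v a * (z a - lin_est a)\<^sup>2))"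
    proof (rule sum_mono)
      fix a assume a: "a \<in> Q"
      define w u where "w = lin_est a" and "u = z a - lin_est a"
      have "(z a)\<^sup>2 \<le> 2 * w\<^sup>2 + 2 * u\<^sup>2"
        using sum_squares_bound[of w u] by (simp add: w_def u_def power2_eq_square algebra_simps)
      hence "((z a)\<^sup>2)\<^sup>2 \<le> (2 * w\<^sup>2 + 2 * u\<^sup>2)\<^sup>2" by (intro power_mono) auto
      also have "\<dots> \<le> 8 * (w\<^sup>2)\<^sup>2 + 8 * (u\<^sup>2)\<^sup>2"
        using sum_squares_bound[of "w\<^sup>2" "u\<^sup>2"] by (simp add: power2_sum power_mult_distrib)
      also have "(w\<^sup>2)\<^sup>2 \<le> 81 * \<tau>\<^sup>2 * lv * g a a"
      proof -
        have "(w\<^sup>2)\<^sup>2 \<le> (9 * \<tau> * g a a)\<^sup>2" using lin[OF a] by (intro power_mono) (auto simp: w_def)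
        also have "\<dots> = 81 * \<tau>\<^sup>2 * g a a * g a a" by (simp add: power2_eq_square)
        also have "\<dots> \<le> 81 * \<tau>\<^sup>2 * lv * g a a"
          using diag[OF a] g_diag_nonneg[OF a] by (intro mult_right_mono mult_left_mono) auto
        finally show ?thesis .
      qed
      also have "(u\<^sup>2)\<^sup>2 \<le> 1 / 16 * u\<^sup>2"
      proof -
        have "\<bar>u\<bar>\<^sup>2 \<le> (1 / 4)\<^sup>2" using zb[OF a] \<rho> by (intro power_mono) (auto simp: u_def)
        hence "u\<^sup>2 * u\<^sup>2 \<le> 1 / 16 * u\<^sup>2" by (intro mult_right_mono) (auto simp: power2_eq_square)
        thus ?thesis by (simp add: power2_eq_square)
      qed
      finally have "z a ^ 4 \<le> 648 * \<tau>\<^sup>2 * lv * g a a + 1 / 2 * u\<^sup>2" by simp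
      from mult_left_mono[OF this v_nonneg[OF a]]
      show "v a * z a ^ 4 \<le> 648 * \<tau>\<^sup>2 * lv * (v a * g a a) + 1 / 2 * (v a * (z a - lin_est a)\<^sup>2)"
        by (simp add: u_def algebra_simps)
    qed
    also have "\<dots> = 648 * \<tau>\<^sup>2 * lv * (\<Sum>a\<in>Q. v a * g a a) + 1 / 2 * (\<Sum>a\<in>Q. v a * (z a - lin_est a)\<^sup>2)"
      by (simp only: sum.distrib sum_distrib_left)
    also have "\<dots> \<le> 648 * \<tau>\<^sup>2 * lv * k + 1 / 2 * R"
      using trace zR nonneg by (intro add_mono mult_left_mono) auto
    also have "\<dots> = R" by (simp add: R_def)
    finally show ?thesis
      using sup range_proj_add[OF zr newton_step_in_range, of 1 z] by (simp add: G_def diff)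
  qed
  have segment: "(\<lambda>a. z a + t * newton_step z a) \<in> G" if z: "z \<in> G" and t: "0 \<le> t" "t \<le> 1" for z t
  proof -
    define u where "u a = z a - lin_est a" for a
    define u' where "u' a = z a + 1 * newton_step z a - lin_est a" for a
    have eq: "z a + t * newton_step z a - lin_est a = (1 - t) * u a + t * u' a" for a
      by (simp add: u_def u'_def algebra_simps)
    have u: "\<bar>u a\<bar> \<le> \<rho>" "\<bar>u' a\<bar> \<le> \<rho>" if "a \<in> Q" for a
      using z step_in_G[OF z] that by (auto simp: G_def u_def u'_def)
    have uR: "(\<Sum>a\<in>Q. v a * (u a)\<^sup>2) \<le> R" "(\<Sum>a\<in>Q. v a * (u' a)\<^sup>2) \<le> R"
      using z step_in_G[OF z] by (auto simp: G_def u_def u'_def)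
    have "\<bar>(1 - t) * u a + t * u' a\<bar> \<le> \<rho>" if "a \<in> Q" for a
    proof -
      have "\<bar>(1 - t) * u a + t * u' a\<bar> \<le> (1 - t) * \<bar>u a\<bar> + t * \<bar>u' a\<bar>"
        using t by (intro order_trans[OF abs_triangle_ineq]) (simp add: abs_mult)
      also have "\<dots> \<le> (1 - t) * \<rho> + t * \<rho>"
        using t u[OF that] by (intro add_mono mult_left_mono) auto
      finally show ?thesis by (simp add: algebra_simps)
    qed
    moreover have "(\<Sum>a\<in>Q. v a * ((1 - t) * u a + t * u' a)\<^sup>2) \<le> R"
    proof -
      have "(\<Sum>a\<in>Q. v a * ((1 - t) * u a + t * u' a)\<^sup>2)
        \<le> (\<Sum>a\<in>Q. v a * ((1 - t) * (u a)\<^sup>2 + t * (u' a)\<^sup>2))"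
        using t v_nonneg by (intro sum_mono mult_left_mono square_convex_le) auto
      also have "\<dots> = (1 - t) * (\<Sum>a\<in>Q. v a * (u a)\<^sup>2) + t * (\<Sum>a\<in>Q. v a * (u' a)\<^sup>2)"
        by (simp add: sum.distrib sum_distrib_left distrib_left mult_ac)
      also have "\<dots> \<le> (1 - t) * R + t * R"
        using t uR by (intro add_mono mult_left_mono) auto
      finally show ?thesis by (simp add: algebra_simps)
    qed
    moreover have "(\<lambda>a. z a + t * newton_step z a) \<in> range_proj"
      using z by (intro range_proj_add newton_step_in_range) (simp add: G_def)
    ultimately show ?thesis by (simp add: G_def eq)
  qed
  have "compact G" unfolding G_def by (rule compact_range_proj_box)
  moreover have "lin_est \<in> G" using R \<rho> lin_est_in_range by (simp add: G_def)
  moreover have "continuous_on G loss"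
  proof -
    have coord: "continuous_on G (\<lambda>z :: 'a \<Rightarrow> real. z a)" for a
      by (rule continuous_on_subset[OF continuous_on_product_coordinates]) simp
    show ?thesis unfolding loss_def
      by (intro continuous_on_sum continuous_on_add continuous_on_mult continuous_on_const coord
          continuous_on_ln continuous_on_exp) (metis one_plus_exp_pos less_irrefl)
  qed
  ultimately obtain z where z: "z \<in> G" and min: "\<And>z'. z' \<in> G \<Longrightarrow> loss z \<le> loss z'"
    using continuous_attains_inf[of G loss] by auto
  have stat: "(\<Sum>a\<in>Q. g b a * grad z a) = 0" if "b \<in> Q" for b
    using that by (rule stationary_if_newton_minimal[rotated]) (intro min segment z)
  have zr: "z \<in> range_proj" using z by (simp add: G_def)
  have "(\<Sum>a\<in>Q. v a * (z a)\<^sup>2) \<le> (\<Sum>a\<in>Q. 18 * \<tau> * (v a * g a a) + 2 * (v a * (z a - lin_est a)\<^sup>2))"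
  proof (rule sum_mono)
    fix a assume a: "a \<in> Q"
    have "(z a)\<^sup>2 \<le> 2 * (lin_est a)\<^sup>2 + 2 * (z a - lin_est a)\<^sup>2"
      using sum_squares_bound[of "lin_est a" "z a - lin_est a"]
      by (simp add: power2_eq_square algebra_simps)
    hence "(z a)\<^sup>2 \<le> 18 * \<tau> * g a a + 2 * (z a - lin_est a)\<^sup>2" using lin[OF a] by linarith
    from mult_left_mono[OF this v_nonneg[OF a]]
    show "v a * (z a)\<^sup>2 \<le> 18 * \<tau> * (v a * g a a) + 2 * (v a * (z a - lin_est a)\<^sup>2)"
      by (simp add: algebra_simps)
  qed
  also have "\<dots> = 18 * \<tau> * (\<Sum>a\<in>Q. v a * g a a) + 2 * (\<Sum>a\<in>Q. v a * (z a - lin_est a)\<^sup>2)"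
    by (simp only: sum.distrib sum_distrib_left)
  also have "\<dots> \<le> 18 * \<tau> * k + 2 * R"
    using trace z nonneg by (intro add_mono mult_left_mono) (auto simp: G_def)
  \<comment> \<open>The radius is of second order: \<open>\<tau> * lv \<le> 1 / 10000\<close> makes
    its contribution at most one further \<open>\<tau> * k\<close>, whence 19 = 18 + 1.\<close>
  also have "2 * R \<le> 1 * \<tau> * k"
  proof -
    have "2592 * (\<tau> * lv) * (\<tau> * k) \<le> 1 * (\<tau> * k)"
      using small(2) nonneg by (intro mult_right_mono) auto
    thus ?thesis by (simp add: R_def power2_eq_square mult_ac)
  qed
  finally have "(\<Sum>a\<in>Q. v a * (z a)\<^sup>2) \<le> 19 * \<tau> * k" by simp
  thus ?thesis
    using zr loss_strict_min_if_stationary[OF stat zr] G_le[OF z] by (auto simp: \<rho>_def)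
qed

end

section \<open>Concentration of linear and quadratic forms\<close>

lemma pmf_exponential_markov:
  fixes M :: "'a pmf" and S :: "'a \<Rightarrow> real"
  assumes "(\<integral>\<^sup>+ f. ennreal (exp (lam * S f)) \<partial>measure_pmf M) \<le> ennreal (exp w)" "lam \<ge> 0"
  shows "measure_pmf.prob M {f. S f > t} \<le> exp (w - lam * t)"
proof -
  have "emeasure M {f. S f > t} \<le> emeasure M {f \<in> UNIV. 1 \<le> ennreal (exp (- (lam * t))) * ennreal (exp (lam * S f))}"
    using assms(2)
    by (intro emeasure_mono)
       (auto simp: ennreal_mult[symmetric] exp_add[symmetric] ennreal_ge_1 mult_left_mono less_imp_le)
  also have "\<dots> \<le> ennreal (exp (- (lam * t))) * (\<integral>\<^sup>+ f. ennreal (exp (lam * S f)) * indicator UNIV f \<partial>measure_pmf M)"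
    by (rule nn_integral_Markov_inequality) auto
  also have "\<dots> \<le> ennreal (exp (- (lam * t))) * ennreal (exp w)"
    using assms(1) by (intro mult_left_mono) auto
  also have "\<dots> = ennreal (exp (w - lam * t))"
    by (simp add: ennreal_mult[symmetric] exp_add[symmetric])
  finally show ?thesis
    by (simp add: measure_pmf.emeasure_eq_measure)
qed

lemma pmf_prob_UN_le:
  assumes "finite Q" "\<And>a. a \<in> Q \<Longrightarrow> measure_pmf.prob M (A a) \<le> e"
  shows "measure_pmf.prob M (\<Union>a\<in>Q. A a) \<le> real (card Q) * e"
proof -
  have "measure_pmf.prob M (\<Union>a\<in>Q. A a) \<le> (\<Sum>a\<in>Q. measure_pmf.prob M (A a))"
    using assms(1) by (intro measure_pmf.finite_measure_subadditive_finite) auto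
  also have "\<dots> \<le> (\<Sum>a\<in>Q. e)" using assms(2) by (rule sum_mono)
  finally show ?thesis by simp
qed

lemma pmf_prob_Un_le:
  "measure_pmf.prob M A \<le> e \<Longrightarrow> measure_pmf.prob M B \<le> e' \<Longrightarrow> measure_pmf.prob M (A \<union> B) \<le> e + e'"
  using measure_Un_le[of A M B] by simp

text \<open>The right-hand side minus 2 is the square of
  \<open>exp (x / 2) - exp (- (x / 2))\<close>, and the hyperbolic sine dominates the identity. This
  converts moment generating functions at \<open>s\<close> and \<open>- s\<close> into a second
  moment.\<close>

lemma square_add_2_le_exp:
  fixes x :: real
  shows "x\<^sup>2 + 2 \<le> exp x + exp (- x)"
proof -
  have sq: "exp y + exp (- y) - 2 = (exp (y / 2) - exp (- (y / 2)))\<^sup>2" for y :: real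
    by (simp add: power2_diff exp_double[symmetric] exp_add[symmetric])
  have main: "\<bar>y\<bar> * 2 \<le> \<bar>exp y - exp (- y)\<bar>" for y :: real
  proof -
    have pos: "2 * t \<le> exp t - exp (- t)" if "t \<ge> 0" for t :: real
    proof -
      have "(\<lambda>y. exp y - exp (- y) - 2 * y) 0 \<le> (\<lambda>y. exp y - exp (- y) - 2 * y) t"
      proof (rule DERIV_nonneg_imp_nondecreasing[OF that])
        fix y :: real
        have "((\<lambda>y. exp y - exp (- y) - 2 * y) has_real_derivative exp y + exp (- y) - 2) (at y)"
          by (auto intro!: derivative_eq_intros)
        moreover have "exp y + exp (- y) - 2 \<ge> 0" unfolding sq by simp
        ultimately show "\<exists>D. ((\<lambda>y. exp y - exp (- y) - 2 * y) has_real_derivative D) (at y) \<and> 0 \<le> D"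
          by blast
      qed
      thus ?thesis by simp
    qed
    show ?thesis using pos[of y] pos[of "- y"] by (cases "y \<ge> 0") auto
  qed
  have "\<bar>x / 2 * 2\<bar> \<le> \<bar>exp (x / 2) - exp (- (x / 2))\<bar>" using main[of "x / 2"] by simp
  hence "x\<^sup>2 \<le> (exp (x / 2) - exp (- (x / 2)))\<^sup>2" by (simp add: abs_le_square_iff)
  thus ?thesis unfolding sq[symmetric] by simp
qed

section \<open>Independent sub-gamma variables: Bernstein, martingale and quadratic form
  bounds\<close>

locale indep_subgamma =
  fixes Q :: "'a set" and p :: "'a \<Rightarrow> real pmf" and v :: "'a \<Rightarrow> real"
  assumes finite_index: "finite Q"
    and var_nonneg: "a \<in> Q \<Longrightarrow> v a \<ge> 0"
    and mgf_le: "a \<in> Q \<Longrightarrow> \<bar>s\<bar> \<le> 1 \<Longrightarrow>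
      (\<integral>\<^sup>+ y. ennreal (exp (s * y)) \<partial>measure_pmf (p a)) \<le> ennreal (exp (s\<^sup>2 * v a))"
begin

lemma second_moment_le:
  assumes a: "a \<in> Q"
  shows "(\<integral>\<^sup>+ y. ennreal (y\<^sup>2) \<partial>measure_pmf (p a)) \<le> ennreal (4 * v a)"
proof -
  let ?I = "\<integral>\<^sup>+ y. ennreal (y\<^sup>2) \<partial>measure_pmf (p a)"
  \<comment> \<open>This \<open>s\<close> satisfies both \<open>s \<le> 1\<close> and
    \<open>s\<^sup>2 * v a \<le> 1\<close>, so \<open>mgf_le\<close> applies and its bound is at
    most \<open>1 + 2 * u\<close>. A fixed \<open>s\<close> thus replaces a limit at 0, at the cost
    of a constant factor.\<close>
  define s where "s = 1 / (1 + v a)"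
  define u where "u = s\<^sup>2 * v a"
  have v0: "v a \<ge> 0" using var_nonneg[OF a] .
  have s: "0 < s" "s \<le> 1" using v0 by (auto simp: s_def)
  have "s * v a \<le> 1" using v0 by (simp add: s_def)
  hence "s * (s * v a) \<le> 1 * 1" using s v0 by (intro mult_mono) auto
  hence u: "0 \<le> u" "u \<le> 1" using v0 s by (auto simp: u_def power2_eq_square mult.assoc)
  have "exp u \<le> 1 + u + u\<^sup>2" using u by (intro exp_le_quadratic) auto
  also have "u\<^sup>2 \<le> u" using u by (simp add: power2_eq_square mult_left_le)
  finally have exp_u: "exp u \<le> 1 + 2 * u" by simp
  have "ennreal (s\<^sup>2) * ?I + 2 = (\<integral>\<^sup>+ y. ennreal (s\<^sup>2) * ennreal (y\<^sup>2) + 2 \<partial>measure_pmf (p a))"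
    by (subst nn_integral_add) (auto simp: nn_integral_cmult)
  also have "\<dots> \<le> (\<integral>\<^sup>+ y. ennreal (exp (s * y)) + ennreal (exp ((- s) * y)) \<partial>measure_pmf (p a))"
  proof (rule nn_integral_mono)
    fix y
    have "ennreal ((s * y)\<^sup>2 + 2) \<le> ennreal (exp (s * y) + exp (- (s * y)))"
      by (intro ennreal_leI square_add_2_le_exp)
    thus "ennreal (s\<^sup>2) * ennreal (y\<^sup>2) + 2 \<le> ennreal (exp (s * y)) + ennreal (exp ((- s) * y))"
      by (simp add: power_mult_distrib ennreal_mult)
  qed
  also have "\<dots> = (\<integral>\<^sup>+ y. ennreal (exp (s * y)) \<partial>measure_pmf (p a))
      + (\<integral>\<^sup>+ y. ennreal (exp ((- s) * y)) \<partial>measure_pmf (p a))"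
    by (rule nn_integral_add) auto
  also have "\<dots> \<le> ennreal (exp u) + ennreal (exp u)"
    using mgf_le[OF a, of s] mgf_le[OF a, of "- s"] s by (intro add_mono) (auto simp: u_def)
  also have "\<dots> \<le> ennreal (1 + 2 * u) + ennreal (1 + 2 * u)"
    using exp_u by (intro add_mono ennreal_leI)
  also have "\<dots> = ennreal (4 * u) + 2" using u by (simp flip: ennreal_plus ennreal_numeral)
  finally have "ennreal (s\<^sup>2) * ?I \<le> ennreal (4 * u)" by (simp add: add.commute[of _ 2])
  also have "\<dots> = ennreal (s\<^sup>2) * ennreal (4 * v a)"
    using v0 by (simp add: u_def ennreal_mult[symmetric] mult_ac)
  finally have le: "ennreal (s\<^sup>2) * ?I \<le> ennreal (s\<^sup>2) * ennreal (4 * v a)" .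
  have "ennreal (1 / s\<^sup>2) * (ennreal (s\<^sup>2) * ?I) \<le> ennreal (1 / s\<^sup>2) * (ennreal (s\<^sup>2) * ennreal (4 * v a))"
    using le by (rule mult_left_mono) simp
  moreover have "ennreal (1 / s\<^sup>2) * (ennreal (s\<^sup>2) * t) = t" for t
    using s by (simp add: mult.assoc[symmetric] ennreal_mult[symmetric])
  ultimately show ?thesis by simp
qed

abbreviation law :: "('a \<Rightarrow> real) pmf" where
  "law \<equiv> Pi_pmf Q 0 p"

text \<open>\<open>rk\<close> plays the role of time, and \<open>c a\<close> depends on the past
  only. Indices are added by increasing rank: given the earlier coordinates, the last summand is
  linear in a fresh variable, and its moment generating function is bounded through the
  deterministic \<open>K b\<close> before the rest is integrated.\<close>

lemma mgf_predictable_sum: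
  fixes rk :: "'a \<Rightarrow> nat"
  assumes rk: "inj_on rk Q"
    and pred: "\<And>a f f'. (\<And>b. rk b < rk a \<Longrightarrow> f b = f' b) \<Longrightarrow> c a f = c a f'"
    and bound: "\<And>a f. a \<in> Q \<Longrightarrow> \<bar>c a f\<bar> \<le> K a"
    and lam: "\<And>a. a \<in> Q \<Longrightarrow> \<bar>lam\<bar> * K a \<le> 1"
  shows "(\<integral>\<^sup>+ f. ennreal (exp (lam * (\<Sum>a\<in>Q. f a * c a f))) \<partial>measure_pmf law)
    \<le> ennreal (exp (lam\<^sup>2 * (\<Sum>a\<in>Q. v a * (K a)\<^sup>2)))"
proof -
  have "A \<subseteq> Q \<longrightarrow> (\<integral>\<^sup>+ f. ennreal (exp (lam * (\<Sum>a\<in>A. f a * c a f))) \<partial>measure_pmf (Pi_pmf A 0 p))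
      \<le> ennreal (exp (lam\<^sup>2 * (\<Sum>a\<in>A. v a * (K a)\<^sup>2)))" if "finite A" for A
    using that
  proof (induction A rule: finite_ranking_induct[where f = rk])
    case empty
    show ?case by simp
  next
    case (insert b A)
    show ?case
    proof (cases "b \<in> A")
      case True
      thus ?thesis using insert.IH by (simp add: insert_absorb)
    next
      case nb: False
      show ?thesis
      proof
        assume sub: "insert b A \<subseteq> Q"
        hence bQ: "b \<in> Q" by simp
        have less: "rk a < rk b" if "a \<in> A" for a
          using insert.hyps(2)[OF that] that nb sub inj_onD[OF rk, of a b] by fastforce
        let ?P = "Pi_pmf A 0 p"
        \<comment> \<open>The newest coordinate has the highest rank, so no coefficient sees it; it
          enters only as the factor \<open>y\<close>.\<close>
        have split: "(\<Sum>a\<in>insert b A. (f(b := y)) a * c a (f(b := y))) = y * c b f + (\<Sum>a\<in>A. f a * c a f)"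
          for f y
        proof -
          have "c b (f(b := y)) = c b f" by (rule pred) auto
          moreover have "(f(b := y)) a * c a (f(b := y)) = f a * c a f" if "a \<in> A" for a
          proof -
            have "c a (f(b := y)) = c a f" by (rule pred) (use less[OF that] in auto)
            thus ?thesis using that nb by auto
          qed
          ultimately show ?thesis using nb insert by (simp cong: sum.cong)
        qed
        have "(\<integral>\<^sup>+ f. ennreal (exp (lam * (\<Sum>a\<in>insert b A. f a * c a f))) \<partial>measure_pmf (Pi_pmf (insert b A) 0 p))
          = (\<integral>\<^sup>+ f. \<integral>\<^sup>+ y. ennreal (exp (lam * (\<Sum>a\<in>insert b A. (f(b := y)) a * c a (f(b := y))))) \<partial>p b \<partial>?P)"
          using insert.hyps(1) nb
          by (subst Pi_pmf_insert) (simp_all add: pair_commute_pmf[of "p b"] nn_integral_pair_pmf' case_prod_unfold cong: if_cong)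
        also have "\<dots> = (\<integral>\<^sup>+ f. ennreal (exp (lam * (\<Sum>a\<in>A. f a * c a f)))
            * (\<integral>\<^sup>+ y. ennreal (exp ((lam * c b f) * y)) \<partial>p b) \<partial>?P)"
          unfolding split by (subst nn_integral_cmult[symmetric])
            (auto simp: ennreal_mult[symmetric] exp_add[symmetric] algebra_simps)
        also have "\<dots> \<le> (\<integral>\<^sup>+ f. ennreal (exp (lam * (\<Sum>a\<in>A. f a * c a f)))
            * ennreal (exp (lam\<^sup>2 * (v b * (K b)\<^sup>2))) \<partial>?P)"
        proof (intro nn_integral_mono mult_left_mono)
          fix f :: "'a \<Rightarrow> real"
          have "\<bar>lam * c b f\<bar> \<le> \<bar>lam\<bar> * K b"
            unfolding abs_mult using bound[OF bQ] by (intro mult_left_mono) auto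
          also have "\<dots> \<le> 1" by (rule lam[OF bQ])
          finally have "(\<integral>\<^sup>+ y. ennreal (exp ((lam * c b f) * y)) \<partial>p b) \<le> ennreal (exp ((lam * c b f)\<^sup>2 * v b))"
            by (rule mgf_le[OF bQ])
          also have "\<dots> \<le> ennreal (exp (lam\<^sup>2 * (v b * (K b)\<^sup>2)))"
          proof -
            have "\<bar>c b f\<bar>\<^sup>2 \<le> (K b)\<^sup>2" using bound[OF bQ] by (intro power_mono) auto
            hence "lam\<^sup>2 * (v b * (c b f)\<^sup>2) \<le> lam\<^sup>2 * (v b * (K b)\<^sup>2)"
              using var_nonneg[OF bQ] by (intro mult_left_mono) auto
            thus ?thesis by (intro ennreal_leI) (simp add: power_mult_distrib mult_ac)
          qed
          finally show "(\<integral>\<^sup>+ y. ennreal (exp ((lam * c b f) * y)) \<partial>p b) \<le> ennreal (exp (lam\<^sup>2 * (v b * (K b)\<^sup>2)))" .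
        qed auto
        also have "\<dots> = (\<integral>\<^sup>+ f. ennreal (exp (lam * (\<Sum>a\<in>A. f a * c a f))) \<partial>?P)
            * ennreal (exp (lam\<^sup>2 * (v b * (K b)\<^sup>2)))"
          by (rule nn_integral_multc) auto
        also have "\<dots> \<le> ennreal (exp (lam\<^sup>2 * (\<Sum>a\<in>A. v a * (K a)\<^sup>2))) * ennreal (exp (lam\<^sup>2 * (v b * (K b)\<^sup>2)))"
          using insert.IH sub by (intro mult_right_mono) auto
        also have "\<dots> = ennreal (exp (lam\<^sup>2 * (\<Sum>a\<in>insert b A. v a * (K a)\<^sup>2)))"
          using nb insert.hyps(1) by (simp add: ennreal_mult[symmetric] exp_add[symmetric] algebra_simps)
        finally show "(\<integral>\<^sup>+ f. ennreal (exp (lam * (\<Sum>a\<in>insert b A. f a * c a f))) \<partial>measure_pmf (Pi_pmf (insert b A) 0 p))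
            \<le> ennreal (exp (lam\<^sup>2 * (\<Sum>a\<in>insert b A. v a * (K a)\<^sup>2)))" .
      qed
    qed
  qed
  thus ?thesis using finite_index by blast
qed

text \<open>Bernstein's inequality for martingales whose increments have deterministic coefficient
  bounds: a Gaussian term from the total variance \<open>V\<close> and a linear term from the
  largest coefficient.\<close>

lemma predictable_sum_tail:
  fixes rk :: "'a \<Rightarrow> nat"
  assumes rk: "inj_on rk Q"
    and pred: "\<And>a f f'. (\<And>b. rk b < rk a \<Longrightarrow> f b = f' b) \<Longrightarrow> c a f = c a f'"
    and bound: "\<And>a f. a \<in> Q \<Longrightarrow> \<bar>c a f\<bar> \<le> K a"
    and K: "\<And>a. a \<in> Q \<Longrightarrow> K a \<le> Kmax" and V: "(\<Sum>a\<in>Q. v a * (K a)\<^sup>2) \<le> V"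
    and \<tau>: "\<tau> > 0" and Kmax: "Kmax \<ge> 0"
  shows "measure_pmf.prob law {f. (\<Sum>a\<in>Q. f a * c a f) > 2 * sqrt (\<tau> * V) + \<tau> * Kmax} \<le> exp (- \<tau>)"
proof -
  have K0: "K a \<ge> 0" if "a \<in> Q" for a using bound[OF that] by (meson abs_ge_zero order_trans)
  have V0: "V \<ge> 0" using V sum_nonneg[of Q "\<lambda>a. v a * (K a)\<^sup>2"] var_nonneg by fastforce
  \<comment> \<open>The exponent is \<open>1 / D\<close>: it keeps every coefficient in the range of
    \<open>mgf_le\<close>, and for \<open>Kmax = 0\<close> it is the Gaussian optimum
    \<open>sqrt (\<tau> / V)\<close>. If \<open>D = 0\<close>, all coefficients vanish.\<close>
  define D where "D = Kmax + sqrt (V / \<tau>)"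
  have D0: "D \<ge> 0" using V0 \<tau> Kmax by (simp add: D_def)
  show ?thesis
  proof (cases "D = 0")
    case True
    hence "Kmax = 0" "sqrt (V / \<tau>) = 0" using Kmax V0 \<tau> by (auto simp: D_def add_nonneg_eq_0_iff)
    hence "c a f = 0" if "a \<in> Q" for a f using bound[OF that] K[OF that] K0[OF that] by (metis abs_le_zero_iff order_antisym)
    hence "(\<Sum>a\<in>Q. f a * c a f) = 0" for f by simp
    moreover have "2 * sqrt (\<tau> * V) + \<tau> * Kmax \<ge> 0" using \<tau> V0 Kmax by simp
    ultimately have "{f. (\<Sum>a\<in>Q. f a * c a f) > 2 * sqrt (\<tau> * V) + \<tau> * Kmax} = {}" by (simp add: not_less)
    thus ?thesis by simp
  next
    case False
    hence D: "D > 0" using D0 by simp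
    have lam: "\<bar>1 / D\<bar> * K a \<le> 1" if "a \<in> Q" for a
    proof -
      have "sqrt (V / \<tau>) \<ge> 0" using V0 \<tau> by (intro real_sqrt_ge_zero) simp
      hence "K a \<le> D" using K[OF that] unfolding D_def by linarith
      thus ?thesis using D by (simp add: divide_le_eq)
    qed
    have "(\<integral>\<^sup>+ f. ennreal (exp (1 / D * (\<Sum>a\<in>Q. f a * c a f))) \<partial>measure_pmf law)
      \<le> ennreal (exp ((1 / D)\<^sup>2 * (\<Sum>a\<in>Q. v a * (K a)\<^sup>2)))"
      by (rule mgf_predictable_sum[OF rk pred bound lam])
    also have "\<dots> \<le> ennreal (exp ((1 / D)\<^sup>2 * V))"
      using V by (intro ennreal_leI) (simp add: mult_left_mono)
    finally have "measure_pmf.prob law {f. (\<Sum>a\<in>Q. f a * c a f) > 2 * sqrt (\<tau> * V) + \<tau> * Kmax}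
      \<le> exp ((1 / D)\<^sup>2 * V - 1 / D * (2 * sqrt (\<tau> * V) + \<tau> * Kmax))"
      using D by (intro pmf_exponential_markov) auto
    also have "\<dots> \<le> exp (- \<tau>)"
    proof -
      \<comment> \<open>In terms of \<open>r\<close> the exponent exceeds \<open>- \<tau>\<close> by
        \<open>\<tau> * (r * (r - D)) / D\<^sup>2\<close>, which is nonpositive because
        \<open>D = Kmax + r\<close>.\<close>
      define r where "r = sqrt (V / \<tau>)"
      have r: "V = \<tau> * r\<^sup>2" "r \<ge> 0" using V0 \<tau> by (auto simp: r_def)
      have s: "sqrt (\<tau> * V) = \<tau> * r"
        using \<tau> r(2) by (simp add: r(1) real_sqrt_mult power2_eq_square)
      have Dr: "D = Kmax + r" by (simp add: D_def r_def)
      have "(1 / D)\<^sup>2 * V - 1 / D * (2 * sqrt (\<tau> * V) + \<tau> * Kmax) + \<tau> = \<tau> * (r * (r - D)) / D\<^sup>2"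
        using D unfolding s unfolding r(1) by (simp add: field_simps power2_eq_square) (simp add: Dr algebra_simps)
      also have "\<dots> \<le> 0"
        using r(2) \<tau> Kmax D by (intro divide_nonpos_nonneg mult_nonneg_nonpos) (auto simp: Dr)
      finally show ?thesis by simp
    qed
    finally show ?thesis .
  qed
qed

lemma linear_tail:
  assumes c: "\<And>a. a \<in> Q \<Longrightarrow> \<bar>c a\<bar> \<le> Kmax" and V: "(\<Sum>a\<in>Q. v a * (c a)\<^sup>2) \<le> V"
    and \<tau>: "\<tau> > 0" and Kmax: "Kmax \<ge> 0"
  shows "measure_pmf.prob law {f. \<bar>\<Sum>a\<in>Q. c a * f a\<bar> > 2 * sqrt (\<tau> * V) + \<tau> * Kmax} \<le> 2 * exp (- \<tau>)"
proof -
  let ?t = "2 * sqrt (\<tau> * V) + \<tau> * Kmax"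
  obtain rk :: "'a \<Rightarrow> nat" where rk: "inj_on rk Q"
    using finite_imp_inj_to_nat_seg[OF finite_index] by blast
  have "measure_pmf.prob law {f. (\<Sum>a\<in>Q. f a * c a) > ?t} \<le> exp (- \<tau>)"
    by (rule predictable_sum_tail[OF rk, where K = "\<lambda>a. \<bar>c a\<bar>"]) (use assms in auto)
  moreover have "measure_pmf.prob law {f. (\<Sum>a\<in>Q. f a * (- c a)) > ?t} \<le> exp (- \<tau>)"
    by (rule predictable_sum_tail[OF rk, where K = "\<lambda>a. \<bar>c a\<bar>"]) (use assms in auto)
  moreover have "{f. \<bar>\<Sum>a\<in>Q. c a * f a\<bar> > ?t} \<subseteq> {f. (\<Sum>a\<in>Q. f a * c a) > ?t} \<union> {f. (\<Sum>a\<in>Q. f a * (- c a)) > ?t}"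
    by (auto simp: sum_negf mult.commute)
  hence "measure_pmf.prob law {f. \<bar>\<Sum>a\<in>Q. c a * f a\<bar> > ?t}
    \<le> measure_pmf.prob law ({f. (\<Sum>a\<in>Q. f a * c a) > ?t} \<union> {f. (\<Sum>a\<in>Q. f a * (- c a)) > ?t})"
    by (rule measure_pmf.finite_measure_mono) simp
  ultimately show ?thesis
    using pmf_prob_Un_le[of law "{f. (\<Sum>a\<in>Q. f a * c a) > ?t}" "exp (- \<tau>)" _ "exp (- \<tau>)"] by fastforce
qed

lemma coordinate_tail:
  assumes a: "a \<in> Q" and \<tau>: "\<tau> > 0"
  shows "measure_pmf.prob law {f. \<bar>f a\<bar> > 2 * sqrt (\<tau> * v a) + \<tau>} \<le> 2 * exp (- \<tau>)"
proof -
  have 1: "(\<Sum>b\<in>Q. (if b = a then 1 else 0) * f b) = f a" for f :: "'a \<Rightarrow> real"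
    using a finite_index by (simp add: if_distrib[of "\<lambda>x. x * _"] sum.delta cong: if_cong)
  have 2: "(\<Sum>b\<in>Q. v b * (if b = a then 1 else 0)\<^sup>2) = v a"
    using a finite_index by (simp add: if_distrib[of "\<lambda>x. _ * x"] if_distrib[of "\<lambda>x. x\<^sup>2"] sum.delta cong: if_cong)
  show ?thesis
    using linear_tail[of "\<lambda>b. if b = a then 1 else 0" 1 "v a" \<tau>] \<tau> by (simp add: 1 2)
qed

text \<open>The factor 2 in front of the mean comes from \<open>exp y \<le> 1 + 2 * y\<close> on \<open>[0, 1]\<close>.\<close>

lemma bounded_nonneg_sum_tail:
  assumes h: "\<And>a y. a \<in> Q \<Longrightarrow> 0 \<le> h a y" "\<And>a y. a \<in> Q \<Longrightarrow> h a y \<le> E"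
    and mean: "\<And>a. a \<in> Q \<Longrightarrow> (\<integral>\<^sup>+ y. ennreal (h a y) \<partial>measure_pmf (p a)) \<le> ennreal (m a)"
    and m: "\<And>a. a \<in> Q \<Longrightarrow> m a \<ge> 0" and E: "E \<ge> 0" and \<tau>: "\<tau> > 0"
  shows "measure_pmf.prob law {f. (\<Sum>a\<in>Q. h a (f a)) > 2 * (\<Sum>a\<in>Q. m a) + \<tau> * E} \<le> exp (- \<tau>)"
proof (cases "E = 0")
  case True
  hence "h a y = 0" if "a \<in> Q" for a y using h[OF that, of y] by simp
  hence "(\<Sum>a\<in>Q. h a (f a)) = 0" for f by simp
  moreover have "(\<Sum>a\<in>Q. m a) \<ge> 0" using m by (rule sum_nonneg)
  ultimately have "{f. (\<Sum>a\<in>Q. h a (f a)) > 2 * (\<Sum>a\<in>Q. m a) + \<tau> * E} = {}"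
    using True by (simp add: not_less)
  thus ?thesis by simp
next
  case False
  hence E: "E > 0" using E by simp
  have one: "(\<integral>\<^sup>+ y. ennreal (exp (1 / E * h a y)) \<partial>measure_pmf (p a)) \<le> ennreal (exp (2 / E * m a))"
    if a: "a \<in> Q" for a
  proof -
    have "(\<integral>\<^sup>+ y. ennreal (exp (1 / E * h a y)) \<partial>measure_pmf (p a))
      \<le> (\<integral>\<^sup>+ y. 1 + ennreal (2 / E) * ennreal (h a y) \<partial>measure_pmf (p a))"
    proof (rule nn_integral_mono)
      fix y
      define u where "u = h a y / E"
      have u: "0 \<le> u" "u \<le> 1" using h[OF a, of y] E by (auto simp: u_def)
      have "exp u \<le> 1 + u + u\<^sup>2" using u by (intro exp_le_quadratic) auto
      also have "u\<^sup>2 \<le> u" using u by (simp add: power2_eq_square mult_left_le)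
      finally have "exp (1 / E * h a y) \<le> 1 + 2 / E * h a y" by (simp add: u_def)
      hence "ennreal (exp (1 / E * h a y)) \<le> ennreal (1 + 2 / E * h a y)" by (rule ennreal_leI)
      also have "\<dots> = 1 + ennreal (2 / E) * ennreal (h a y)"
        using h(1)[OF a, of y] E by (subst ennreal_plus) (auto simp: ennreal_mult[symmetric])
      finally show "ennreal (exp (1 / E * h a y)) \<le> 1 + ennreal (2 / E) * ennreal (h a y)" .
    qed
    also have "\<dots> = 1 + ennreal (2 / E) * (\<integral>\<^sup>+ y. ennreal (h a y) \<partial>measure_pmf (p a))"
      by (subst nn_integral_add) (auto simp: nn_integral_cmult)
    also have "\<dots> \<le> 1 + ennreal (2 / E) * ennreal (m a)"
      using mean[OF a] by (intro add_left_mono mult_left_mono) auto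
    also have "\<dots> = ennreal (1 + 2 / E * m a)"
      using m[OF a] E by (subst ennreal_plus) (auto simp: ennreal_mult[symmetric])
    also have "\<dots> \<le> ennreal (exp (2 / E * m a))"
      by (intro ennreal_leI exp_ge_add_one_self)
    finally show ?thesis .
  qed
  have "(\<integral>\<^sup>+ f. ennreal (exp (1 / E * (\<Sum>a\<in>Q. h a (f a)))) \<partial>measure_pmf law)
    = (\<integral>\<^sup>+ f. (\<Prod>a\<in>Q. ennreal (exp (1 / E * h a (f a)))) \<partial>measure_pmf law)"
    using finite_index by (simp only: sum_distrib_left exp_sum) (simp add: prod_ennreal)
  also have "\<dots> = (\<Prod>a\<in>Q. \<integral>\<^sup>+ y. ennreal (exp (1 / E * h a y)) \<partial>measure_pmf (p a))"
    by (rule nn_integral_prod_Pi_pmf[OF finite_index])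
  also have "\<dots> \<le> (\<Prod>a\<in>Q. ennreal (exp (2 / E * m a)))"
    by (intro prod_mono_ennreal one)
  also have "\<dots> = ennreal (exp (2 / E * (\<Sum>a\<in>Q. m a)))"
    using finite_index by (simp only: sum_distrib_left exp_sum) (simp add: prod_ennreal)
  finally have "measure_pmf.prob law {f. (\<Sum>a\<in>Q. h a (f a)) > 2 * (\<Sum>a\<in>Q. m a) + \<tau> * E}
    \<le> exp (2 / E * (\<Sum>a\<in>Q. m a) - 1 / E * (2 * (\<Sum>a\<in>Q. m a) + \<tau> * E))"
    using E by (intro pmf_exponential_markov) auto
  also have "2 / E * (\<Sum>a\<in>Q. m a) - 1 / E * (2 * (\<Sum>a\<in>Q. m a) + \<tau> * E) = - \<tau>"
    using E by (simp add: field_simps)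
  finally show ?thesis .
qed

text \<open>The off-diagonal part is a martingale along an arbitrary enumeration of the indices.  Its
  increments are truncated at deterministic levels that are exceeded with small probability only.\<close>

lemma quadratic_form_tail:
  assumes sym: "\<And>a b. a \<in> Q \<Longrightarrow> b \<in> Q \<Longrightarrow> M a b = M b a"
    and diag: "\<And>a. a \<in> Q \<Longrightarrow> M a a \<ge> 0"
    and E: "\<And>a. a \<in> Q \<Longrightarrow> M a a * (2 * sqrt (\<tau> * v a) + \<tau>)\<^sup>2 \<le> E" "E \<ge> 0"
    and row: "\<And>a. a \<in> Q \<Longrightarrow> (\<Sum>b\<in>Q. v b * (M a b)\<^sup>2) \<le> W a"
    and entry: "\<And>a b. a \<in> Q \<Longrightarrow> b \<in> Q \<Longrightarrow> \<bar>M a b\<bar> \<le> A a"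
    and K: "\<And>a. a \<in> Q \<Longrightarrow> 2 * sqrt (\<tau> * W a) + \<tau> * A a \<le> K a" "\<And>a. a \<in> Q \<Longrightarrow> K a \<le> Kmax"
    and V: "(\<Sum>a\<in>Q. v a * (K a)\<^sup>2) \<le> V" and Kmax: "Kmax \<ge> 0" and \<tau>: "\<tau> > 0"
  shows "measure_pmf.prob law {f. (\<Sum>a\<in>Q. \<Sum>b\<in>Q. M a b * f a * f b)
      > 8 * (\<Sum>a\<in>Q. M a a * v a) + \<tau> * E + 2 * (2 * sqrt (\<tau> * V) + \<tau> * Kmax)}
    \<le> (4 * real (card Q) + 2) * exp (- \<tau>)"
proof -
  obtain rk :: "'a \<Rightarrow> nat" where rk: "inj_on rk Q"
    using finite_imp_inj_to_nat_seg[OF finite_index] by blast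
  \<comment> \<open>The level of \<open>coordinate_tail\<close>: truncated there, the diagonal terms
    are bounded by \<open>E\<close>, and outside \<open>B1\<close> the truncation changes
    nothing.\<close>
  define \<kappa> where "\<kappa> a = 2 * sqrt (\<tau> * v a) + \<tau>" for a
  define h where "h a y = (if \<bar>y\<bar> \<le> \<kappa> a then M a a * y\<^sup>2 else 0)" for a y
  \<comment> \<open>The part of row \<open>a\<close> that precedes \<open>a\<close> in the
    enumeration. Its truncation \<open>c a\<close> at \<open>K a\<close> is still predictable, and
    the two agree outside \<open>B2\<close>.\<close>
  define D where "D a f = (\<Sum>b\<in>Q. (if rk b < rk a then M a b else 0) * f b)" for a and f :: "'a \<Rightarrow> real"
  define c where "c a f = (if \<bar>D a f\<bar> \<le> K a then D a f else 0)" for a f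
  have D_eq: "D a f = (\<Sum>b\<in>{b\<in>Q. rk b < rk a}. M a b * f b)" for a f
    using finite_index unfolding D_def by (simp add: sum.inter_filter if_distrib[of "\<lambda>x. x * _"] cong: if_cong)
  have A0: "A a \<ge> 0" if "a \<in> Q" for a using entry[OF that that] by linarith
  have W0: "W a \<ge> 0" if "a \<in> Q" for a
    using row[OF that] sum_nonneg[of Q "\<lambda>b. v b * (M a b)\<^sup>2"] var_nonneg by fastforce
  have K0: "K a \<ge> 0" if "a \<in> Q" for a
    using K(1)[OF that] A0[OF that] W0[OF that] \<tau> by (smt (verit) mult_nonneg_nonneg real_sqrt_ge_zero)
  define B1 where "B1 = (\<Union>a\<in>Q. {f :: 'a \<Rightarrow> real. \<bar>f a\<bar> > \<kappa> a})"
  define B2 where "B2 = (\<Union>a\<in>Q. {f. \<bar>D a f\<bar> > K a})"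
  \<comment> \<open>The 4 comes from \<open>second_moment_le\<close>; with the factor 2 of the
    nonnegative sum bound it becomes the 8 of the statement.\<close>
  define B3 where "B3 = {f. (\<Sum>a\<in>Q. h a (f a)) > 2 * (\<Sum>a\<in>Q. M a a * (4 * v a)) + \<tau> * E}"
  define B4 where "B4 = {f. (\<Sum>a\<in>Q. f a * c a f) > 2 * sqrt (\<tau> * V) + \<tau> * Kmax}"
  have P1: "measure_pmf.prob law B1 \<le> real (card Q) * (2 * exp (- \<tau>))"
    unfolding B1_def \<kappa>_def using \<tau> by (intro pmf_prob_UN_le finite_index coordinate_tail)
  have P2: "measure_pmf.prob law B2 \<le> real (card Q) * (2 * exp (- \<tau>))"
    unfolding B2_def
  proof (intro pmf_prob_UN_le finite_index)
    fix a assume a: "a \<in> Q"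
    have "measure_pmf.prob law {f. \<bar>D a f\<bar> > 2 * sqrt (\<tau> * W a) + \<tau> * A a} \<le> 2 * exp (- \<tau>)"
      unfolding D_def
    proof (rule linear_tail)
      show "(\<Sum>b\<in>Q. v b * (if rk b < rk a then M a b else 0)\<^sup>2) \<le> W a"
        using row[OF a] by (rule order_trans[rotated]) (auto intro!: sum_mono simp: var_nonneg)
    qed (use A0[OF a] entry[OF a] \<tau> in auto)
    moreover have "measure_pmf.prob law {f. \<bar>D a f\<bar> > K a}
      \<le> measure_pmf.prob law {f. \<bar>D a f\<bar> > 2 * sqrt (\<tau> * W a) + \<tau> * A a}"
      using K(1)[OF a] by (intro measure_pmf.finite_measure_mono) auto
    ultimately show "measure_pmf.prob law {f. \<bar>D a f\<bar> > K a} \<le> 2 * exp (- \<tau>)" by linarith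
  qed
  have P3: "measure_pmf.prob law B3 \<le> exp (- \<tau>)"
    unfolding B3_def
  proof (rule bounded_nonneg_sum_tail)
    fix a y assume a: "a \<in> Q"
    show "0 \<le> h a y" using diag[OF a] by (simp add: h_def)
    show "h a y \<le> E"
    proof (cases "\<bar>y\<bar> \<le> \<kappa> a")
      case True
      hence "\<bar>y\<bar>\<^sup>2 \<le> (\<kappa> a)\<^sup>2" by (intro power_mono) auto
      hence "M a a * y\<^sup>2 \<le> M a a * (\<kappa> a)\<^sup>2" using diag[OF a] by (intro mult_left_mono) auto
      thus ?thesis using True E(1)[OF a] by (simp add: h_def \<kappa>_def)
    qed (use E in \<open>simp add: h_def\<close>)
  next
    fix a assume a: "a \<in> Q"
    have "(\<integral>\<^sup>+ y. ennreal (h a y) \<partial>measure_pmf (p a)) \<le> (\<integral>\<^sup>+ y. ennreal (M a a) * ennreal (y\<^sup>2) \<partial>measure_pmf (p a))"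
      using diag[OF a] by (intro nn_integral_mono) (auto simp: h_def ennreal_mult[symmetric])
    also have "\<dots> = ennreal (M a a) * (\<integral>\<^sup>+ y. ennreal (y\<^sup>2) \<partial>measure_pmf (p a))"
      by (rule nn_integral_cmult) auto
    also have "\<dots> \<le> ennreal (M a a) * ennreal (4 * v a)"
      using second_moment_le[OF a] by (intro mult_left_mono) auto
    finally show "(\<integral>\<^sup>+ y. ennreal (h a y) \<partial>measure_pmf (p a)) \<le> ennreal (M a a * (4 * v a))"
      using diag[OF a] var_nonneg[OF a] by (simp add: ennreal_mult)
    show "M a a * (4 * v a) \<ge> 0" using diag[OF a] var_nonneg[OF a] by simp
  qed (use E \<tau> in auto)
  have P4: "measure_pmf.prob law B4 \<le> exp (- \<tau>)"
    unfolding B4_def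
  proof (rule predictable_sum_tail[OF rk _ _ K(2) V \<tau> Kmax])
    fix a :: 'a and f f' :: "'a \<Rightarrow> real" assume "\<And>b. rk b < rk a \<Longrightarrow> f b = f' b"
    hence "D a f = D a f'" unfolding D_eq by (intro sum.cong) auto
    thus "c a f = c a f'" by (simp add: c_def)
  next
    fix a f assume "a \<in> Q"
    thus "\<bar>c a f\<bar> \<le> K a" using K0 by (simp add: c_def)
  qed
  have "{f. (\<Sum>a\<in>Q. \<Sum>b\<in>Q. M a b * f a * f b)
      > 8 * (\<Sum>a\<in>Q. M a a * v a) + \<tau> * E + 2 * (2 * sqrt (\<tau> * V) + \<tau> * Kmax)} \<subseteq> B1 \<union> B2 \<union> (B3 \<union> B4)"
  proof (rule ccontr)
    assume "\<not> ?thesis"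
    then obtain f where big: "(\<Sum>a\<in>Q. \<Sum>b\<in>Q. M a b * f a * f b)
      > 8 * (\<Sum>a\<in>Q. M a a * v a) + \<tau> * E + 2 * (2 * sqrt (\<tau> * V) + \<tau> * Kmax)"
      and f: "f \<notin> B1" "f \<notin> B2" "f \<notin> B3" "f \<notin> B4" by auto
    have "h a (f a) = M a a * (f a)\<^sup>2" if "a \<in> Q" for a
      using f(1) that by (auto simp: B1_def h_def)
    moreover have "c a f = D a f" if "a \<in> Q" for a using f(2) that by (auto simp: B2_def c_def)
    moreover have "(\<Sum>a\<in>Q. M a a * (4 * v a)) = 4 * (\<Sum>a\<in>Q. M a a * v a)"
      by (simp add: sum_distrib_left mult_ac)
    ultimately have le: "(\<Sum>a\<in>Q. M a a * (f a)\<^sup>2) \<le> 8 * (\<Sum>a\<in>Q. M a a * v a) + \<tau> * E"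
      "(\<Sum>a\<in>Q. f a * D a f) \<le> 2 * sqrt (\<tau> * V) + \<tau> * Kmax"
      using f(3,4) by (auto simp: B3_def B4_def cong: sum.cong)
    have lower: "(\<Sum>a\<in>Q. \<Sum>b\<in>Q. (if rk b < rk a then M a b * f a * f b else 0)) = (\<Sum>a\<in>Q. f a * D a f)"
      unfolding D_def sum_distrib_left by (intro sum.cong refl) auto
    \<comment> \<open>Diagonal, lower and upper triangle; injectivity of \<open>rk\<close> makes the
      cases exhaustive. By symmetry the triangles have equal sums, hence the factor 2 in front of
      the martingale bound.\<close>
    have "(\<Sum>a\<in>Q. \<Sum>b\<in>Q. M a b * f a * f b) = (\<Sum>a\<in>Q. \<Sum>b\<in>Q. (if b = a then M a b * f a * f b else 0)
       + (if rk b < rk a then M a b * f a * f b else 0) + (if rk a < rk b then M b a * f b * f a else 0))"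
    proof (intro sum.cong refl)
      fix a b assume "a \<in> Q" "b \<in> Q"
      thus "M a b * f a * f b = (if b = a then M a b * f a * f b else 0)
        + (if rk b < rk a then M a b * f a * f b else 0) + (if rk a < rk b then M b a * f b * f a else 0)"
        using inj_onD[OF rk, of a b] sym[of a b] by (cases "rk a" "rk b" rule: linorder_cases) auto
    qed
    also have "\<dots> = (\<Sum>a\<in>Q. \<Sum>b\<in>Q. (if b = a then M a b * f a * f b else 0))
       + (\<Sum>a\<in>Q. \<Sum>b\<in>Q. (if rk b < rk a then M a b * f a * f b else 0))
       + (\<Sum>a\<in>Q. \<Sum>b\<in>Q. (if rk a < rk b then M b a * f b * f a else 0))"
      by (simp only: sum.distrib)
    also have "(\<Sum>a\<in>Q. \<Sum>b\<in>Q. (if rk a < rk b then M b a * f b * f a else 0)) = (\<Sum>a\<in>Q. f a * D a f)"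
      by (subst sum.swap) (rule lower)
    also have "(\<Sum>a\<in>Q. \<Sum>b\<in>Q. (if b = a then M a b * f a * f b else 0)) = (\<Sum>a\<in>Q. M a a * (f a)\<^sup>2)"
      using finite_index by (simp add: sum.delta power2_eq_square mult.assoc)
    also note lower
    finally show False using le big by argo
  qed
  hence "measure_pmf.prob law {f. (\<Sum>a\<in>Q. \<Sum>b\<in>Q. M a b * f a * f b)
      > 8 * (\<Sum>a\<in>Q. M a a * v a) + \<tau> * E + 2 * (2 * sqrt (\<tau> * V) + \<tau> * Kmax)}
    \<le> measure_pmf.prob law (B1 \<union> B2 \<union> (B3 \<union> B4))"
    by (rule measure_pmf.finite_measure_mono) simp
  also have "\<dots> \<le> (real (card Q) * (2 * exp (- \<tau>)) + real (card Q) * (2 * exp (- \<tau>)))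
      + (exp (- \<tau>) + exp (- \<tau>))"
    by (intro pmf_prob_Un_le P1 P2 P3 P4)
  also have "\<dots> = (4 * real (card Q) + 2) * exp (- \<tau>)" by (simp add: algebra_simps)
  finally show ?thesis .
qed

end

section \<open>Noise passed through a projection kernel\<close>

locale kernel_noise = projection_kernel Q v g + indep_subgamma Q p v
  for Q :: "'a set" and v :: "'a \<Rightarrow> real" and g :: "'a \<Rightarrow> 'a \<Rightarrow> real" and p :: "'a \<Rightarrow> real pmf" +
  fixes lv k \<tau> :: real
  assumes diag_le: "a \<in> Q \<Longrightarrow> g a a \<le> lv" and trace_le: "(\<Sum>a\<in>Q. v a * g a a) \<le> k"
    and lv_nonneg: "lv \<ge> 0" and k_nonneg: "k \<ge> 0" and \<tau>_ge_1: "\<tau> \<ge> 1" and \<tau>_lv: "\<tau> ^ 3 * lv \<le> 1"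
begin

definition smooth :: "('a \<Rightarrow> real) \<Rightarrow> 'a \<Rightarrow> real" where
  "smooth f b = (\<Sum>a\<in>Q. g b a * f a)"

lemma \<tau>_lv_le: "\<tau> * lv \<le> 1" "\<tau> ^ 2 * lv \<le> 1"
proof -
  have "\<tau> ^ 1 * lv \<le> \<tau> ^ 3 * lv" "\<tau> ^ 2 * lv \<le> \<tau> ^ 3 * lv"
    using \<tau>_ge_1 lv_nonneg by (intro mult_right_mono power_increasing; simp)+
  thus "\<tau> * lv \<le> 1" "\<tau> ^ 2 * lv \<le> 1" using \<tau>_lv by auto
qed

lemma abs_g_le_lv:
  assumes "a \<in> Q" "b \<in> Q"
  shows "\<bar>g a b\<bar> \<le> sqrt (g a a) * sqrt lv" "\<bar>g a b\<bar> \<le> lv"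
proof -
  show 1: "\<bar>g a b\<bar> \<le> sqrt (g a a) * sqrt lv"
    using abs_g_le[OF assms] diag_le[OF assms(2)] g_diag_nonneg[OF assms(1)]
    by (elim order_trans) (intro mult_left_mono, auto)
  also have "\<dots> \<le> sqrt lv * sqrt lv" using diag_le[OF assms(1)] lv_nonneg by (intro mult_right_mono) auto
  finally show "\<bar>g a b\<bar> \<le> lv" using lv_nonneg by simp
qed

text \<open>Row \<open>b\<close> has variance \<open>g b b\<close> and entries at most
  \<open>sqrt (g b b) * sqrt lv\<close>. As \<open>\<tau> * lv \<le> 1\<close>, the linear Bernstein
  term is at most \<open>sqrt (\<tau> * g b b)\<close>, whence 3 = 2 + 1.\<close>

lemma smooth_tail:
  assumes b: "b \<in> Q"
  shows "measure_pmf.prob law {f. \<bar>smooth f b\<bar> > 3 * sqrt (\<tau> * g b b)} \<le> 2 * exp (- \<tau>)"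
proof -
  have "measure_pmf.prob law {f. \<bar>smooth f b\<bar> > 2 * sqrt (\<tau> * g b b) + \<tau> * (sqrt (g b b) * sqrt lv)} \<le> 2 * exp (- \<tau>)"
    unfolding smooth_def
    by (rule linear_tail) (use abs_g_le_lv b \<tau>_ge_1 g_diag_nonneg lv_nonneg in \<open>auto simp: g_diag_eq\<close>)
  moreover have "2 * sqrt (\<tau> * g b b) + \<tau> * (sqrt (g b b) * sqrt lv) \<le> 3 * sqrt (\<tau> * g b b)"
  proof -
    have "\<tau> * (sqrt (g b b) * sqrt lv) = sqrt (\<tau> * g b b) * sqrt (\<tau> * lv)"
      using \<tau>_ge_1 by (simp add: real_sqrt_mult)
    also have "\<dots> \<le> sqrt (\<tau> * g b b) * 1"
      using \<tau>_lv_le \<tau>_ge_1 g_diag_nonneg[OF b] by (intro mult_left_mono) auto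
    finally show ?thesis by simp
  qed
  moreover from this have "measure_pmf.prob law {f. \<bar>smooth f b\<bar> > 3 * sqrt (\<tau> * g b b)}
    \<le> measure_pmf.prob law {f. \<bar>smooth f b\<bar> > 2 * sqrt (\<tau> * g b b) + \<tau> * (sqrt (g b b) * sqrt lv)}"
    by (intro measure_pmf.finite_measure_mono) auto
  ultimately show ?thesis by linarith
qed

text \<open>Here \<open>f\<close> enters through a quadratic form with matrix \<open>M\<close>.
  Bounding each \<open>smooth f c\<close> separately would give \<open>\<tau> * lv * sqrt k\<close>;
  treating the form as a whole puts \<open>\<tau>\<close> only on the fluctuation, which is governed
  by the row norms of \<open>M\<close>.\<close>

lemma smooth_quadratic_tail:
  assumes b: "b \<in> Q"
  shows "measure_pmf.prob law {f. (\<Sum>c\<in>Q. v c * \<bar>g b c\<bar> * (smooth f c)\<^sup>2) > 16 * lv * sqrt k + 28 * sqrt (\<tau> * lv)}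
    \<le> (4 * real (card Q) + 2) * exp (- \<tau>)"
proof -
  define M where "M a a' = (\<Sum>c\<in>Q. v c * \<bar>g b c\<bar> * g c a * g c a')" for a a'
  define W where "W a = (\<Sum>c\<in>Q. v c * (g b c)\<^sup>2 * (g c a)\<^sup>2)" for a
  \<comment> \<open>One leverage \<open>g a a\<close> is kept in the entry bound, so that the
    weighted sum of the squares can be estimated by the trace.\<close>
  define A where "A a = lv * (sqrt (g a a) * sqrt lv)" for a
  define K where "K a = 2 * sqrt (\<tau> * W a) + \<tau> * A a" for a
  define Kmax where "Kmax = 2 * sqrt (\<tau> * lv ^ 3) + \<tau> * lv\<^sup>2"
  define V where "V = 8 * \<tau> * lv\<^sup>2 + 2 * \<tau>\<^sup>2 * lv ^ 3 * k"
  have \<tau>0: "\<tau> > 0" using \<tau>_ge_1 by simp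
  have quad_eq: "(\<Sum>c\<in>Q. v c * \<bar>g b c\<bar> * (smooth f c)\<^sup>2) = (\<Sum>a\<in>Q. \<Sum>a'\<in>Q. M a a' * f a * f a')" for f
  proof -
    have "(\<Sum>c\<in>Q. v c * \<bar>g b c\<bar> * (smooth f c)\<^sup>2)
      = (\<Sum>c\<in>Q. \<Sum>a\<in>Q. \<Sum>a'\<in>Q. v c * \<bar>g b c\<bar> * g c a * g c a' * f a * f a')"
    proof (rule sum.cong[OF refl])
      fix c
      have "v c * \<bar>g b c\<bar> * (smooth f c)\<^sup>2 = v c * \<bar>g b c\<bar> * (\<Sum>a\<in>Q. \<Sum>a'\<in>Q. (g c a * f a) * (g c a' * f a'))"
        unfolding smooth_def power2_eq_square sum_product ..
      also have "\<dots> = (\<Sum>a\<in>Q. \<Sum>a'\<in>Q. v c * \<bar>g b c\<bar> * ((g c a * f a) * (g c a' * f a')))"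
        by (simp only: sum_distrib_left)
      finally show "v c * \<bar>g b c\<bar> * (smooth f c)\<^sup>2 = (\<Sum>a\<in>Q. \<Sum>a'\<in>Q. v c * \<bar>g b c\<bar> * g c a * g c a' * f a * f a')"
        by (simp add: mult_ac)
    qed
    also have "\<dots> = (\<Sum>a\<in>Q. \<Sum>c\<in>Q. \<Sum>a'\<in>Q. v c * \<bar>g b c\<bar> * g c a * g c a' * f a * f a')" by (rule sum.swap)
    also have "\<dots> = (\<Sum>a\<in>Q. \<Sum>a'\<in>Q. \<Sum>c\<in>Q. v c * \<bar>g b c\<bar> * g c a * g c a' * f a * f a')"
      by (rule sum.cong[OF refl], rule sum.swap)
    also have "\<dots> = (\<Sum>a\<in>Q. \<Sum>a'\<in>Q. M a a' * f a * f a')" by (simp only: M_def sum_distrib_right)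
    finally show ?thesis .
  qed
  have diag0: "M a a \<ge> 0" if "a \<in> Q" for a
  proof -
    have "M a a = (\<Sum>c\<in>Q. v c * \<bar>g b c\<bar> * (g c a)\<^sup>2)" by (simp add: M_def power2_eq_square mult.assoc)
    also have "\<dots> \<ge> 0" using v_nonneg by (intro sum_nonneg) auto
    finally show ?thesis .
  qed
  have Mdiag: "M a a \<le> lv * g a a" if a: "a \<in> Q" for a
  proof -
    have "M a a \<le> (\<Sum>c\<in>Q. lv * (v c * (g a c)\<^sup>2))"
      unfolding M_def
    proof (rule sum_mono)
      fix c assume c: "c \<in> Q"
      have "\<bar>g b c\<bar> * (v c * (g a c)\<^sup>2) \<le> lv * (v c * (g a c)\<^sup>2)"
        using abs_g_le_lv(2)[OF b c] v_nonneg[OF c] by (intro mult_right_mono) auto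
      thus "v c * \<bar>g b c\<bar> * g c a * g c a \<le> lv * (v c * (g a c)\<^sup>2)"
        using g_sym[OF a c] by (simp add: power2_eq_square mult_ac)
    qed
    also have "\<dots> = lv * g a a" by (simp only: sum_distrib_left[symmetric] g_diag_eq[OF a])
    finally show ?thesis .
  qed
  have Mv: "M a a * v a \<le> lv" if a: "a \<in> Q" for a
  proof -
    have "M a a * v a \<le> lv * (v a * g a a)"
      using mult_right_mono[OF Mdiag[OF a] v_nonneg[OF a]] by (simp add: mult_ac)
    also have "\<dots> \<le> lv * 1" using v_g_diag_le_1[OF a] lv_nonneg by (intro mult_left_mono)
    finally show ?thesis by simp
  qed
  have W_nonneg: "W a \<ge> 0" for a
    unfolding W_def using v_nonneg by (intro sum_nonneg) auto
  have g_sq_le: "(g b c)\<^sup>2 \<le> lv\<^sup>2" if "c \<in> Q" for c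
    using power_mono[OF abs_g_le_lv(2)[OF b that], of 2] by simp
  have W_le: "W a \<le> lv ^ 3" if a: "a \<in> Q" for a
  proof -
    have "W a \<le> (\<Sum>c\<in>Q. lv\<^sup>2 * (v c * (g a c)\<^sup>2))"
      unfolding W_def
    proof (rule sum_mono)
      fix c assume c: "c \<in> Q"
      have "(g b c)\<^sup>2 * (v c * (g a c)\<^sup>2) \<le> lv\<^sup>2 * (v c * (g a c)\<^sup>2)"
        using g_sq_le[OF c] v_nonneg[OF c] by (intro mult_right_mono) auto
      thus "v c * (g b c)\<^sup>2 * (g c a)\<^sup>2 \<le> lv\<^sup>2 * (v c * (g a c)\<^sup>2)"
        using g_sym[OF a c] by (simp add: mult_ac)
    qed
    also have "\<dots> = lv\<^sup>2 * g a a" by (simp only: sum_distrib_left[symmetric] g_diag_eq[OF a])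
    also have "\<dots> \<le> lv\<^sup>2 * lv" using diag_le[OF a] by (intro mult_left_mono) auto
    finally show ?thesis by (simp add: power2_eq_square power3_eq_cube)
  qed
  \<comment> \<open>Summing over \<open>a\<close> first leaves \<open>g c c \<le> lv\<close>, and
    the sum over \<open>c\<close> then gives \<open>g b b \<le> lv\<close>. The trace does not
    enter, so the leading term of \<open>V\<close> is free of \<open>k\<close>.\<close>
  have W_sum: "(\<Sum>a\<in>Q. v a * W a) \<le> lv\<^sup>2"
  proof -
    have "(\<Sum>a\<in>Q. v a * W a) = (\<Sum>a\<in>Q. \<Sum>c\<in>Q. v c * (g b c)\<^sup>2 * (v a * (g c a)\<^sup>2))"
      unfolding W_def sum_distrib_left by (simp add: mult_ac)
    also have "\<dots> = (\<Sum>c\<in>Q. \<Sum>a\<in>Q. v c * (g b c)\<^sup>2 * (v a * (g c a)\<^sup>2))" by (rule sum.swap)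
    also have "\<dots> = (\<Sum>c\<in>Q. v c * (g b c)\<^sup>2 * g c c)"
      by (intro sum.cong refl) (simp only: sum_distrib_left[symmetric] g_diag_eq)
    also have "\<dots> \<le> (\<Sum>c\<in>Q. v c * (g b c)\<^sup>2 * lv)"
      using diag_le v_nonneg by (intro sum_mono mult_left_mono) auto
    also have "\<dots> = g b b * lv" by (simp only: sum_distrib_right[symmetric] g_diag_eq[OF b])
    also have "\<dots> \<le> lv * lv" using diag_le[OF b] lv_nonneg by (intro mult_right_mono)
    finally show ?thesis by (simp add: power2_eq_square)
  qed
  \<comment> \<open>Row \<open>a\<close> of \<open>M\<close> is the projection of the function
    \<open>\<bar>g b c\<bar> * g c a\<close> of \<open>c\<close>, so contraction bounds its
    norm.\<close>
  have row: "(\<Sum>a'\<in>Q. v a' * (M a a')\<^sup>2) \<le> W a" if a: "a \<in> Q" for a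
  proof -
    have "M a a' = proj (\<lambda>c. \<bar>g b c\<bar> * g c a) a'" if "a' \<in> Q" for a'
      unfolding M_def proj_def using that by (intro sum.cong refl) (simp add: g_sym[of a'])
    hence "(\<Sum>a'\<in>Q. v a' * (M a a')\<^sup>2) = (\<Sum>a'\<in>Q. v a' * (proj (\<lambda>c. \<bar>g b c\<bar> * g c a) a')\<^sup>2)"
      by simp
    also have "\<dots> \<le> (\<Sum>c\<in>Q. v c * (\<bar>g b c\<bar> * g c a)\<^sup>2)" by (rule proj_contraction)
    also have "\<dots> = W a" by (simp add: W_def power_mult_distrib mult.assoc)
    finally show ?thesis .
  qed
  have entry: "\<bar>M a a'\<bar> \<le> A a" if a: "a \<in> Q" and a': "a' \<in> Q" for a a'
  proof -
    have "\<bar>M a a'\<bar> \<le> (\<Sum>c\<in>Q. \<bar>v c * \<bar>g b c\<bar> * g c a * g c a'\<bar>)" unfolding M_def by (rule sum_abs)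
    also have "\<dots> \<le> (\<Sum>c\<in>Q. lv * (v c * \<bar>g a c\<bar> * \<bar>g a' c\<bar>))"
    proof (rule sum_mono)
      fix c assume c: "c \<in> Q"
      have "\<bar>g b c\<bar> * (v c * \<bar>g a c\<bar> * \<bar>g a' c\<bar>) \<le> lv * (v c * \<bar>g a c\<bar> * \<bar>g a' c\<bar>)"
        using abs_g_le_lv(2)[OF b c] v_nonneg[OF c] by (intro mult_right_mono) auto
      thus "\<bar>v c * \<bar>g b c\<bar> * g c a * g c a'\<bar> \<le> lv * (v c * \<bar>g a c\<bar> * \<bar>g a' c\<bar>)"
        using g_sym[OF a c] g_sym[OF a' c] v_nonneg[OF c] by (simp add: abs_mult mult_ac)
    qed
    also have "\<dots> = lv * (\<Sum>c\<in>Q. v c * \<bar>g a c\<bar> * \<bar>g a' c\<bar>)" by (simp only: sum_distrib_left)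
    also have "(\<Sum>c\<in>Q. v c * \<bar>g a c\<bar> * \<bar>g a' c\<bar>) \<le> sqrt (g a a) * sqrt (g a' a')"
      using Cauchy_Schwarz_sum_weighted[of Q v "\<lambda>c. \<bar>g a c\<bar>" "\<lambda>c. \<bar>g a' c\<bar>"] v_nonneg
      by (simp add: g_diag_eq[OF a] g_diag_eq[OF a'] real_sqrt_mult[symmetric] real_le_rsqrt)
    also have "\<dots> \<le> sqrt (g a a) * sqrt lv"
      using diag_le[OF a'] g_diag_nonneg[OF a] by (intro mult_left_mono) auto
    finally show ?thesis using lv_nonneg by (simp add: A_def mult_left_mono)
  qed
  have A_le: "A a \<le> lv\<^sup>2" if a: "a \<in> Q" for a
  proof -
    have "sqrt (g a a) * sqrt lv \<le> sqrt lv * sqrt lv"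
      using diag_le[OF a] lv_nonneg by (intro mult_right_mono) auto
    thus ?thesis using lv_nonneg by (simp add: A_def power2_eq_square mult_left_mono)
  qed
  have A_sq: "(A a)\<^sup>2 = lv ^ 3 * g a a" if a: "a \<in> Q" for a
    using lv_nonneg g_diag_nonneg[OF a]
    by (simp add: A_def power_mult_distrib) (simp add: power3_eq_cube power2_eq_square)
  have K_V: "(\<Sum>a\<in>Q. v a * (K a)\<^sup>2) \<le> V"
  proof -
    have "(\<Sum>a\<in>Q. v a * (K a)\<^sup>2) \<le> (\<Sum>a\<in>Q. 8 * \<tau> * (v a * W a) + 2 * \<tau>\<^sup>2 * lv ^ 3 * (v a * g a a))"
    proof (rule sum_mono)
      fix a assume a: "a \<in> Q"
      have "(K a)\<^sup>2 \<le> 2 * (2 * sqrt (\<tau> * W a))\<^sup>2 + 2 * (\<tau> * A a)\<^sup>2"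
        using sum_squares_bound[of "2 * sqrt (\<tau> * W a)" "\<tau> * A a"] by (simp add: K_def power2_sum)
      also have "\<dots> = 8 * \<tau> * W a + 2 * \<tau>\<^sup>2 * lv ^ 3 * g a a"
        using W_nonneg[of a] \<tau>0 by (simp add: power_mult_distrib A_sq[OF a])
      finally have "v a * (K a)\<^sup>2 \<le> v a * (8 * \<tau> * W a + 2 * \<tau>\<^sup>2 * lv ^ 3 * g a a)"
        using v_nonneg[OF a] by (rule mult_left_mono)
      thus "v a * (K a)\<^sup>2 \<le> 8 * \<tau> * (v a * W a) + 2 * \<tau>\<^sup>2 * lv ^ 3 * (v a * g a a)"
        by (simp add: algebra_simps)
    qed
    also have "\<dots> = 8 * \<tau> * (\<Sum>a\<in>Q. v a * W a) + 2 * \<tau>\<^sup>2 * lv ^ 3 * (\<Sum>a\<in>Q. v a * g a a)"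
      by (simp only: sum.distrib sum_distrib_left)
    also have "\<dots> \<le> 8 * \<tau> * lv\<^sup>2 + 2 * \<tau>\<^sup>2 * lv ^ 3 * k"
      using W_sum trace_le \<tau>0 lv_nonneg by (intro add_mono mult_left_mono) auto
    finally show ?thesis by (simp add: V_def)
  qed
  \<comment> \<open>The Gaussian part of the truncation level is paid for by
    \<open>v a * g a a \<le> 1\<close>, the linear part by \<open>g a a \<le> lv\<close> and
    \<open>\<tau> * lv \<le> 1\<close>; hence 10 = 8 + 2.\<close>
  have E: "M a a * (2 * sqrt (\<tau> * v a) + \<tau>)\<^sup>2 \<le> 10 * (\<tau> * lv)" if a: "a \<in> Q" for a
  proof -
    have "(2 * sqrt (\<tau> * v a) + \<tau>)\<^sup>2 \<le> 2 * (2 * sqrt (\<tau> * v a))\<^sup>2 + 2 * \<tau>\<^sup>2"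
      using sum_squares_bound[of "2 * sqrt (\<tau> * v a)" "\<tau>"] by (simp add: power2_sum)
    also have "\<dots> = 8 * (\<tau> * v a) + 2 * \<tau>\<^sup>2"
      using v_nonneg[OF a] \<tau>0 by (simp add: power_mult_distrib)
    finally have "M a a * (2 * sqrt (\<tau> * v a) + \<tau>)\<^sup>2 \<le> M a a * (8 * (\<tau> * v a) + 2 * \<tau>\<^sup>2)"
      using diag0[OF a] by (rule mult_left_mono)
    also have "\<dots> = 8 * \<tau> * (M a a * v a) + 2 * \<tau>\<^sup>2 * M a a" by (simp add: algebra_simps)
    also have "\<dots> \<le> 8 * \<tau> * lv + 2 * \<tau>\<^sup>2 * (lv * lv)"
      using Mv[OF a] order_trans[OF Mdiag[OF a] mult_left_mono[OF diag_le[OF a] lv_nonneg]] \<tau>0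
      by (intro add_mono mult_left_mono) auto
    also have "2 * \<tau>\<^sup>2 * (lv * lv) = 2 * (\<tau> * lv) * (\<tau> * lv)" by (simp add: power2_eq_square)
    also have "\<dots> \<le> 2 * (\<tau> * lv) * 1"
      using \<tau>_lv_le \<tau>0 lv_nonneg by (intro mult_left_mono) auto
    finally show ?thesis by simp
  qed
  \<comment> \<open>Cauchy-Schwarz between row \<open>b\<close> of the kernel and its diagonal;
    bounding one leverage by \<open>lv\<close> and summing the other to the trace produces
    \<open>sqrt k\<close>.\<close>
  have mean: "(\<Sum>a\<in>Q. M a a * v a) \<le> lv * sqrt k"
  proof -
    have "(\<Sum>a\<in>Q. M a a * v a) = (\<Sum>a\<in>Q. \<Sum>c\<in>Q. v c * \<bar>g b c\<bar> * (v a * (g c a)\<^sup>2))"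
      unfolding M_def sum_distrib_right by (simp add: power2_eq_square mult_ac)
    also have "\<dots> = (\<Sum>c\<in>Q. \<Sum>a\<in>Q. v c * \<bar>g b c\<bar> * (v a * (g c a)\<^sup>2))" by (rule sum.swap)
    also have "\<dots> = (\<Sum>c\<in>Q. v c * \<bar>g b c\<bar> * g c c)"
      by (intro sum.cong refl) (simp only: sum_distrib_left[symmetric] g_diag_eq)
    also have "\<dots> \<le> sqrt (g b b) * sqrt (\<Sum>c\<in>Q. v c * (g c c)\<^sup>2)"
      using Cauchy_Schwarz_sum_weighted[of Q v "\<lambda>c. \<bar>g b c\<bar>" "\<lambda>c. g c c"] v_nonneg
      by (simp add: g_diag_eq[OF b] real_sqrt_mult[symmetric] real_le_rsqrt)
    also have "\<dots> \<le> sqrt lv * sqrt (lv * k)"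
    proof (intro mult_mono real_sqrt_le_mono)
      have "(\<Sum>c\<in>Q. v c * (g c c)\<^sup>2) \<le> (\<Sum>c\<in>Q. lv * (v c * g c c))"
      proof (rule sum_mono)
        fix c assume c: "c \<in> Q"
        have "g c c * (v c * g c c) \<le> lv * (v c * g c c)"
          using diag_le[OF c] v_nonneg[OF c] g_diag_nonneg[OF c] by (intro mult_right_mono) auto
        thus "v c * (g c c)\<^sup>2 \<le> lv * (v c * g c c)" by (simp add: power2_eq_square mult_ac)
      qed
      also have "\<dots> = lv * (\<Sum>c\<in>Q. v c * g c c)" by (simp only: sum_distrib_left)
      also have "\<dots> \<le> lv * k" using trace_le lv_nonneg by (rule mult_left_mono)
      finally show "(\<Sum>c\<in>Q. v c * (g c c)\<^sup>2) \<le> lv * k" .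
    qed (use diag_le[OF b] lv_nonneg v_nonneg in \<open>auto intro!: sum_nonneg\<close>)
    also have "\<dots> = lv * sqrt k" using lv_nonneg by (simp add: real_sqrt_mult)
    finally show ?thesis .
  qed
  \<comment> \<open>The part of \<open>V\<close> with \<open>k\<close> is absorbed by
    \<open>\<tau> ^ 3 * lv \<le> 1\<close> into the mean, which doubles 8 to 16. All other terms are
    at most 28 = 10 + 12 + 6 times \<open>\<tau>\<^sup>2 * lv\<close>, and \<open>\<tau>\<^sup>2 *
    lv = sqrt (\<tau> * lv) * sqrt (\<tau> ^ 3 * lv)\<close>.\<close>
  have threshold: "8 * (\<Sum>a\<in>Q. M a a * v a) + \<tau> * (10 * (\<tau> * lv)) + 2 * (2 * sqrt (\<tau> * V) + \<tau> * Kmax)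
    \<le> 16 * lv * sqrt k + 28 * sqrt (\<tau> * lv)"
  proof -
    define r where "r = sqrt (\<tau> * lv)"
    have r: "0 \<le> r" "r \<le> 1" "r\<^sup>2 = \<tau> * lv"
      using \<tau>_lv_le \<tau>0 lv_nonneg by (auto simp: r_def)
    have "sqrt (\<tau> * V) \<le> 3 * (\<tau> * lv) + 2 * (lv * sqrt k)"
    proof (rule real_le_lsqrt)
      have "\<tau> * V = 8 * (\<tau> * lv)\<^sup>2 + 2 * (\<tau> ^ 3 * lv) * (lv\<^sup>2 * k)"
        by (simp add: V_def power2_eq_square power3_eq_cube algebra_simps)
      also have "2 * (\<tau> ^ 3 * lv) * (lv\<^sup>2 * k) \<le> 2 * 1 * (lv\<^sup>2 * k)"
        using \<tau>_lv k_nonneg by (intro mult_right_mono) auto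
      also have "lv\<^sup>2 * k = (lv * sqrt k)\<^sup>2" using k_nonneg by (simp add: power_mult_distrib)
      finally have 1: "\<tau> * V \<le> 8 * (\<tau> * lv)\<^sup>2 + 2 * (lv * sqrt k)\<^sup>2" by simp
      have "0 \<le> (\<tau> * lv) * (lv * sqrt k)" using \<tau>0 lv_nonneg k_nonneg by simp
      hence "8 * (\<tau> * lv)\<^sup>2 + 2 * (lv * sqrt k)\<^sup>2 \<le> (3 * (\<tau> * lv) + 2 * (lv * sqrt k))\<^sup>2"
        using zero_le_power2[of "\<tau> * lv"] zero_le_power2[of "lv * sqrt k"]
        by (simp add: power2_sum power_mult_distrib)
      thus "\<tau> * V \<le> (3 * (\<tau> * lv) + 2 * (lv * sqrt k))\<^sup>2" using 1 by linarith
    qed (use \<tau>0 lv_nonneg k_nonneg in auto)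
    moreover have "\<tau> * Kmax \<le> 3 * (\<tau>\<^sup>2 * lv)"
    proof -
      have "sqrt (\<tau> * lv ^ 3) = lv * r"
        using lv_nonneg by (simp add: r_def real_sqrt_mult power3_eq_cube)
      hence "\<tau> * Kmax = 2 * (\<tau> * lv) * r + (\<tau> * lv) * (\<tau> * lv)"
        by (simp add: Kmax_def power2_eq_square algebra_simps)
      also have "\<dots> \<le> 2 * (\<tau> * lv) * 1 + (\<tau> * lv) * 1"
        using r \<tau>0 lv_nonneg \<tau>_lv_le by (intro add_mono mult_left_mono) auto
      also have "\<dots> = 3 * (1 * (\<tau> * lv))" by simp
      also have "\<dots> \<le> 3 * (\<tau> * (\<tau> * lv))"
        using \<tau>_ge_1 lv_nonneg by (intro mult_left_mono mult_right_mono) auto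
      finally show ?thesis by (simp add: power2_eq_square mult.assoc)
    qed
    moreover have "\<tau> * lv \<le> \<tau>\<^sup>2 * lv"
      using \<tau>_ge_1 lv_nonneg by (simp add: power2_eq_square mult_right_mono)
    moreover have "\<tau>\<^sup>2 * lv \<le> r"
    proof -
      have "\<tau>\<^sup>2 * lv = r * sqrt (\<tau> ^ 3 * lv)"
        using \<tau>0 lv_nonneg by (simp add: r_def real_sqrt_mult[symmetric])
          (simp add: real_sqrt_mult power2_eq_square power3_eq_cube mult_ac)
      also have "\<dots> \<le> r * 1" using \<tau>_lv r by (intro mult_left_mono) auto
      finally show ?thesis by simp
    qed
    moreover have "\<tau> * (10 * (\<tau> * lv)) = 10 * (\<tau>\<^sup>2 * lv)" by (simp add: power2_eq_square)
    moreover have "16 * lv * sqrt k = 16 * (lv * sqrt k)" by simp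
    ultimately show ?thesis using mean unfolding r_def[symmetric] by argo
  qed
  have "measure_pmf.prob law {f. (\<Sum>a\<in>Q. \<Sum>a'\<in>Q. M a a' * f a * f a')
      > 8 * (\<Sum>a\<in>Q. M a a * v a) + \<tau> * (10 * (\<tau> * lv)) + 2 * (2 * sqrt (\<tau> * V) + \<tau> * Kmax)}
    \<le> (4 * real (card Q) + 2) * exp (- \<tau>)"
  proof (rule quadratic_form_tail[where W = W and A = A and K = K])
    fix a a' show "M a a' = M a' a" by (simp add: M_def mult_ac)
  next
    fix a assume a: "a \<in> Q"
    show "K a \<le> Kmax" unfolding K_def Kmax_def
      using W_le[OF a] A_le[OF a] \<tau>0 by (intro add_mono mult_left_mono real_sqrt_le_mono) auto
  qed (use diag0 E row entry K_V \<tau>0 lv_nonneg in \<open>auto simp: K_def Kmax_def\<close>)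
  moreover have "measure_pmf.prob law {f. (\<Sum>c\<in>Q. v c * \<bar>g b c\<bar> * (smooth f c)\<^sup>2) > 16 * lv * sqrt k + 28 * sqrt (\<tau> * lv)}
    \<le> measure_pmf.prob law {f. (\<Sum>a\<in>Q. \<Sum>a'\<in>Q. M a a' * f a * f a')
      > 8 * (\<Sum>a\<in>Q. M a a * v a) + \<tau> * (10 * (\<tau> * lv)) + 2 * (2 * sqrt (\<tau> * V) + \<tau> * Kmax)}"
    using threshold by (intro measure_pmf.finite_measure_mono) (auto simp: quad_eq)
  ultimately show ?thesis by linarith
qed

lemma noise_event_prob:
  "measure_pmf.prob law {f. (\<forall>b\<in>Q. (smooth f b)\<^sup>2 \<le> 9 * \<tau> * g b b) \<and>
      (\<forall>b\<in>Q. (\<Sum>c\<in>Q. v c * \<bar>g b c\<bar> * (smooth f c)\<^sup>2) \<le> 16 * lv * sqrt k + 28 * sqrt (\<tau> * lv))}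
    \<ge> 1 - real (card Q) * (4 * real (card Q) + 4) * exp (- \<tau>)" (is "measure_pmf.prob law ?G \<ge> _")
proof -
  define B where "B b = {f. \<bar>smooth f b\<bar> > 3 * sqrt (\<tau> * g b b)} \<union>
    {f. (\<Sum>c\<in>Q. v c * \<bar>g b c\<bar> * (smooth f c)\<^sup>2) > 16 * lv * sqrt k + 28 * sqrt (\<tau> * lv)}" for b
  have sub: "- ?G \<subseteq> (\<Union>b\<in>Q. B b)"
  proof
    fix f assume f: "f \<in> - ?G"
    show "f \<in> (\<Union>b\<in>Q. B b)"
    proof (rule ccontr)
      assume n: "f \<notin> (\<Union>b\<in>Q. B b)"
      have "(smooth f b)\<^sup>2 \<le> 9 * \<tau> * g b b" if b: "b \<in> Q" for b
      proof -
        have "\<bar>smooth f b\<bar>\<^sup>2 \<le> (3 * sqrt (\<tau> * g b b))\<^sup>2"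
          using n b by (intro power_mono) (auto simp: B_def not_less)
        thus ?thesis using \<tau>_ge_1 g_diag_nonneg[OF b] by (simp add: power_mult_distrib)
      qed
      thus False using f n by (auto simp: B_def not_less)
    qed
  qed
  have "1 - measure_pmf.prob law ?G = measure_pmf.prob law (- ?G)"
    using measure_pmf.prob_compl[of ?G law] by (simp add: Compl_eq_Diff_UNIV)
  also have "\<dots> \<le> measure_pmf.prob law (\<Union>b\<in>Q. B b)"
    using sub by (rule measure_pmf.finite_measure_mono) simp
  also have "\<dots> \<le> real (card Q) * (2 * exp (- \<tau>) + (4 * real (card Q) + 2) * exp (- \<tau>))"
    unfolding B_def by (intro pmf_prob_UN_le pmf_prob_Un_le finite_Q smooth_tail smooth_quadratic_tail)
  also have "\<dots> = real (card Q) * (4 * real (card Q) + 4) * exp (- \<tau>)" by (simp add: algebra_simps)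
  finally show ?thesis by linarith
qed

end

section \<open>Gram matrices\<close>

lemma scalar_prod_vec_sum:
  fixes w :: "real vec"
  assumes w: "w \<in> carrier_vec k" and x: "\<And>c. c \<in> Q \<Longrightarrow> x c \<in> carrier_vec k"
  shows "w \<bullet> vec k (\<lambda>j. \<Sum>c\<in>Q. s c * x c $ j) = (\<Sum>c\<in>Q. s c * (w \<bullet> x c))"
proof -
  have "w \<bullet> vec k (\<lambda>j. \<Sum>c\<in>Q. s c * x c $ j) = (\<Sum>j\<in>{0..<k}. \<Sum>c\<in>Q. s c * (w $ j * x c $ j))"
    by (simp add: scalar_prod_def sum_distrib_left mult_ac)
  also have "\<dots> = (\<Sum>c\<in>Q. \<Sum>j\<in>{0..<k}. s c * (w $ j * x c $ j))" by (rule sum.swap)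
  also have "\<dots> = (\<Sum>c\<in>Q. s c * (w \<bullet> x c))"
  proof (rule sum.cong[OF refl])
    fix c assume "c \<in> Q"
    hence "dim_vec (x c) = k" using x by auto
    thus "(\<Sum>j\<in>{0..<k}. s c * (w $ j * x c $ j)) = s c * (w \<bullet> x c)"
      by (simp add: scalar_prod_def sum_distrib_left)
  qed
  finally show ?thesis .
qed

definition gram :: "'a set \<Rightarrow> ('a \<Rightarrow> real) \<Rightarrow> ('a \<Rightarrow> real vec) \<Rightarrow> nat \<Rightarrow> real mat" where
  "gram Q v x k = mat k k (\<lambda>(i, j). \<Sum>c\<in>Q. v c * (x c $ i * x c $ j))"

lemma gram_carrier [simp]: "gram Q v x k \<in> carrier_mat k k"
  by (simp add: gram_def)

lemma gram_mult_vec: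
  assumes u: "u \<in> carrier_vec k" and x: "\<And>c. c \<in> Q \<Longrightarrow> x c \<in> carrier_vec k"
  shows "gram Q v x k *\<^sub>v u = vec k (\<lambda>i. \<Sum>c\<in>Q. (v c * (x c \<bullet> u)) * x c $ i)"
proof (rule eq_vecI)
  fix i assume "i < dim_vec (vec k (\<lambda>i. \<Sum>c\<in>Q. (v c * (x c \<bullet> u)) * x c $ i))"
  hence i: "i < k" by simp
  have "(gram Q v x k *\<^sub>v u) $ i = (\<Sum>j\<in>{0..<k}. \<Sum>c\<in>Q. v c * x c $ i * (x c $ j * u $ j))"
    using i u by (simp add: gram_def scalar_prod_def sum_distrib_right sum_distrib_left mult_ac)
  also have "\<dots> = (\<Sum>c\<in>Q. \<Sum>j\<in>{0..<k}. v c * x c $ i * (x c $ j * u $ j))" by (rule sum.swap)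
  also have "\<dots> = (\<Sum>c\<in>Q. (v c * (x c \<bullet> u)) * x c $ i)"
    using u by (intro sum.cong refl) (simp add: scalar_prod_def sum_distrib_left sum_distrib_right mult_ac)
  finally show "(gram Q v x k *\<^sub>v u) $ i = vec k (\<lambda>i. \<Sum>c\<in>Q. (v c * (x c \<bullet> u)) * x c $ i) $ i"
    using i by simp
qed (simp add: gram_def)

lemma gram_bilinear:
  assumes w: "w \<in> carrier_vec k" and u: "u \<in> carrier_vec k" and x: "\<And>c. c \<in> Q \<Longrightarrow> x c \<in> carrier_vec k"
  shows "w \<bullet> (gram Q v x k *\<^sub>v u) = (\<Sum>c\<in>Q. v c * (x c \<bullet> w) * (x c \<bullet> u))"
proof -
  have "w \<bullet> (gram Q v x k *\<^sub>v u) = (\<Sum>c\<in>Q. (v c * (x c \<bullet> u)) * (w \<bullet> x c))"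
    by (subst gram_mult_vec[OF u x]) (assumption, rule scalar_prod_vec_sum[OF w x])
  also have "\<dots> = (\<Sum>c\<in>Q. v c * (x c \<bullet> w) * (x c \<bullet> u))"
    using x w by (intro sum.cong refl) (simp add: comm_scalar_prod[of w k])
  finally show ?thesis .
qed

text \<open>On a null vector the quadratic form, a sum of squares with positive weights, would
  vanish, contrary to \<open>span\<close>.\<close>

lemma gram_invertible:
  assumes fin: "finite Q" and v: "\<And>c. c \<in> Q \<Longrightarrow> v c > 0" and x: "\<And>c. c \<in> Q \<Longrightarrow> x c \<in> carrier_vec k"
    and span: "\<And>u. u \<in> carrier_vec k \<Longrightarrow> u \<noteq> 0\<^sub>v k \<Longrightarrow> \<exists>c\<in>Q. x c \<bullet> u \<noteq> 0"
  shows "\<exists>G. mat_inverse (gram Q v x k) = Some G"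
proof (cases "mat_inverse (gram Q v x k)")
  case None
  hence "gram Q v x k \<notin> Units (ring_mat TYPE(real) k ())"
    by (rule mat_inverse(1)[OF gram_carrier])
  hence "det (gram Q v x k) = 0" using det_non_zero_imp_unit[OF gram_carrier[of Q v x k]] by metis
  then obtain u where u: "u \<in> carrier_vec k" "u \<noteq> 0\<^sub>v k" "gram Q v x k *\<^sub>v u = 0\<^sub>v k"
    using det_0_iff_vec_prod_zero_field[OF gram_carrier] by blast
  obtain c where c: "c \<in> Q" "x c \<bullet> u \<noteq> 0" using span u by blast
  have "0 = u \<bullet> (gram Q v x k *\<^sub>v u)" using u by simp
  also have "\<dots> = (\<Sum>c\<in>Q. v c * (x c \<bullet> u) * (x c \<bullet> u))" by (rule gram_bilinear[OF u(1) u(1) x])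
  also have "\<dots> \<ge> v c * (x c \<bullet> u) * (x c \<bullet> u)"
    using fin c v by (intro member_le_sum) (auto simp: mult.assoc less_imp_le)
  finally have "v c * (x c \<bullet> u)\<^sup>2 \<le> 0" by (simp add: power2_eq_square mult.assoc)
  moreover have "v c * (x c \<bullet> u)\<^sup>2 > 0" using c v by simp
  ultimately show ?thesis by linarith
qed auto

locale gram_inverse =
  fixes Q :: "'a set" and v :: "'a \<Rightarrow> real" and x :: "'a \<Rightarrow> real vec" and k :: nat and G :: "real mat"
  assumes fin: "finite Q" and pos: "c \<in> Q \<Longrightarrow> v c > 0" and x_carrier: "c \<in> Q \<Longrightarrow> x c \<in> carrier_vec k"
    and inverse: "mat_inverse (gram Q v x k) = Some G"
begin

definition ker :: "'a \<Rightarrow> 'a \<Rightarrow> real" where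
  "ker a b = x a \<bullet> (G *\<^sub>v x b)"

lemma G_carrier: "G \<in> carrier_mat k k"
  and gram_G: "gram Q v x k * G = 1\<^sub>m k" and G_gram: "G * gram Q v x k = 1\<^sub>m k"
  using mat_inverse(2)[OF gram_carrier inverse] by auto

lemma Gx_carrier: "c \<in> Q \<Longrightarrow> G *\<^sub>v x c \<in> carrier_vec k"
  using G_carrier x_carrier by simp

text \<open>Writing \<open>x b\<close> as the Gram matrix applied to \<open>G *\<^sub>v x b\<close>
  and pairing with \<open>u\<close> turns an evaluation into a weighted inner product with the
  kernel.\<close>

lemma reproducing:
  assumes u: "u \<in> carrier_vec k" and b: "b \<in> Q"
  shows "x b \<bullet> u = (\<Sum>c\<in>Q. v c * ker c b * (x c \<bullet> u))"
proof -
  have "x b = (gram Q v x k * G) *\<^sub>v x b" using x_carrier[OF b] by (simp add: gram_G)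
  also have "\<dots> = gram Q v x k *\<^sub>v (G *\<^sub>v x b)"
    by (rule assoc_mult_mat_vec[OF gram_carrier G_carrier x_carrier[OF b]])
  finally have "u \<bullet> x b = u \<bullet> (gram Q v x k *\<^sub>v (G *\<^sub>v x b))" by simp
  also have "\<dots> = (\<Sum>c\<in>Q. v c * (x c \<bullet> u) * ker c b)"
    unfolding ker_def by (rule gram_bilinear[OF u Gx_carrier[OF b] x_carrier])
  finally show ?thesis using comm_scalar_prod[OF u x_carrier[OF b]] by (simp add: mult_ac)
qed

lemma ker_gram: "a \<in> Q \<Longrightarrow> b \<in> Q \<Longrightarrow> ker b a = (\<Sum>c\<in>Q. v c * ker c b * ker c a)"
  using reproducing[OF Gx_carrier, of a b] by (simp add: ker_def)

text \<open>Read off from \<open>ker_gram\<close>, whose right-hand side is symmetric in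
  \<open>a\<close> and \<open>b\<close>; no symmetry of the matrix \<open>G\<close> is
  established.\<close>

lemma ker_sym: "a \<in> Q \<Longrightarrow> b \<in> Q \<Longrightarrow> ker a b = ker b a"
  using ker_gram[of a b] ker_gram[of b a] by (simp add: mult_ac)

sublocale projection_kernel Q v ker
proof
  fix a b assume ab: "a \<in> Q" "b \<in> Q"
  show "ker a b = ker b a" using ab by (rule ker_sym)
  show "(\<Sum>c\<in>Q. v c * ker a c * ker c b) = ker a b"
    using ker_gram[OF ab(2,1)] ab by (simp add: ker_sym[of a] cong: sum.cong)
qed (use fin pos in auto)

text \<open>Cyclicity of the trace: the sum is the trace of \<open>G\<close> times the Gram matrix,
  which is the identity.\<close>

lemma trace_ker: "(\<Sum>a\<in>Q. v a * ker a a) = real k"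
proof -
  have "(\<Sum>a\<in>Q. v a * ker a a) = (\<Sum>a\<in>Q. \<Sum>i\<in>{0..<k}. \<Sum>j\<in>{0..<k}. G $$ (i, j) * (v a * (x a $ j * x a $ i)))"
    unfolding ker_def
  proof (rule sum.cong[OF refl])
    fix a assume "a \<in> Q"
    hence "dim_vec (x a) = k" using x_carrier by auto
    thus "v a * (x a \<bullet> (G *\<^sub>v x a))
      = (\<Sum>i\<in>{0..<k}. \<Sum>j\<in>{0..<k}. G $$ (i, j) * (v a * (x a $ j * x a $ i)))"
      using G_carrier by (simp add: scalar_prod_def sum_distrib_left mult_ac)
  qed
  also have "\<dots> = (\<Sum>i\<in>{0..<k}. \<Sum>a\<in>Q. \<Sum>j\<in>{0..<k}. G $$ (i, j) * (v a * (x a $ j * x a $ i)))" by (rule sum.swap)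
  also have "\<dots> = (\<Sum>i\<in>{0..<k}. \<Sum>j\<in>{0..<k}. \<Sum>a\<in>Q. G $$ (i, j) * (v a * (x a $ j * x a $ i)))"
    by (rule sum.cong[OF refl], rule sum.swap)
  also have "\<dots> = (\<Sum>i\<in>{0..<k}. (G * gram Q v x k) $$ (i, i))"
    using G_carrier by (intro sum.cong refl) (auto simp: gram_def scalar_prod_def sum_distrib_left)
  also have "\<dots> = real k" by (simp add: G_gram)
  finally show ?thesis .
qed

lemma eq_zero_if_orthogonal:
  assumes u: "u \<in> carrier_vec k" and 0: "\<And>a. a \<in> Q \<Longrightarrow> x a \<bullet> u = 0"
  shows "u = 0\<^sub>v k"
proof -
  have "gram Q v x k *\<^sub>v u = 0\<^sub>v k"
    by (subst gram_mult_vec[OF u x_carrier]) (assumption, auto simp: 0)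
  hence "G *\<^sub>v (gram Q v x k *\<^sub>v u) = 0\<^sub>v k" using G_carrier by (intro eq_vecI) auto
  thus ?thesis using assoc_mult_mat_vec[OF G_carrier gram_carrier[of Q v x k] u] u by (simp add: G_gram)
qed

text \<open>The witness is the weighted least squares solution for the data \<open>z\<close>; its
  fitted values are \<open>proj z\<close>, hence \<open>z\<close>.\<close>

lemma range_proj_representable:
  assumes z: "z \<in> range_proj"
  shows "\<exists>u\<in>carrier_vec k. \<forall>a\<in>Q. x a \<bullet> u = z a"
proof
  define b where "b = vec k (\<lambda>j. \<Sum>c\<in>Q. (v c * z c) * x c $ j)"
  have b: "b \<in> carrier_vec k" by (simp add: b_def)
  show "G *\<^sub>v b \<in> carrier_vec k" using G_carrier b by simp
  show "\<forall>a\<in>Q. x a \<bullet> (G *\<^sub>v b) = z a"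
  proof
    fix a assume a: "a \<in> Q"
    have "x a \<bullet> (G *\<^sub>v b) = (transpose_mat G *\<^sub>v x a) \<bullet> b"
      using transpose_vec_mult_scalar[OF G_carrier b x_carrier[OF a]] by simp
    also have "\<dots> = (\<Sum>c\<in>Q. (v c * z c) * ((transpose_mat G *\<^sub>v x a) \<bullet> x c))"
      unfolding b_def using G_carrier x_carrier[OF a] x_carrier by (intro scalar_prod_vec_sum) auto
    also have "\<dots> = (\<Sum>c\<in>Q. (v c * z c) * ker a c)"
      using transpose_vec_mult_scalar[OF G_carrier x_carrier x_carrier[OF a]]
      by (intro sum.cong refl) (simp add: ker_def)
    also have "\<dots> = z a" using range_projD(2)[OF z a] by (simp add: proj_def mult_ac)
    finally show "x a \<bullet> (G *\<^sub>v b) = z a" .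
  qed
qed

lemma evaluation_in_range_proj:
  assumes u: "u \<in> carrier_vec k"
  shows "(\<lambda>a. if a \<in> Q then x a \<bullet> u else 0) \<in> range_proj"
proof (rule range_projI)
  fix a assume a: "a \<in> Q"
  have "proj (\<lambda>a. if a \<in> Q then x a \<bullet> u else 0) a = (\<Sum>c\<in>Q. v c * ker c a * (x c \<bullet> u))"
    unfolding proj_def using a by (intro sum.cong refl) (simp add: ker_sym[of a])
  also have "\<dots> = x a \<bullet> u" by (rule reproducing[OF u a, symmetric])
  finally show "proj (\<lambda>a. if a \<in> Q then x a \<bullet> u else 0) a = (if a \<in> Q then x a \<bullet> u else 0)"
    using a by simp
qed simp

end

text \<open>Cauchy--Schwarz in the inner product of the dominated design.\<close>

lemma leverage_comparison:
  assumes 1: "gram_inverse Q v x k G" and 2: "gram_inverse Q w x k G'"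
    and dom: "\<And>c. c \<in> Q \<Longrightarrow> w c \<le> C * v c" and a: "a \<in> Q" and C: "C \<ge> 0"
  shows "gram_inverse.ker x G a a \<le> C * gram_inverse.ker x G' a a"
proof -
  interpret A: gram_inverse Q v x k G by (rule 1)
  interpret B: gram_inverse Q w x k G' by (rule 2)
  define h where "h = A.ker a a"
  define h' where "h' = B.ker a a"
  \<comment> \<open>The evaluation of \<open>G *\<^sub>v x a\<close> at \<open>x a\<close> is
    expanded in the dominated design. The weighted square sums of the two factors are
    \<open>h'\<close> and at most \<open>C * h\<close>.\<close>
  have "h = (\<Sum>c\<in>Q. w c * B.ker c a * A.ker c a)"
    unfolding h_def A.ker_def by (rule B.reproducing[OF A.Gx_carrier[OF a] a, unfolded A.ker_def])
  hence "h\<^sup>2 \<le> (\<Sum>c\<in>Q. w c * (B.ker c a)\<^sup>2) * (\<Sum>c\<in>Q. w c * (A.ker c a)\<^sup>2)"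
    using Cauchy_Schwarz_sum_weighted[of Q w "\<lambda>c. B.ker c a" "\<lambda>c. A.ker c a"] B.v_nonneg by simp
  also have "(\<Sum>c\<in>Q. w c * (B.ker c a)\<^sup>2) = h'"
    by (simp only: B.g_diag_eq'[OF a] h'_def)
  also have "h' * (\<Sum>c\<in>Q. w c * (A.ker c a)\<^sup>2) \<le> h' * (C * h)"
  proof (rule mult_left_mono)
    have "(\<Sum>c\<in>Q. w c * (A.ker c a)\<^sup>2) \<le> (\<Sum>c\<in>Q. C * (v c * (A.ker c a)\<^sup>2))"
      using dom by (intro sum_mono) (simp add: mult.assoc[symmetric] mult_right_mono)
    also have "\<dots> = C * h" by (simp only: sum_distrib_left[symmetric] A.g_diag_eq'[OF a] h_def)
    finally show "(\<Sum>c\<in>Q. w c * (A.ker c a)\<^sup>2) \<le> C * h" .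
    show "h' \<ge> 0" using B.g_diag_nonneg[OF a] by (simp add: h'_def)
  qed
  finally have le: "h * h \<le> (C * h') * h" by (simp add: power2_eq_square mult_ac)
  have "h \<ge> 0" "h' \<ge> 0" using A.g_diag_nonneg[OF a] B.g_diag_nonneg[OF a] by (auto simp: h_def h'_def)
  have "h \<le> C * h'"
  proof (cases "h = 0")
    case False
    thus ?thesis using le \<open>h \<ge> 0\<close> by (intro mult_right_le_imp_le[of h h "C * h'"]) simp_all
  qed (use C \<open>h' \<ge> 0\<close> in simp)
  thus ?thesis by (simp add: h_def h'_def)
qed

section \<open>The Bradley--Terry--Luce model\<close>

text \<open>Statistics of disjoint blocks of independent coordinates are independent;
  \<open>local\<close> says that \<open>s a\<close> reads only its own block. One block is split off
  at a time.\<close>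

lemma Pi_pmf_Sigma_blocks:
  fixes B :: "'a \<Rightarrow> 'b set" and d :: 'c and s :: "'a \<Rightarrow> ('a \<times> 'b \<Rightarrow> 'c) \<Rightarrow> 'd"
  assumes fin: "finite Q" and finB: "\<And>a. a \<in> Q \<Longrightarrow> finite (B a)"
    and local: "\<And>a f f'. a \<in> Q \<Longrightarrow> (\<And>t. t \<in> B a \<Longrightarrow> f (a, t) = f' (a, t)) \<Longrightarrow> s a f = s a f'"
  shows "map_pmf (\<lambda>f a. if a \<in> Q then s a f else z) (Pi_pmf (Sigma Q B) d p)
    = Pi_pmf Q z (\<lambda>a. map_pmf (s a) (Pi_pmf ({a} \<times> B a) d p))"
  using assms
proof (induction Q rule: finite_induct)
  case empty
  show ?case by simp
next
  case (insert b Q)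
  have IH: "map_pmf (\<lambda>f a. if a \<in> Q then s a f else z) (Pi_pmf (Sigma Q B) d p)
    = Pi_pmf Q z (\<lambda>a. map_pmf (s a) (Pi_pmf ({a} \<times> B a) d p))"
    by (rule insert.IH) (fact insert.prems(1)[OF insertI2], rule insert.prems(2)[OF insertI2])
  have "map_pmf (\<lambda>f a. if a \<in> insert b Q then s a f else z) (Pi_pmf (Sigma (insert b Q) B) d p)
    = map_pmf (\<lambda>f a. if a \<in> insert b Q then s a f else z)
        (map_pmf (\<lambda>(f, h) i. if i \<in> {b} \<times> B b then f i else h i)
          (pair_pmf (Pi_pmf ({b} \<times> B b) d p) (Pi_pmf (Sigma Q B) d p)))"
  proof -
    have "Sigma (insert b Q) B = {b} \<times> B b \<union> Sigma Q B" by auto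
    moreover have "({b} \<times> B b) \<inter> Sigma Q B = {}" using insert.hyps by auto
    moreover have "finite ({b} \<times> B b)" "finite (Sigma Q B)"
      using insert.hyps(1) insert.prems(1) by (auto intro!: finite_SigmaI)
    ultimately show ?thesis by (simp only: Pi_pmf_union)
  qed
  also have "\<dots> = map_pmf (\<lambda>(f, h) a. if a = b then s b f else if a \<in> Q then s a h else z)
          (pair_pmf (Pi_pmf ({b} \<times> B b) d p) (Pi_pmf (Sigma Q B) d p))"
    unfolding map_pmf_comp
  proof (intro map_pmf_cong refl)
    fix fh :: "('a \<times> 'b \<Rightarrow> 'c) \<times> ('a \<times> 'b \<Rightarrow> 'c)"
    obtain f h where fh: "fh = (f, h)" by (cases fh)
    let ?m = "\<lambda>i. if i \<in> {b} \<times> B b then f i else h i"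
    have "s b ?m = s b f" by (rule insert.prems(2)) auto
    moreover have "s a ?m = s a h" if "a \<in> Q" for a
      using that insert.hyps by (intro insert.prems(2)) auto
    ultimately show "(\<lambda>a. if a \<in> insert b Q
        then s a ((case fh of (f, h) \<Rightarrow> \<lambda>i. if i \<in> {b} \<times> B b then f i else h i)) else z)
      = (case fh of (f, h) \<Rightarrow> \<lambda>a. if a = b then s b f else if a \<in> Q then s a h else z)"
      by (auto simp: fh fun_eq_iff)
  qed
  also have "\<dots> = map_pmf (\<lambda>(y, f). f(b := y)) (map_pmf (\<lambda>(f, h). (s b f, \<lambda>a. if a \<in> Q then s a h else z))
          (pair_pmf (Pi_pmf ({b} \<times> B b) d p) (Pi_pmf (Sigma Q B) d p)))"
    unfolding map_pmf_comp by (intro map_pmf_cong refl) (auto simp: fun_eq_iff)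
  also have "\<dots> = map_pmf (\<lambda>(y, f). f(b := y)) (pair_pmf (map_pmf (s b) (Pi_pmf ({b} \<times> B b) d p))
      (Pi_pmf Q z (\<lambda>a. map_pmf (s a) (Pi_pmf ({a} \<times> B a) d p))))"
    by (simp only: map_pair IH)
  also have "\<dots> = Pi_pmf (insert b Q) z (\<lambda>a. map_pmf (s a) (Pi_pmf ({a} \<times> B a) d p))"
    using insert.hyps by (simp add: Pi_pmf_insert)
  finally show ?case .
qed

text \<open>In the quadratic bound for the exponential the linear terms cancel in the mean and the
  quadratic ones average to the variance. Hence the proxy of a centred count is its exact variance,
  which for query \<open>a\<close> is \<open>v a\<close>.\<close>

lemma bernoulli_mgf_le:
  assumes P: "0 \<le> P" "P \<le> 1" and s: "\<bar>s\<bar> \<le> 1"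
  shows "(\<integral>\<^sup>+ b. ennreal (exp (s * (of_bool b - P))) \<partial>measure_pmf (bernoulli_pmf P))
    \<le> ennreal (exp (s\<^sup>2 * (P * (1 - P))))"
proof -
  have le1: "\<bar>s * t\<bar> \<le> 1" if "0 \<le> t" "t \<le> 1" for t
    using mult_mono[of "\<bar>s\<bar>" 1 "\<bar>t\<bar>" 1] that s by (simp add: abs_mult)
  have "(\<integral>\<^sup>+ b. ennreal (exp (s * (of_bool b - P))) \<partial>measure_pmf (bernoulli_pmf P))
    = ennreal (exp (s * (1 - P)) * P + exp (- (s * P)) * (1 - P))"
    using P by (simp add: ennreal_mult[symmetric] flip: ennreal_plus)
  also have "\<dots> \<le> ennreal (exp (s\<^sup>2 * (P * (1 - P))))"
  proof (rule ennreal_leI)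
    have "exp (s * (1 - P)) * P + exp (- (s * P)) * (1 - P)
      \<le> (1 + s * (1 - P) + (s * (1 - P))\<^sup>2) * P + (1 + - (s * P) + (- (s * P))\<^sup>2) * (1 - P)"
      using P le1[of P] le1[of "1 - P"] by (intro add_mono mult_right_mono exp_le_quadratic) auto
    also have "\<dots> = 1 + s\<^sup>2 * (P * (1 - P))" by (simp add: algebra_simps power2_eq_square)
    also have "\<dots> \<le> exp (s\<^sup>2 * (P * (1 - P)))" by (rule exp_ge_add_one_self)
    finally show "exp (s * (1 - P)) * P + exp (- (s * P)) * (1 - P) \<le> exp (s\<^sup>2 * (P * (1 - P)))" .
  qed
  finally show ?thesis .
qed

lemma bernoulli_sum_mgf_le:
  assumes fin: "finite A" and P: "0 \<le> P" "P \<le> 1" and s: "\<bar>s\<bar> \<le> 1"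
  shows "(\<integral>\<^sup>+ f. ennreal (exp (s * (\<Sum>i\<in>A. of_bool (f i) - P))) \<partial>measure_pmf (Pi_pmf A False (\<lambda>_. bernoulli_pmf P)))
    \<le> ennreal (exp (s\<^sup>2 * (real (card A) * (P * (1 - P)))))"
proof -
  have "(\<integral>\<^sup>+ f. ennreal (exp (s * (\<Sum>i\<in>A. of_bool (f i) - P))) \<partial>measure_pmf (Pi_pmf A False (\<lambda>_. bernoulli_pmf P)))
    = (\<integral>\<^sup>+ f. (\<Prod>i\<in>A. ennreal (exp (s * (of_bool (f i) - P)))) \<partial>measure_pmf (Pi_pmf A False (\<lambda>_. bernoulli_pmf P)))"
    using fin by (simp only: sum_distrib_left exp_sum) (simp add: prod_ennreal)
  also have "\<dots> = (\<Prod>i\<in>A. \<integral>\<^sup>+ b. ennreal (exp (s * (of_bool b - P))) \<partial>measure_pmf (bernoulli_pmf P))"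
    by (rule nn_integral_prod_Pi_pmf[OF fin])
  also have "\<dots> \<le> (\<Prod>i\<in>A. ennreal (exp (s\<^sup>2 * (P * (1 - P)))))"
    by (intro prod_mono_ennreal bernoulli_mgf_le P s)
  also have "\<dots> = ennreal (exp (\<Sum>i\<in>A. s\<^sup>2 * (P * (1 - P))))"
    using fin by (simp only: exp_sum) (simp add: prod_ennreal ennreal_power)
  finally show ?thesis by (simp add: mult_ac)
qed

section \<open>The model as an instance of the kernel framework\<close>

locale btl_model =
  fixes S :: btl and \<theta>s :: "real vec" and B :: real
  assumes setting: "btl_setting S" and B: "B > 1" and \<theta>s: "\<theta>s \<in> carrier_vec (dim_theta S)"
    and logit_le: "(MAX \<alpha>\<in>queries S. \<bar>logit S \<theta>s \<alpha>\<bar>) \<le> ln B"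
    and pos_def: "pos_def_mat (dim_theta S) (design_mat S)"
begin

abbreviation "Q \<equiv> queries S"
abbreviation "k \<equiv> dim_theta S"
abbreviation "\<sigma> \<equiv> scale S"
abbreviation "N \<equiv> real (sample_size S)"
abbreviation "\<eta> \<equiv> logit S \<theta>s"

definition n :: "nat \<times> nat \<Rightarrow> real" where "n a = real (reps S a)"
definition v :: "nat \<times> nat \<Rightarrow> real" where "v a = n a * dsigm (\<eta> a)"
definition x :: "nat \<times> nat \<Rightarrow> real vec" where "x a = (1 / \<sigma>) \<cdot>\<^sub>v red_query_vec S a"
definition G :: "real mat" where "G = the (mat_inverse (gram Q v x k))"
definition cnt :: "response \<Rightarrow> nat \<times> nat \<Rightarrow> real" where "cnt y a = (\<Sum>t<reps S a. of_bool (y (a, t)))"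

lemma finite_Q: "finite Q"
proof (rule finite_subset)
  show "Q \<subseteq> {..<num_items S} \<times> {..<num_items S}"
    using setting unfolding btl_setting_def by fastforce
qed auto

lemma card_Q_le: "real (card Q) \<le> (real (num_items S))\<^sup>2"
proof -
  have "Q \<subseteq> {..<num_items S} \<times> {..<num_items S}"
    using setting unfolding btl_setting_def by fastforce
  hence "card Q \<le> card ({..<num_items S} \<times> {..<num_items S})" by (intro card_mono) auto
  hence "real (card Q) \<le> real (num_items S * num_items S)"
    by (simp only: card_cartesian_product card_lessThan of_nat_le_iff)
  thus ?thesis by (simp add: power2_eq_square)
qed

lemma Q_nonempty: "Q \<noteq> {}" and \<sigma>_pos: "\<sigma> > 0" and k_pos: "k \<ge> 1" and n_pos: "a \<in> Q \<Longrightarrow> n a > 0"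
  and items: "num_items S \<ge> 2"
  using setting by (auto simp: btl_setting_def n_def Suc_le_eq)

lemma N_eq: "N = (\<Sum>a\<in>Q. n a)"
  by (simp add: sample_size_def n_def)

lemma N_pos: "N > 0"
  unfolding N_eq using finite_Q Q_nonempty n_pos by (intro sum_pos) auto

lemma v_pos: "a \<in> Q \<Longrightarrow> v a > 0"
  by (simp add: v_def n_pos dsigm_pos)

lemma q_carrier [simp]: "red_query_vec S a \<in> carrier_vec k"
  using setting by (intro carrier_vecI) (auto simp: btl_setting_def red_query_vec_def)

lemma q_dim [simp]: "dim_vec (red_query_vec S a) = k"
  using q_carrier by (rule carrier_vecD)

lemma x_carrier [simp]: "x a \<in> carrier_vec k"
  by (simp add: x_def)

lemma x_scalar: "u \<in> carrier_vec k \<Longrightarrow> x a \<bullet> u = (red_query_vec S a \<bullet> u) / \<sigma>"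
  by (simp add: x_def carrier_vecD)

lemma x_index: "i < k \<Longrightarrow> x a $ i = red_query_vec S a $ i / \<sigma>"
  by (simp add: x_def)

text \<open>The design matrix and the Hessian are Gram matrices of the same scaled vectors
  \<open>x\<close> and differ only in their weights, which makes their leverages comparable.\<close>

lemma design_mat_eq: "design_mat S = gram Q (\<lambda>a. \<sigma>\<^sup>2 / N * n a) x k"
proof (rule eq_matI)
  fix i j assume "i < dim_row (gram Q (\<lambda>a. \<sigma>\<^sup>2 / N * n a) x k)" "j < dim_col (gram Q (\<lambda>a. \<sigma>\<^sup>2 / N * n a) x k)"
  hence ij: "i < k" "j < k" by (auto simp: gram_def)
  have "(\<Sum>c\<in>Q. \<sigma>\<^sup>2 / N * n c * (x c $ i * x c $ j))
    = (\<Sum>c\<in>Q. 1 / N * (real (reps S c) * (red_query_vec S c $ i * red_query_vec S c $ j)))"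
    using \<sigma>_pos ij by (intro sum.cong refl) (simp add: x_index n_def power2_eq_square)
  thus "design_mat S $$ (i, j) = gram Q (\<lambda>a. \<sigma>\<^sup>2 / N * n a) x k $$ (i, j)"
    using ij by (simp add: design_mat_def gram_def sum_distrib_left sum_divide_distrib)
qed (auto simp: design_mat_def gram_def)

lemma spanning:
  assumes u: "u \<in> carrier_vec k" "u \<noteq> 0\<^sub>v k"
  shows "\<exists>c\<in>Q. x c \<bullet> u \<noteq> 0"
proof (rule ccontr)
  assume "\<not> ?thesis"
  hence 0: "x c \<bullet> u = 0" if "c \<in> Q" for c using that by blast
  have "u \<bullet> (design_mat S *\<^sub>v u) = (\<Sum>c\<in>Q. \<sigma>\<^sup>2 / N * n c * (x c \<bullet> u) * (x c \<bullet> u))"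
    unfolding design_mat_eq by (rule gram_bilinear) (use u in auto)
  also have "\<dots> = 0" by (simp add: 0)
  finally show False using pos_def u unfolding pos_def_mat_def by fastforce
qed

lemma gram_inverse_of:
  assumes "\<And>c. c \<in> Q \<Longrightarrow> w c > 0"
  shows "gram_inverse Q w x k (the (mat_inverse (gram Q w x k)))"
proof -
  have "\<exists>G'. mat_inverse (gram Q w x k) = Some G'"
    by (rule gram_invertible) (use finite_Q assms spanning in auto)
  then obtain G' where "mat_inverse (gram Q w x k) = Some G'" ..
  thus ?thesis by unfold_locales (use finite_Q assms in auto)
qed

sublocale gram_inverse Q v x k G
  unfolding G_def by (rule gram_inverse_of[OF v_pos])

text \<open>Since \<open>dsigm t\<close> is the reciprocal of \<open>2 + exp t + exp (- t)\<close>,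
  and both exponentials are at most \<open>B > 1\<close>, the denominator is at most
  \<open>4 * B\<close>.\<close>

lemma dsigm_ge:
  assumes a: "a \<in> Q"
  shows "dsigm (\<eta> a) \<ge> 1 / (4 * B)"
proof -
  have "\<bar>\<eta> a\<bar> \<le> (MAX \<alpha>\<in>Q. \<bar>\<eta> \<alpha>\<bar>)" using a finite_Q by (intro Max_ge) auto
  hence "\<bar>\<eta> a\<bar> \<le> ln B" using logit_le by linarith
  hence "exp (\<eta> a) \<le> exp (ln B)" "exp (- \<eta> a) \<le> exp (ln B)" by (subst exp_le_cancel_iff, linarith)+
  hence e: "exp (\<eta> a) \<le> B" "exp (- \<eta> a) \<le> B" using B by auto
  have "(1 + exp (\<eta> a))\<^sup>2 = exp (\<eta> a) * (2 + exp (\<eta> a) + exp (- \<eta> a))"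
    by (simp add: power2_eq_square exp_minus field_simps)
  also have "\<dots> \<le> exp (\<eta> a) * (4 * B)" using e B by (intro mult_left_mono) auto
  finally show ?thesis
    using B one_plus_exp_pos[of "\<eta> a"] by (simp add: dsigm_def field_simps)
qed

text \<open>\<open>coherence S * real k\<close> is the largest leverage of the design matrix;
  \<open>4 * B / N\<close> is the price of passing to the weights \<open>v\<close>, and the scale
  cancels.\<close>

definition lv :: real where "lv = 4 * B * coherence S * real k / N"

lemma ker_diag_le_lv:
  assumes a: "a \<in> Q"
  shows "ker a a \<le> lv"
proof -
  let ?w = "\<lambda>a. \<sigma>\<^sup>2 / N * n a"
  have w: "?w c > 0" if "c \<in> Q" for c using that n_pos N_pos \<sigma>_pos by simp
  define W where "W = the (mat_inverse (gram Q ?w x k))"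
  interpret W: gram_inverse Q ?w x k W unfolding W_def by (rule gram_inverse_of[OF w])
  let ?q = "red_query_vec S a"
  have dom: "?w c \<le> 4 * B * \<sigma>\<^sup>2 / N * v c" if c: "c \<in> Q" for c
  proof -
    have "1 \<le> 4 * B * dsigm (\<eta> c)" using dsigm_ge[OF c] B by (simp add: field_simps)
    hence "\<sigma>\<^sup>2 / N * n c * 1 \<le> \<sigma>\<^sup>2 / N * n c * (4 * B * dsigm (\<eta> c))"
      using w[OF c] by (intro mult_left_mono) auto
    thus ?thesis by (simp add: v_def mult_ac)
  qed
  have "ker a a \<le> 4 * B * \<sigma>\<^sup>2 / N * W.ker a a"
    by (rule leverage_comparison[OF gram_inverse_axioms W.gram_inverse_axioms dom a]) (use B in simp_all)
  also have "W.ker a a = (?q \<bullet> (W *\<^sub>v ?q)) / \<sigma>\<^sup>2"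
  proof -
    have Wq: "W *\<^sub>v x a = (1 / \<sigma>) \<cdot>\<^sub>v (W *\<^sub>v ?q)"
      unfolding x_def by (rule mult_mat_vec[OF W.G_carrier q_carrier])
    have "W *\<^sub>v ?q \<in> carrier_vec k" using W.G_carrier by simp
    hence "x a \<bullet> (W *\<^sub>v x a) = (1 / \<sigma>) * ((?q \<bullet> (W *\<^sub>v ?q)) / \<sigma>)"
      unfolding Wq by (subst scalar_prod_smult_distrib[of _ k]) (auto simp: x_scalar)
    thus ?thesis by (simp add: W.ker_def power2_eq_square)
  qed
  also have "?q \<bullet> (W *\<^sub>v ?q) \<le> coherence S * real k"
  proof -
    have "1 / real k * (?q \<bullet> (W *\<^sub>v ?q)) \<le> coherence S"
      unfolding coherence_def design_mat_eq W_def using a finite_Q by (intro Max_ge) auto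
    thus ?thesis using k_pos by (simp add: field_simps)
  qed
  finally show ?thesis using B N_pos \<sigma>_pos
    by (simp add: lv_def divide_right_mono mult_left_mono field_simps)
qed

lemma lv_nonneg: "lv \<ge> 0"
  using Q_nonempty ker_diag_le_lv g_diag_nonneg by (meson ex_in_conv order_trans)

text \<open>The centred counts, summed over blocks of the response index set so that
  \<open>Pi_pmf_Sigma_blocks\<close> applies; the value 0 off \<open>Q\<close> is the default of the
  product law.\<close>

definition dev :: "response \<Rightarrow> nat \<times> nat \<Rightarrow> real" where
  "dev y a = (if a \<in> Q then \<Sum>i\<in>{a} \<times> {..<reps S a}. of_bool (y i) - sigm (\<eta> a) else 0)"

definition dev_law :: "nat \<times> nat \<Rightarrow> real pmf" where
  "dev_law a = map_pmf (\<lambda>y. \<Sum>i\<in>{a} \<times> {..<reps S a}. of_bool (y i) - sigm (\<eta> a))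
     (Pi_pmf ({a} \<times> {..<reps S a}) False (\<lambda>(a, t). bernoulli_pmf (sigm (\<eta> a))))"

lemma dev_eq: "a \<in> Q \<Longrightarrow> dev y a = cnt y a - n a * sigm (\<eta> a)"
proof -
  assume a: "a \<in> Q"
  have "(\<Sum>i\<in>{a} \<times> {..<reps S a}. of_bool (y i) - sigm (\<eta> a)) = (\<Sum>t<reps S a. of_bool (y (a, t)) - sigm (\<eta> a))"
    by (rule sum.reindex_bij_witness[of _ "\<lambda>t. (a, t)" snd]) auto
  thus ?thesis using a by (simp add: dev_def cnt_def n_def sum_subtractf)
qed

lemma map_dev_response: "map_pmf dev (response_pmf S \<theta>s) = Pi_pmf Q 0 dev_law"
  unfolding response_pmf_def dev_def[abs_def] dev_law_def sigm_def
  by (rule Pi_pmf_Sigma_blocks) (auto simp: finite_Q intro!: sum.cong)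

lemma mgf_dev_law:
  assumes a: "a \<in> Q" and s: "\<bar>s\<bar> \<le> 1"
  shows "(\<integral>\<^sup>+ y. ennreal (exp (s * y)) \<partial>measure_pmf (dev_law a)) \<le> ennreal (exp (s\<^sup>2 * v a))"
proof -
  let ?A = "{a} \<times> {..<reps S a}" and ?P = "sigm (\<eta> a)"
  have "Pi_pmf ?A False (\<lambda>(a, t). bernoulli_pmf (sigm (\<eta> a))) = Pi_pmf ?A False (\<lambda>_. bernoulli_pmf ?P)"
    by (intro Pi_pmf_cong) auto
  hence "(\<integral>\<^sup>+ y. ennreal (exp (s * y)) \<partial>measure_pmf (dev_law a))
    = (\<integral>\<^sup>+ f. ennreal (exp (s * (\<Sum>i\<in>?A. of_bool (f i) - ?P))) \<partial>measure_pmf (Pi_pmf ?A False (\<lambda>_. bernoulli_pmf ?P)))"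
    by (simp only: dev_law_def nn_integral_map_pmf)
  also have "\<dots> \<le> ennreal (exp (s\<^sup>2 * (real (card ?A) * (?P * (1 - ?P)))))"
    using sigm_bounds[of "\<eta> a"] s by (intro bernoulli_sum_mgf_le) auto
  also have "\<dots> = ennreal (exp (s\<^sup>2 * v a))"
    by (simp add: v_def n_def dsigm_eq card_cartesian_product)
  finally show ?thesis .
qed

text \<open>A deterministic statement about one response. The bound \<open>1 / 10 ^ 6\<close> yields
  \<open>sqrt (\<tau> * lv) \<le> 1 / 10 ^ 3\<close> and so \<open>T \<le> 1 / 16\<close>. Inserting
  \<open>T\<close> into \<open>3 * sqrt (\<tau> * lv) + 4 * T\<close> gives 115 = 3 + 4 * 28 and 64
  = 4 * 16.\<close>

lemma mle_near_truth:
  fixes \<tau> :: real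
  assumes \<tau>: "\<tau> \<ge> 1" and small: "\<tau> ^ 3 * lv * sqrt (real k) \<le> 1 / 10 ^ 6"
    and lin: "\<And>b. b \<in> Q \<Longrightarrow> (\<Sum>a\<in>Q. ker b a * dev y a)\<^sup>2 \<le> 9 * \<tau> * ker b b"
    and quad: "\<And>b. b \<in> Q \<Longrightarrow> (\<Sum>c\<in>Q. v c * \<bar>ker b c\<bar> * (\<Sum>a\<in>Q. ker c a * dev y a)\<^sup>2)
      \<le> 16 * lv * sqrt (real k) + 28 * sqrt (\<tau> * lv)"
  shows "\<exists>\<theta>h\<in>carrier_vec k. (\<forall>\<theta>. is_mle S y \<theta> \<longleftrightarrow> \<theta> = \<theta>h) \<and>
    (\<forall>a\<in>Q. \<bar>x a \<bullet> (\<theta>h - \<theta>s)\<bar> \<le> 115 * sqrt (\<tau> * lv) + 64 * lv * sqrt (real k)) \<and>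
    (\<Sum>a\<in>Q. v a * (x a \<bullet> (\<theta>h - \<theta>s))\<^sup>2) \<le> 19 * \<tau> * real k"
proof -
  interpret L: logistic_kernel Q v ker \<eta> n "cnt y"
    by unfold_locales (auto simp: n_pos v_def)
  define T where "T = 16 * lv * sqrt (real k) + 28 * sqrt (\<tau> * lv)"
  have lin_est: "L.lin_est b = (\<Sum>a\<in>Q. ker b a * dev y a)" if "b \<in> Q" for b
    using that by (simp add: L.lin_est_def dev_eq cong: sum.cong)
  have sqrtk: "sqrt (real k) \<ge> 1" using k_pos by simp
  have powers: "\<tau> ^ i * lv * c \<le> \<tau> ^ 3 * lv * sqrt (real k)" if "i \<le> 3" "0 \<le> c" "c \<le> sqrt (real k)" for i c
    using that \<tau> lv_nonneg by (intro mult_mono power_increasing) auto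
  have b0: "lv * sqrt (real k) \<le> 1 / 10 ^ 6" and b1: "\<tau> * lv \<le> 1 / 10 ^ 6"
    and b1k: "\<tau> * lv * sqrt (real k) \<le> 1 / 10 ^ 6"
    using powers[of 0 "sqrt (real k)"] powers[of 1 1] powers[of 1 "sqrt (real k)"] sqrtk small by auto
  have sq: "sqrt (\<tau> * lv) \<le> 1 / 10 ^ 3" using b1 by (intro real_le_lsqrt) (auto simp: power2_eq_square)
  have T: "T \<le> 1 / 16" "T \<ge> 0"
    using b0 sq \<tau> lv_nonneg by (auto simp: T_def)
  obtain z where z: "z \<in> range_proj" and min: "\<And>z'. z' \<in> range_proj \<Longrightarrow> z' \<noteq> z \<Longrightarrow> L.loss z < L.loss z'"
    and zsup: "\<And>a. a \<in> Q \<Longrightarrow> \<bar>z a\<bar> \<le> 3 * sqrt (\<tau> * lv) + 4 * T" and zsq: "(\<Sum>a\<in>Q. v a * (z a)\<^sup>2) \<le> 19 * \<tau> * real k"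
    using L.minimiser_exists_near_lin_est[of lv "real k" \<tau> T] ker_diag_le_lv trace_ker lv_nonneg \<tau> T b1 b1k
      lin quad by (auto simp: lin_est T_def cong: sum.cong)
  obtain u where u: "u \<in> carrier_vec k" and xu: "\<And>a. a \<in> Q \<Longrightarrow> x a \<bullet> u = z a"
    using range_proj_representable[OF z] by blast
  define \<theta>h where "\<theta>h = \<theta>s + u"
  have h: "\<theta>h \<in> carrier_vec k" and hu: "\<theta>h - \<theta>s = u" using u \<theta>s by (auto simp: \<theta>h_def)
  \<comment> \<open>Translates parameters into predictor displacements. It maps into the range and
    separates parameters, so the unique minimiser \<open>z\<close> lifts to a unique maximum
    likelihood estimator.\<close>
  define ev where "ev \<theta> = (\<lambda>a. if a \<in> Q then x a \<bullet> (\<theta> - \<theta>s) else 0)" for \<theta>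
  have nll: "neg_log_lik S y \<theta> = L.loss (ev \<theta>) / N" if \<theta>: "\<theta> \<in> carrier_vec k" for \<theta>
  proof -
    have "logit S \<theta> a = \<eta> a + ev \<theta> a" if "a \<in> Q" for a
    proof -
      have "x a \<bullet> (\<theta> - \<theta>s) = (red_query_vec S a \<bullet> \<theta> - red_query_vec S a \<bullet> \<theta>s) / \<sigma>"
        using \<theta> \<theta>s by (simp add: x_scalar scalar_prod_minus_distrib[of _ k] diff_divide_distrib)
      thus ?thesis using that by (simp add: ev_def logit_def add_divide_distrib diff_divide_distrib)
    qed
    thus ?thesis by (simp add: neg_log_lik_def L.loss_def cnt_def n_def cong: sum.cong)
  qed
  have ev_h: "ev \<theta>h = z"
  proof
    fix a show "ev \<theta>h a = z a" using xu[of a] range_projD(1)[OF z, of a] by (simp add: ev_def hu)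
  qed
  have less: "neg_log_lik S y \<theta>h < neg_log_lik S y \<theta>" if \<theta>: "\<theta> \<in> carrier_vec k" "\<theta> \<noteq> \<theta>h" for \<theta>
  proof -
    have "ev \<theta> \<in> range_proj" unfolding ev_def using \<theta> \<theta>s by (intro evaluation_in_range_proj) auto
    moreover have "ev \<theta> \<noteq> z"
    proof
      assume eq: "ev \<theta> = z"
      have "x a \<bullet> (\<theta> - \<theta>h) = 0" if a: "a \<in> Q" for a
      proof -
        have "\<theta> - \<theta>h = (\<theta> - \<theta>s) - u" using \<theta> \<theta>s u by (auto simp: \<theta>h_def)
        hence "x a \<bullet> (\<theta> - \<theta>h) = x a \<bullet> (\<theta> - \<theta>s) - x a \<bullet> u"
          using \<theta> \<theta>s u by (simp add: scalar_prod_minus_distrib[of _ k])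
        also have "x a \<bullet> (\<theta> - \<theta>s) = z a" using fun_cong[OF eq, of a] a by (simp add: ev_def)
        finally show ?thesis using xu[OF a] by simp
      qed
      hence "\<theta> - \<theta>h = 0\<^sub>v k" using \<theta> h by (intro eq_zero_if_orthogonal) auto
      hence 0: "(\<theta> - \<theta>h) $ i = 0" if "i < k" for i using that by simp
      have "\<theta> = \<theta>h"
      proof (rule eq_vecI)
        fix i assume "i < dim_vec \<theta>h"
        thus "\<theta> $ i = \<theta>h $ i" using 0[of i] \<theta> h by simp
      qed (use \<theta> h in simp)
      thus False using \<theta> by simp
    qed
    ultimately have "L.loss z < L.loss (ev \<theta>)" by (rule min)
    thus ?thesis using N_pos nll[OF \<theta>(1)] nll[OF h] by (simp add: ev_h divide_strict_right_mono)
  qed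
  have "is_mle S y \<theta> \<longleftrightarrow> \<theta> = \<theta>h" for \<theta>
    unfolding is_mle_def is_arg_min_def using less h by (metis less_asym less_irrefl)
  moreover have "\<bar>x a \<bullet> (\<theta>h - \<theta>s)\<bar> \<le> 115 * sqrt (\<tau> * lv) + 64 * lv * sqrt (real k)" if "a \<in> Q" for a
    using zsup[OF that] xu[OF that] by (simp add: hu T_def)
  moreover have "(\<Sum>a\<in>Q. v a * (x a \<bullet> (\<theta>h - \<theta>s))\<^sup>2) \<le> 19 * \<tau> * real k"
    using zsq xu by (simp add: hu cong: sum.cong)
  ultimately show ?thesis using h by blast
qed

lemma query_norm_le:
  assumes u: "u \<in> carrier_vec k" and le: "\<And>a. a \<in> Q \<Longrightarrow> \<bar>x a \<bullet> u\<bar> \<le> r"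
  shows "query_norm S u \<le> \<sigma> * r"
  unfolding query_norm_def
proof (rule Max.boundedI)
  fix t assume "t \<in> (\<lambda>\<alpha>. \<bar>red_query_vec S \<alpha> \<bullet> u\<bar>) ` Q"
  then obtain a where a: "a \<in> Q" "t = \<bar>red_query_vec S a \<bullet> u\<bar>" by auto
  have "red_query_vec S a \<bullet> u = \<sigma> * (x a \<bullet> u)" using u \<sigma>_pos by (simp add: x_scalar)
  thus "t \<le> \<sigma> * r" using le[OF a(1)] \<sigma>_pos by (simp add: a abs_mult)
qed (use finite_Q Q_nonempty in auto)

lemma mat_norm_hessian:
  assumes u: "u \<in> carrier_vec k"
  shows "mat_norm (hessian k (neg_log_lik S y) \<theta>s) u = sqrt ((\<Sum>a\<in>Q. v a * (x a \<bullet> u)\<^sup>2) / N)"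
proof -
  have "hessian k (neg_log_lik S y) \<theta>s = gram Q (\<lambda>a. v a / N) x k"
    unfolding hessian_neg_log_lik[OF setting \<theta>s]
  proof (rule eq_matI)
    fix i j assume "i < dim_row (gram Q (\<lambda>a. v a / N) x k)" "j < dim_col (gram Q (\<lambda>a. v a / N) x k)"
    hence ij: "i < k" "j < k" by (auto simp: gram_def)
    have "(\<Sum>c\<in>Q. v c / N * (x c $ i * x c $ j)) = (\<Sum>c\<in>Q. 1 / (N * \<sigma>\<^sup>2) * (real (reps S c) *
      (exp (\<eta> c) / (1 + exp (\<eta> c))\<^sup>2) * (red_query_vec S c $ i * red_query_vec S c $ j)))"
      using ij by (intro sum.cong refl) (simp add: x_index v_def n_def dsigm_def power2_eq_square)
    thus "mat k k (\<lambda>(i, j). 1 / (N * \<sigma>\<^sup>2) * (\<Sum>\<alpha>\<in>Q. real (reps S \<alpha>) *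
      (exp (\<eta> \<alpha>) / (1 + exp (\<eta> \<alpha>))\<^sup>2) * (red_query_vec S \<alpha> $ i * red_query_vec S \<alpha> $ j))) $$ (i, j)
      = gram Q (\<lambda>a. v a / N) x k $$ (i, j)"
      using ij by (simp add: gram_def sum_distrib_left)
  qed (auto simp: gram_def)
  hence "u \<bullet> (hessian k (neg_log_lik S y) \<theta>s *\<^sub>v u) = (\<Sum>a\<in>Q. v a / N * (x a \<bullet> u) * (x a \<bullet> u))"
    using u by (simp add: gram_bilinear)
  thus ?thesis by (simp add: mat_norm_def sum_divide_distrib power2_eq_square mult_ac)
qed

text \<open>The noise event concerns the product law of the centred counts. Its preimage under
  \<open>dev\<close> has the same probability under the response law and lies in the event
  claimed.\<close>

lemma main_event:
  fixes \<tau> :: real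
  assumes \<tau>: "\<tau> \<ge> 1" and small: "\<tau> ^ 3 * lv * sqrt (real k) \<le> 1 / 10 ^ 6"
  shows "measure_pmf.prob (response_pmf S \<theta>s) {y. \<exists>\<theta>h\<in>carrier_vec k. (\<forall>\<theta>. is_mle S y \<theta> \<longleftrightarrow> \<theta> = \<theta>h) \<and>
      query_norm S (\<theta>h - \<theta>s) \<le> \<sigma> * (115 * sqrt (\<tau> * lv) + 64 * lv * sqrt (real k)) \<and>
      mat_norm (hessian k (neg_log_lik S y) \<theta>s) (\<theta>h - \<theta>s) \<le> sqrt (19 * \<tau> * real k / N)}
    \<ge> 1 - real (card Q) * (4 * real (card Q) + 4) * exp (- \<tau>)" (is "measure_pmf.prob _ ?E \<ge> _")
proof -
  interpret K: kernel_noise Q v ker dev_law lv "real k" \<tau>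
  proof unfold_locales
    have "\<tau> ^ 3 * lv * 1 \<le> \<tau> ^ 3 * lv * sqrt (real k)"
      using k_pos \<tau> lv_nonneg by (intro mult_left_mono) auto
    thus "\<tau> ^ 3 * lv \<le> 1" using small by simp
  qed (use finite_Q v_pos mgf_dev_law ker_diag_le_lv trace_ker lv_nonneg \<tau> in \<open>auto simp: less_imp_le\<close>)
  let ?F = "{f. (\<forall>b\<in>Q. (K.smooth f b)\<^sup>2 \<le> 9 * \<tau> * ker b b) \<and>
      (\<forall>b\<in>Q. (\<Sum>c\<in>Q. v c * \<bar>ker b c\<bar> * (K.smooth f c)\<^sup>2) \<le> 16 * lv * sqrt (real k) + 28 * sqrt (\<tau> * lv))}"
  have sub: "dev -` ?F \<subseteq> ?E"
  proof
    fix y assume "y \<in> dev -` ?F"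
    hence y: "\<forall>b\<in>Q. (K.smooth (dev y) b)\<^sup>2 \<le> 9 * \<tau> * ker b b"
      "\<forall>b\<in>Q. (\<Sum>c\<in>Q. v c * \<bar>ker b c\<bar> * (K.smooth (dev y) c)\<^sup>2) \<le> 16 * lv * sqrt (real k) + 28 * sqrt (\<tau> * lv)"
      by auto
    obtain \<theta>h where h: "\<theta>h \<in> carrier_vec k" "\<forall>\<theta>. is_mle S y \<theta> \<longleftrightarrow> \<theta> = \<theta>h"
      "\<forall>a\<in>Q. \<bar>x a \<bullet> (\<theta>h - \<theta>s)\<bar> \<le> 115 * sqrt (\<tau> * lv) + 64 * lv * sqrt (real k)"
      "(\<Sum>a\<in>Q. v a * (x a \<bullet> (\<theta>h - \<theta>s))\<^sup>2) \<le> 19 * \<tau> * real k"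
      using mle_near_truth[OF \<tau> small, of y] y unfolding K.smooth_def by blast
    have u: "\<theta>h - \<theta>s \<in> carrier_vec k" using h(1) \<theta>s by simp
    have "mat_norm (hessian k (neg_log_lik S y) \<theta>s) (\<theta>h - \<theta>s) \<le> sqrt (19 * \<tau> * real k / N)"
      unfolding mat_norm_hessian[OF u] using h(4) N_pos by (intro real_sqrt_le_mono divide_right_mono) auto
    thus "y \<in> ?E" using h query_norm_le[OF u, of "115 * sqrt (\<tau> * lv) + 64 * lv * sqrt (real k)"] by auto
  qed
  have "1 - real (card Q) * (4 * real (card Q) + 4) * exp (- \<tau>) \<le> measure_pmf.prob (Pi_pmf Q 0 dev_law) ?F"
    by (rule K.noise_event_prob)
  also have "\<dots> = measure_pmf.prob (response_pmf S \<theta>s) (dev -` ?F)"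
    by (simp add: map_dev_response[symmetric] del: vimage_Collect_eq)
  also have "\<dots> \<le> measure_pmf.prob (response_pmf S \<theta>s) ?E"
    using sub by (rule measure_pmf.finite_measure_mono) simp
  finally show ?thesis .
qed

end

section \<open>Choice of the numerical constants\<close>

lemma powr_three_halves: "x \<ge> 0 \<Longrightarrow> x powr (3 / 2) = x * sqrt x" for x :: real
proof -
  assume "x \<ge> 0"
  have "x powr (3 / 2) = x powr (1 + 1 / 2)" by simp
  also have "\<dots> = x powr 1 * x powr (1 / 2)" by (rule powr_add)
  finally show ?thesis using \<open>x \<ge> 0\<close> by (simp add: powr_half_sqrt)
qed

context btl_model
begin

context
  assumes N_large: "N \<ge> 3 * 10 ^ 9 * B ^ 3 * coherence S * real k powr (3 / 2) * ln (real (num_items S)) ^ 3"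
begin

abbreviation "L \<equiv> ln (real (num_items S))"

lemma L_ge: "L \<ge> 2 / 3"
proof -
  have "ln 2 \<le> L" using items by simp
  thus ?thesis using ln2_ge_two_thirds by linarith
qed

text \<open>Recovered from \<open>lv\<close>, whose sign is known because it bounds a diagonal entry
  of a projection kernel.\<close>

lemma coherence_nonneg: "coherence S \<ge> 0"
proof -
  have "coherence S = lv * N / (4 * B * real k)" using N_pos B k_pos by (simp add: lv_def)
  thus ?thesis using lv_nonneg N_pos B by simp
qed

text \<open>The left-hand side is \<open>9 ^ 3 * 4 = 2916\<close> times \<open>B * X / N\<close>,
  and 2916 * 10^6 is below the constant 3 * 10^9 of \<open>N_large\<close>.\<close>

lemma small_leverage: "(9 * L) ^ 3 * lv * sqrt (real k) \<le> 1 / 10 ^ 6"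
proof -
  define X where "X = coherence S * (real k * sqrt (real k)) * L ^ 3"
  have X: "X \<ge> 0" using coherence_nonneg L_ge by (simp add: X_def)
  have "1 * B \<le> B\<^sup>2 * B" using B by (intro mult_right_mono) auto
  hence "B * X \<le> B ^ 3 * X" using X by (intro mult_right_mono) (simp_all add: power2_eq_square power3_eq_cube)
  moreover have "3 * 10 ^ 9 * (B ^ 3 * X) \<le> N"
    using N_large by (simp add: X_def powr_three_halves mult_ac)
  ultimately have "2916 * (B * X) \<le> N / 10 ^ 6" using X N_pos by simp
  hence "2916 * (B * X) / N \<le> 1 / 10 ^ 6" using N_pos by (simp add: field_simps)
  moreover have "(9 * L) ^ 3 * lv * sqrt (real k) = 2916 * (B * X) / N"
    by (simp add: X_def lv_def power_mult_distrib mult_ac)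
  ultimately show ?thesis by simp
qed

text \<open>At most \<open>d\<^sup>2\<close> queries give a prefactor of at most
  \<open>d\<^sup>2 * (4 * d\<^sup>2 + 4)\<close>, which for \<open>d \<ge> 2\<close> is at most
  \<open>d ^ 7\<close>; against \<open>d ^ 9\<close> in the denominator the exponent 2
  remains.\<close>

lemma failure_prob_le:
  "real (card Q) * (4 * real (card Q) + 4) * exp (- (9 * L)) \<le> real (num_items S) powr (- 2)"
proof -
  define d where "d = real (num_items S)"
  have d: "d \<ge> 2" using items by (simp add: d_def)
  have "d ^ 3 \<ge> 2 ^ 3" "d\<^sup>2 \<ge> 2\<^sup>2" using d by (intro power_mono; simp)+
  moreover have "8 * d\<^sup>2 \<le> d ^ 3 * d\<^sup>2" using \<open>d ^ 3 \<ge> 2 ^ 3\<close> by (intro mult_right_mono) auto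
  ultimately have "4 * d\<^sup>2 + 4 \<le> d ^ 3 * d\<^sup>2" by simp
  hence "d\<^sup>2 * (4 * d\<^sup>2 + 4) \<le> d\<^sup>2 * (d ^ 3 * d\<^sup>2)" by (intro mult_left_mono) auto
  moreover have "real (card Q) * (4 * real (card Q) + 4) \<le> d\<^sup>2 * (4 * d\<^sup>2 + 4)"
    using card_Q_le by (intro mult_mono) (auto simp: d_def)
  ultimately have 1: "real (card Q) * (4 * real (card Q) + 4) \<le> d ^ 7"
    by (simp add: power_add[symmetric])
  have "exp (- (9 * L)) = 1 / d ^ 9"
    using d exp_of_nat_mult[of 9 "ln d"] by (simp add: d_def[symmetric] exp_minus field_simps)
  hence "real (card Q) * (4 * real (card Q) + 4) * exp (- (9 * L)) \<le> d ^ 7 * (1 / d ^ 9)"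
    using 1 d by (intro mult_mono) auto
  also have "\<dots> = 1 / d\<^sup>2"
  proof -
    have eq: "d ^ 9 = d ^ 7 * d\<^sup>2" by (simp only: power_add[symmetric]) simp
    show ?thesis unfolding eq times_divide_eq_right mult_1_right
      using d by (intro nonzero_divide_mult_cancel_left) simp
  qed
  also have "\<dots> = d powr (- 2)" using d by (simp add: powr_minus powr_numeral divide_inverse)
  finally show ?thesis by (simp add: d_def)
qed

text \<open>As \<open>9 * L * lv = 36 * X\<close>, the coefficients become 115 * 6 = 690 and 64 * 4
  = 256, both below 1000.\<close>

lemma sup_bound_le:
  "\<sigma> * (115 * sqrt (9 * L * lv) + 64 * lv * sqrt (real k))
    \<le> 1000 * (sqrt (\<sigma>\<^sup>2 * B * coherence S * real k * L / N) + \<sigma> * B * coherence S * real k powr (3 / 2) / N)"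
proof -
  define X where "X = B * coherence S * real k * L / N"
  define Y where "Y = \<sigma> * B * coherence S * (real k * sqrt (real k)) / N"
  have X: "X \<ge> 0" and Y: "Y \<ge> 0"
    using B coherence_nonneg L_ge N_pos \<sigma>_pos by (simp_all add: X_def Y_def)
  have "9 * L * lv = 6\<^sup>2 * X" by (simp add: X_def lv_def)
  hence "sqrt (9 * L * lv) = 6 * sqrt X" by (simp only: real_sqrt_mult) simp
  hence 1: "\<sigma> * (115 * sqrt (9 * L * lv)) = 690 * (\<sigma> * sqrt X)" by simp
  have "\<sigma>\<^sup>2 * B * coherence S * real k * L / N = \<sigma>\<^sup>2 * X" by (simp add: X_def)
  hence 2: "sqrt (\<sigma>\<^sup>2 * B * coherence S * real k * L / N) = \<sigma> * sqrt X"
    using \<sigma>_pos by (simp only: real_sqrt_mult) simp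
  have 3: "\<sigma> * (64 * lv * sqrt (real k)) = 256 * Y" by (simp add: Y_def lv_def)
  have 4: "\<sigma> * B * coherence S * real k powr (3 / 2) / N = Y" by (simp add: Y_def powr_three_halves)
  have "\<sigma> * sqrt X \<ge> 0" using X \<sigma>_pos by simp
  thus ?thesis using Y unfolding distrib_left[of \<sigma>] 1 2 3 4 by argo
qed

lemma energy_bound_le: "sqrt (19 * (9 * L) * real k / N) \<le> 1000 * sqrt (B * real k * L / N)"
proof -
  have "real k * L / N \<ge> 0" using L_ge N_pos by simp
  hence "171 * (real k * L / N) \<le> (1000\<^sup>2 * B) * (real k * L / N)" using B by (intro mult_right_mono) auto
  hence "19 * (9 * L) * real k / N \<le> 1000\<^sup>2 * (B * real k * L / N)" by (simp add: mult_ac)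
  hence "sqrt (19 * (9 * L) * real k / N) \<le> sqrt (1000\<^sup>2 * (B * real k * L / N))" by (rule real_sqrt_le_mono)
  thus ?thesis by (simp only: real_sqrt_mult) simp
qed

text \<open>All three events contain the event of \<open>main_event\<close> at
  \<open>\<tau> = 9 * L\<close>. There \<open>is_mle\<close> holds for exactly one vector, so its
  bounds hold for every estimator.\<close>

lemma probability_bounds:
  "measure_pmf.prob (response_pmf S \<theta>s) {y. \<exists>!\<theta>h. is_mle S y \<theta>h} \<ge> 1 - real (num_items S) powr (- 2)"
  "measure_pmf.prob (response_pmf S \<theta>s) {y. (\<exists>\<theta>h. is_mle S y \<theta>h) \<and> (\<forall>\<theta>h. is_mle S y \<theta>h \<longrightarrow>
      query_norm S (\<theta>h - \<theta>s) \<le> 1000 * (sqrt (\<sigma>\<^sup>2 * B * coherence S * real k * L / N)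
        + \<sigma> * B * coherence S * real k powr (3 / 2) / N))} \<ge> 1 - real (num_items S) powr (- 2)"
  "measure_pmf.prob (response_pmf S \<theta>s) {y. (\<exists>\<theta>h. is_mle S y \<theta>h) \<and> (\<forall>\<theta>h. is_mle S y \<theta>h \<longrightarrow>
      mat_norm (hessian k (neg_log_lik S y) \<theta>s) (\<theta>h - \<theta>s) \<le> 1000 * sqrt (B * real k * L / N))}
    \<ge> 1 - real (num_items S) powr (- 2)"
proof -
  let ?P = "measure_pmf.prob (response_pmf S \<theta>s)"
  let ?E = "{y. \<exists>\<theta>h\<in>carrier_vec k. (\<forall>\<theta>. is_mle S y \<theta> \<longleftrightarrow> \<theta> = \<theta>h) \<and>
      query_norm S (\<theta>h - \<theta>s) \<le> \<sigma> * (115 * sqrt (9 * L * lv) + 64 * lv * sqrt (real k)) \<and>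
      mat_norm (hessian k (neg_log_lik S y) \<theta>s) (\<theta>h - \<theta>s) \<le> sqrt (19 * (9 * L) * real k / N)}"
  have "9 * L \<ge> 1" using L_ge by linarith
  hence "1 - real (num_items S) powr (- 2) \<le> ?P ?E"
    using main_event[OF _ small_leverage] failure_prob_le by linarith
  hence *: "?P A \<ge> 1 - real (num_items S) powr (- 2)" if "?E \<subseteq> A" for A
    using measure_pmf.finite_measure_mono[OF that, of "response_pmf S \<theta>s"] by simp
  show "?P {y. \<exists>!\<theta>h. is_mle S y \<theta>h} \<ge> 1 - real (num_items S) powr (- 2)"
    by (rule *) auto
  show "?P {y. (\<exists>\<theta>h. is_mle S y \<theta>h) \<and> (\<forall>\<theta>h. is_mle S y \<theta>h \<longrightarrow>
      query_norm S (\<theta>h - \<theta>s) \<le> 1000 * (sqrt (\<sigma>\<^sup>2 * B * coherence S * real k * L / N)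
        + \<sigma> * B * coherence S * real k powr (3 / 2) / N))} \<ge> 1 - real (num_items S) powr (- 2)"
    by (rule *) (use sup_bound_le in \<open>auto intro: order_trans\<close>)
  show "?P {y. (\<exists>\<theta>h. is_mle S y \<theta>h) \<and> (\<forall>\<theta>h. is_mle S y \<theta>h \<longrightarrow>
      mat_norm (hessian k (neg_log_lik S y) \<theta>s) (\<theta>h - \<theta>s) \<le> 1000 * sqrt (B * real k * L / N))}
    \<ge> 1 - real (num_items S) powr (- 2)"
    by (rule *) (use energy_bound_le in \<open>auto intro: order_trans\<close>)
qed

end

end

theorem theorem4p1:
  "\<exists>C0 C1 c :: real. C0 > 0 \<and> C1 > 0 \<and> c > 1 \<and>
    (\<forall>(S :: btl) (B :: real) (\<theta>s :: real vec).
      let d = real (num_items S);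
          N = real (sample_size S);
          k = real (dim_theta S);
          \<mu> = coherence S;
          P = (\<lambda>E :: response set. measure_pmf.prob (response_pmf S \<theta>s) E)
      in
        btl_setting S \<longrightarrow> B > 1 \<longrightarrow>
        \<theta>s \<in> carrier_vec (dim_theta S) \<longrightarrow>
        (MAX \<alpha>\<in>queries S. \<bar>logit S \<theta>s \<alpha>\<bar>) \<le> ln B \<longrightarrow>
        pos_def_mat (dim_theta S) (design_mat S) \<longrightarrow>
        N \<ge> C0 * B ^ 3 * \<mu> * k powr (3 / 2) * ln d ^ 3 \<longrightarrow>
        P {y. \<exists>!\<theta>h. is_mle S y \<theta>h} \<ge> 1 - d powr (- c) \<and>
        P {y. (\<exists>\<theta>h. is_mle S y \<theta>h) \<and>
              (\<forall>\<theta>h. is_mle S y \<theta>h \<longrightarrow>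
                query_norm S (\<theta>h - \<theta>s)
                  \<le> C1 * (sqrt ((scale S)\<^sup>2 * B * \<mu> * k * ln d / N)
                          + scale S * B * \<mu> * k powr (3 / 2) / N))}
          \<ge> 1 - d powr (- c) \<and>
        P {y. (\<exists>\<theta>h. is_mle S y \<theta>h) \<and>
              (\<forall>\<theta>h. is_mle S y \<theta>h \<longrightarrow>
                mat_norm (hessian (dim_theta S) (neg_log_lik S y) \<theta>s) (\<theta>h - \<theta>s)
                  \<le> C1 * sqrt (B * k * ln d / N))}
          \<ge> 1 - d powr (- c))"
proof (rule exI[of _ "3 * 10 ^ 9"], rule exI[of _ 1000], rule exI[of _ 2], intro conjI allI)
  fix S :: btl and B :: real and \<theta>s :: "real vec"
  show "let d = real (num_items S);
          N = real (sample_size S);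
          k = real (dim_theta S);
          \<mu> = coherence S;
          P = (\<lambda>E :: response set. measure_pmf.prob (response_pmf S \<theta>s) E)
      in
        btl_setting S \<longrightarrow> B > 1 \<longrightarrow>
        \<theta>s \<in> carrier_vec (dim_theta S) \<longrightarrow>
        (MAX \<alpha>\<in>queries S. \<bar>logit S \<theta>s \<alpha>\<bar>) \<le> ln B \<longrightarrow>
        pos_def_mat (dim_theta S) (design_mat S) \<longrightarrow>
        N \<ge> 3 * 10 ^ 9 * B ^ 3 * \<mu> * k powr (3 / 2) * ln d ^ 3 \<longrightarrow>
        P {y. \<exists>!\<theta>h. is_mle S y \<theta>h} \<ge> 1 - d powr (- 2) \<and>
        P {y. (\<exists>\<theta>h. is_mle S y \<theta>h) \<and>
              (\<forall>\<theta>h. is_mle S y \<theta>h \<longrightarrow>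
                query_norm S (\<theta>h - \<theta>s)
                  \<le> 1000 * (sqrt ((scale S)\<^sup>2 * B * \<mu> * k * ln d / N)
                          + scale S * B * \<mu> * k powr (3 / 2) / N))}
          \<ge> 1 - d powr (- 2) \<and>
        P {y. (\<exists>\<theta>h. is_mle S y \<theta>h) \<and>
              (\<forall>\<theta>h. is_mle S y \<theta>h \<longrightarrow>
                mat_norm (hessian (dim_theta S) (neg_log_lik S y) \<theta>s) (\<theta>h - \<theta>s)
                  \<le> 1000 * sqrt (B * k * ln d / N))}
          \<ge> 1 - d powr (- 2)"
    unfolding Let_def
    by (intro impI conjI btl_model.probability_bounds btl_model.intro; assumption)
qed simp_all

end
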